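(* Let $p$ be a prime with $p\ne 2$ and $p\ne 5$. Then $T_{p}$ maps $N2$ into $N2$ and maps $W$ into $W$.
   Context: All power series are in $\mathbb{Z}/2[[x]]$. Let $F=\sum_{n\ \mathrm{odd},\,n>0}x^{n^{2}}$, $G=F(x^{5})$, and $D=\sum_{n>0,\ (n,10)=1}x^{n^{2}}$ (so $D=F(x)+F(x^{25})$). For $k>0$ with $(k,10)=1$ define $D_{k}$ by $D_{1}=D$, $D_{3}=D^{8}/G$, $D_{7}=D^{2}G$, $D_{9}=D^{4}G$ and $D_{k+10}=G^{2}D_{k}$; $W$ is the $\mathbb{Z}/2$-span of all the $D_{k}$. $N2$ is the $\mathbb{Z}/2[G^{2}]$-submodule of $\mathbb{Z}/2[[x]]$ generated by $G, F, F^{2}G, F^{3}, F^{4}G$. For an odd prime $p$, the formal Hecke operator $T_{p}:\mathbb{Z}/2[[x]]\to\mathbb{Z}/2[[x]]$ is $T_{p}(\sum c_{n}x^{n})=\sum c_{pn}x^{n}+\sum c_{n}x^{pn}$. *)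

theory Defs
  imports "HOL-Library.Z2" "HOL-Computational_Algebra.Formal_Power_Series"
begin

definition F :: "bit fps" where
  "F = Abs_fps (\<lambda>m. if \<exists>n::nat. odd n \<and> n > 0 \<and> m = n^2 then 1 else 0)"

definition G :: "bit fps" where
  "G = fps_compose F (fps_X ^ 5)"

definition D :: "bit fps" where
  "D = Abs_fps (\<lambda>m. if \<exists>n::nat. n > 0 \<and> coprime n 10 \<and> m = n^2 then 1 else 0)"

definition Dbase :: "nat \<Rightarrow> bit fps" where
  "Dbase r = (if r = 1 then D
              else if r = 3 then D^8 / G
              else if r = 7 then D^2 * G
              else if r = 9 then D^4 * G
              else 0)"

definition Dk :: "nat \<Rightarrow> bit fps" where
  "Dk k = G ^ (2 * (k div 10)) * Dbase (k mod 10)"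

definition W :: "bit fps set" where
  "W = {(\<Sum>k\<in>S. fps_const (c k) * Dk k) | S c. finite S \<and> S \<subseteq> {k. k > 0 \<and> coprime k 10}}"

definition N2gens :: "bit fps list" where
  "N2gens = [G, F, F^2 * G, F^3, F^4 * G]"

text \<open>The Z/2[G^2]-submodule generated by N2gens: sums of P_i(G^2) * gen_i.\<close>
definition N2 :: "bit fps set" where
  "N2 = {(\<Sum>i<5. (\<Sum>j<n. fps_const (c i j) * G ^ (2 * j)) * N2gens ! i) | n c. True}"

definition T :: "nat \<Rightarrow> bit fps \<Rightarrow> bit fps" where
  "T p f = Abs_fps (\<lambda>n. fps_nth f (p * n) + (if p dvd n then fps_nth f (n div p) else 0))"

end

theory Submission
  imports Defs "HOL-Computational_Algebra.Computational_Algebra" "HOL-Algebra.Algebraic_Closure_Type"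
begin

text \<open>Over a field of characteristic 2 consider the theta series \<open>\<theta>\<^sub>0(v)\<close>, \<open>\<theta>\<^sub>1(v)\<close>, the sums of \<open>x\<^bsup>n\<^sup>2\<^esup> v\<^sup>n\<close> over even
  and odd \<open>n\<close>. The quotient \<open>t = \<theta>\<^sub>1/\<theta>\<^sub>0\<close> is a coordinate on the Tate curve modulo sign, with explicit addition laws.
  The nonzero \<open>p\<close>-torsion points give the roots \<open>t\<close> of a division polynomial over \<open>\<int>/2[1/F]\<close>. For a subgroup \<open>C\<close>
  of order \<open>p\<close> the series \<open>F\<close> of the quotient curve is a rational function of the values of \<open>t\<close> on \<open>C\<close>, and \<open>T\<^sub>p\<close>
  sums over the \<open>p + 1\<close> subgroups.

  At level 5 there is a series \<open>h\<close> with \<open>F = h(1 + h)\<^sup>5\<close> and \<open>G = h\<^sup>5(1 + h)\<close>. The isogeny of degree 5 from the curve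
  of \<open>x\<close> to that of \<open>x\<^sup>5\<close> is defined over \<open>\<int>/2(h)\<close>, and its dual arises by replacing \<open>h\<close> by \<open>1 + h\<close>, which exchanges
  \<open>F\<close> and \<open>G\<close>. As a trace of something integral, \<open>T\<^sub>p(F\<^sup>i G\<^sup>j)\<close> is therefore a polynomial in \<open>h\<close>, and the
  substitution of \<open>1 + h\<close> turns it into \<open>T\<^sub>p(F\<^sup>j G\<^sup>i)\<close>.

  Now \<open>N2\<close> consists of the odd polynomials in \<open>h\<close> on which this substitution agrees with the operator
  \<open>U\<^sub>5\<close> extracting the coefficients of \<open>x\<^bsup>5n\<^esup>\<close>, and \<open>U\<^sub>5\<close> commutes with \<open>T\<^sub>p\<close>. Finally, \<open>W\<close> is the image of \<open>N2\<close>
  under deletion of the exponents divisible by 5, which commutes with \<open>T\<^sub>p\<close> as well.\<close>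

text \<open>An identity of power series says nothing about the substitution of \<open>1 + h\<close>
  for \<open>h\<close>. Characteristic 2 shapes the rest. Most theta identities come out squared,
  and roots are taken because Frobenius is injective. A subgroup of order p has (p - 1)/2 nonzero
  points up to sign, a number that may be even, so a sum over subgroups is not a multiple of a sum
  over points; weights t / (sum of t over the subgroup) repair this. They need that sum to be
  nonzero, which is read off from leading exponents. The series \<open>F\<close> of a quotient curve
  has denominators as a function of t, and only its square is visibly integral, so integrality is
  proved for the square of the Hecke sum and then for the sum itself.\<close>

unbundle fps_syntax

hide_const (open) Divisibility.prime

section \<open>Rings of characteristic 2\<close>

class char2 = comm_ring_1 +
  assumes char_two: "1 + 1 = 0"
begin

lemma add_self: "x + x = 0"
proof -
  have "x + x = (1 + 1) * x" unfolding distrib_right mult_1_left ..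
  then show ?thesis by (simp only: char_two mult_zero_left)
qed

lemma add_self_left: "x + (x + y) = y"
  by (simp add: add_self flip: add.assoc)

lemma minus_eq: "- x = x"
  by (rule minus_unique) (rule add_self)

lemma diff_eq_add: "x - y = x + y"
  by (metis diff_conv_add_uminus minus_eq)

lemma add_eq_0_iff_eq: "x + y = 0 \<longleftrightarrow> x = y"
  by (metis add_self add_self_left add_0_right)

lemma two_eq_0: "2 = 0"
  using char_two one_add_one by simp

lemma square_add: "(x + y)\<^sup>2 = x\<^sup>2 + y\<^sup>2"
  by (simp add: power2_eq_square distrib_left distrib_right add.assoc mult.commute[of y x] add_self_left)

lemmas char2 = add_self add_self_left minus_eq diff_eq_add two_eq_0

end

lemma square_sum: "(\<Sum>i\<in>I. f i :: 'a::char2)\<^sup>2 = (\<Sum>i\<in>I. (f i)\<^sup>2)"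
  by (induct I rule: infinite_finite_induct) (auto simp: square_add)

lemma square_inj: "(x::'a::{idom,char2})\<^sup>2 = y\<^sup>2 \<Longrightarrow> x = y"
  by (metis square_add add_eq_0_iff_eq power_eq_0_iff)

instance bit :: char2 by standard (simp only: one_add_one bit_2_eq_0)
instance alg_closure :: ("{field,char2}") char2
proof
  have "to_ac (1 + 1 :: 'a) = 1 + 1" unfolding to_ac_add by (simp only: to_ac_1)
  then show "1 + 1 = (0 :: 'a alg_closure)" by (simp only: char_two to_ac_0)
qed
instance fls :: (char2) char2
proof
  show "1 + 1 = (0 :: 'a fls)"
    by (rule fls_eqI) (simp only: fls_plus_nth fls_one_nth fls_zero_nth char_two add_0_left split: if_split, blast)
qed

instance fps :: (char2) char2
proof
  show "1 + 1 = (0 :: 'a fps)"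
    by (rule fps_ext) (simp only: fps_add_nth fps_one_nth fps_zero_nth char_two add_0_left split: if_split, blast)
qed

instance poly :: (char2) char2
proof
  show "1 + 1 = (0 :: 'a poly)"
    by (rule poly_eqI) (simp only: coeff_add coeff_1 coeff_0 char_two add_0_left of_bool_def split: if_split, blast)
qed

section \<open>Laurent series as sums over index sets\<close>

definition locfin :: "'i set \<Rightarrow> ('i \<Rightarrow> int) \<Rightarrow> bool" where
  "locfin A d \<longleftrightarrow> (\<forall>K. finite {a \<in> A. d a \<le> K})"

text \<open>The series of all \<open>c a\<close> times x to the power \<open>d a\<close>;
  \<open>locfin\<close> makes every coefficient a finite sum and bounds the exponents below. Keeping
  the index set turns identities of theta series into bijections and involutions of
  integers.\<close>

definition lsum :: "'i set \<Rightarrow> ('i \<Rightarrow> 'a::comm_ring_1) \<Rightarrow> ('i \<Rightarrow> int) \<Rightarrow> 'a fls" where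
  "lsum A c d = Abs_fls (\<lambda>k. \<Sum>a | a \<in> A \<and> d a = k. c a)"

lemma locfin_fibre: "locfin A d \<Longrightarrow> finite {a. a \<in> A \<and> d a = k}"
  unfolding locfin_def by (rule finite_subset[of _ "{a \<in> A. d a \<le> k}"]) auto

lemma locfin_bound:
  assumes "locfin A d"
  obtains b where "\<And>a. a \<in> A \<Longrightarrow> b \<le> d a"
proof -
  have f: "finite {a \<in> A. d a \<le> 0}" using assms by (simp add: locfin_def)
  let ?b = "Min (insert 0 (d ` {a \<in> A. d a \<le> 0}))"
  have "?b \<le> d a" if "a \<in> A" for a
  proof (cases "d a \<le> 0")
    case True then show ?thesis using f that by (intro Min_le) auto
  next
    case False
    have "?b \<le> 0" using f by (intro Min_le) auto
    then show ?thesis using False by simp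
  qed
  then show ?thesis using that by blast
qed

lemma lsum_nth:
  assumes "locfin A d"
  shows "lsum A c d $$ k = (\<Sum>a | a \<in> A \<and> d a = k. c a)"
proof -
  obtain b where b: "\<And>a. a \<in> A \<Longrightarrow> b \<le> d a" using locfin_bound[OF assms] by blast
  have "\<exists>N. \<forall>n. n < N \<longrightarrow> (\<Sum>a | a \<in> A \<and> d a = n. c a) = 0"
  proof (intro exI allI impI)
    fix n assume "n < b"
    then have "{a. a \<in> A \<and> d a = n} = {}" using b by force
    then show "(\<Sum>a | a \<in> A \<and> d a = n. c a) = 0" by (simp only: sum.empty)
  qed
  then show ?thesis unfolding lsum_def by (simp add: nth_Abs_fls_ex_lower_bound)
qed

lemma lsum_reindex:
  assumes "bij_betw g A B" "\<And>a. a \<in> A \<Longrightarrow> c' (g a) = c a" "\<And>a. a \<in> A \<Longrightarrow> d' (g a) = d a"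
  shows "lsum A c d = lsum B c' d'"
proof -
  have "(\<Sum>a | a \<in> A \<and> d a = k. c a) = (\<Sum>b | b \<in> B \<and> d' b = k. c' b)" for k
  proof (rule sum.reindex_bij_betw[symmetric, THEN trans, symmetric])
    show "bij_betw g {a. a \<in> A \<and> d a = k} {b. b \<in> B \<and> d' b = k}"
      using assms unfolding bij_betw_def inj_on_def by auto
    show "(\<Sum>a | a \<in> A \<and> d a = k. c' (g a)) = (\<Sum>a | a \<in> A \<and> d a = k. c a)"
      by (rule sum.cong) (auto simp: assms)
  qed
  then show ?thesis by (simp add: lsum_def)
qed

lemma lsum_cong:
  assumes "\<And>a. a \<in> A \<Longrightarrow> c' a = c a" "\<And>a. a \<in> A \<Longrightarrow> d' a = d a"
  shows "lsum A c d = lsum A c' d'"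
  by (rule lsum_reindex[of id]) (auto simp: assms)

lemma locfin_subset: "locfin B d \<Longrightarrow> A \<subseteq> B \<Longrightarrow> locfin A d"
  unfolding locfin_def
proof (intro allI)
  fix K assume "\<forall>K. finite {a \<in> B. d a \<le> K}" "A \<subseteq> B"
  then show "finite {a \<in> A. d a \<le> K}"
    by (intro finite_subset[of "{a \<in> A. d a \<le> K}" "{a \<in> B. d a \<le> K}"]) auto
qed

lemma locfin_inj:
  assumes "locfin B d'" "inj_on g A" "g ` A \<subseteq> B" "\<And>a. a \<in> A \<Longrightarrow> d' (g a) \<le> d a"
  shows "locfin A d"
  unfolding locfin_def
proof
  fix K
  have "finite (g ` {a \<in> A. d a \<le> K})"
    by (rule finite_subset[of _ "{b \<in> B. d' b \<le> K}"])
      (use assms(1,3,4) in \<open>auto simp: locfin_def intro: order_trans\<close>)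
  then show "finite {a \<in> A. d a \<le> K}"
    by (rule finite_imageD) (use assms(2) in \<open>auto simp: inj_on_def\<close>)
qed

lemma locfin_times:
  assumes "locfin A d" "locfin B d'"
  shows "locfin (A \<times> B) (\<lambda>(a, b). d a + d' b)"
  unfolding locfin_def
proof
  fix K
  obtain b1 b2 where b: "\<And>a. a \<in> A \<Longrightarrow> b1 \<le> d a" "\<And>a. a \<in> B \<Longrightarrow> b2 \<le> d' a"
    using locfin_bound[OF assms(1)] locfin_bound[OF assms(2)] by metis
  have "{x \<in> A \<times> B. (case x of (a, b) \<Rightarrow> d a + d' b) \<le> K} \<subseteq>
      {a \<in> A. d a \<le> K - b2} \<times> {b \<in> B. d' b \<le> K - b1}"
    using b by fastforce
  then show "finite {x \<in> A \<times> B. (case x of (a, b) \<Rightarrow> d a + d' b) \<le> K}"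
    by (rule finite_subset) (use assms in \<open>auto simp: locfin_def\<close>)
qed

lemma fls_times_nth_lower:
  fixes f g :: "'a::comm_ring_1 fls"
  assumes "\<And>k. k < m \<Longrightarrow> f $$ k = 0" "\<And>k. k < n \<Longrightarrow> g $$ k = 0"
  shows "(f * g) $$ k = (\<Sum>i=m..k - n. f $$ i * g $$ (k - i))"
proof (cases "f = 0 \<or> g = 0")
  case False
  then have s: "m \<le> fls_subdegree f" "n \<le> fls_subdegree g"
    using assms by (auto intro!: fls_subdegree_geI)
  have "(f * g) $$ k = (\<Sum>i=fls_subdegree f..k - fls_subdegree g. f $$ i * g $$ (k - i))"
    by (rule fls_times_nth(2))
  also have "\<dots> = (\<Sum>i=m..k - n. f $$ i * g $$ (k - i))"
    by (rule sum.mono_neutral_left) (use s in auto)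
  finally show ?thesis .
qed auto

lemma lsum_times:
  assumes A: "locfin A d" and B: "locfin B d'"
  shows "lsum A c d * lsum B c' d' = lsum (A \<times> B) (\<lambda>(a, b). c a * c' b) (\<lambda>(a, b). d a + d' b)"
proof (rule fls_eqI)
  fix k
  obtain m n where b: "\<And>a. a \<in> A \<Longrightarrow> m \<le> d a" "\<And>a. a \<in> B \<Longrightarrow> n \<le> d' a"
    using locfin_bound[OF assms(1)] locfin_bound[OF assms(2)] by metis
  have z: "lsum A c d $$ i = 0" if "i < m" for i
  proof -
    have e: "{a. a \<in> A \<and> d a = i} = {}" using b that by force
    show ?thesis unfolding lsum_nth[OF A] e by simp
  qed
  have z': "lsum B c' d' $$ i = 0" if "i < n" for i
  proof -
    have e: "{a. a \<in> B \<and> d' a = i} = {}" using b that by force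
    show ?thesis unfolding lsum_nth[OF B] e by simp
  qed
  let ?S = "\<lambda>i. {a. a \<in> A \<and> d a = i} \<times> {b. b \<in> B \<and> d' b = k - i}"
  have "(lsum A c d * lsum B c' d') $$ k = (\<Sum>i=m..k - n. \<Sum>x\<in>?S i. c (fst x) * c' (snd x))"
    by (subst fls_times_nth_lower[OF z z'], assumption, assumption)
      (simp add: lsum_nth[OF A] lsum_nth[OF B] sum_product sum.cartesian_product split_def)
  also have "\<dots> = (\<Sum>x\<in>(\<Union>i\<in>{m..k - n}. ?S i). c (fst x) * c' (snd x))"
    by (rule sum.UNION_disjoint[symmetric]) (auto intro!: finite_cartesian_product locfin_fibre A B)
  also have "(\<Union>i\<in>{m..k - n}. ?S i) = {x. x \<in> A \<times> B \<and> (case x of (a, b) \<Rightarrow> d a + d' b) = k}"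
    using b by (fastforce simp: Bex_def)
  finally show "(lsum A c d * lsum B c' d') $$ k =
      lsum (A \<times> B) (\<lambda>(a, b). c a * c' b) (\<lambda>(a, b). d a + d' b) $$ k"
    by (subst lsum_nth[OF locfin_times[OF A B]]) (simp add: split_def)
qed

text \<open>Each orbit {a, \<open>g a\<close>} has two elements and contributes
  \<open>c a + c a = 0\<close>.\<close>

lemma sum_involution_char2:
  fixes c :: "'i \<Rightarrow> 'a::char2"
  assumes "finite S" "\<And>a. a \<in> S \<Longrightarrow> g a \<in> S" "\<And>a. a \<in> S \<Longrightarrow> g (g a) = a"
    "\<And>a. a \<in> S \<Longrightarrow> g a \<noteq> a" "\<And>a. a \<in> S \<Longrightarrow> c (g a) = c a"
  shows "(\<Sum>a\<in>S. c a) = 0"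
  using assms
proof (induct "card S" arbitrary: S rule: less_induct)
  case less
  show ?case
  proof (cases "S = {}")
    case False
    then obtain a where a: "a \<in> S" by auto
    let ?S = "S - {a, g a}"
    have "card ?S < card S" using a less.prems(1) by (intro psubset_card_mono) auto
    then have "(\<Sum>a\<in>?S. c a) = 0"
      using less.prems a by (intro less.hyps) (auto, metis+)
    moreover have "S = insert a (insert (g a) ?S)" using a less.prems(2) by auto
    then have "sum c S = sum c (insert a (insert (g a) ?S))" by simp
    ultimately show ?thesis
      using less.prems(1) less.prems(4)[OF a] less.prems(5)[OF a] by (simp add: sum.insert_if char2)
  qed simp
qed

lemma lsum_cancel:
  fixes c :: "'i \<Rightarrow> 'a::char2"
  assumes "locfin A d" "\<And>a. a \<in> A \<Longrightarrow> g a \<in> A" "\<And>a. a \<in> A \<Longrightarrow> g (g a) = a"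
    "\<And>a. a \<in> A \<Longrightarrow> g a \<noteq> a" "\<And>a. a \<in> A \<Longrightarrow> c (g a) = c a" "\<And>a. a \<in> A \<Longrightarrow> d (g a) = d a"
  shows "lsum A c d = 0"
  by (rule fls_eqI, simp add: lsum_nth assms(1), rule sum_involution_char2[where g = g])
    (use assms in \<open>auto intro: locfin_fibre\<close>)

lemma locfin_Un: "locfin A d \<Longrightarrow> locfin B d \<Longrightarrow> locfin (A \<union> B) d"
  by (auto simp: locfin_def Collect_disj_eq conj_disj_distribR)

lemma lsum_Un:
  assumes "locfin A d" "locfin B d" "A \<inter> B = {}"
  shows "lsum (A \<union> B) c d = lsum A c d + lsum B c d"
proof (rule fls_eqI)
  fix k
  have "{a. a \<in> A \<union> B \<and> d a = k} = {a. a \<in> A \<and> d a = k} \<union> {a. a \<in> B \<and> d a = k}" by auto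
  then show "lsum (A \<union> B) c d $$ k = (lsum A c d + lsum B c d) $$ k"
    using assms by (simp add: lsum_nth locfin_Un locfin_fibre) (subst sum.union_disjoint, auto intro: locfin_fibre)
qed

lemma lsum_split:
  assumes "locfin A d"
  shows "lsum A c d = lsum {a \<in> A. P a} c d + lsum {a \<in> A. \<not> P a} c d"
proof -
  have "A = {a \<in> A. P a} \<union> {a \<in> A. \<not> P a}" by auto
  then have "lsum A c d = lsum ({a \<in> A. P a} \<union> {a \<in> A. \<not> P a}) c d" by simp
  also have "\<dots> = lsum {a \<in> A. P a} c d + lsum {a \<in> A. \<not> P a} c d"
    by (rule lsum_Un) (auto intro: locfin_subset[OF assms])
  finally show ?thesis .
qed

lemma lsum_cancel_part:
  fixes c :: "'i \<Rightarrow> 'a::char2"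
  assumes "locfin A d" "\<And>a. a \<in> A \<Longrightarrow> \<not> P a \<Longrightarrow> g a \<in> A \<and> \<not> P (g a) \<and> g (g a) = a \<and> g a \<noteq> a \<and> c (g a) = c a \<and> d (g a) = d a"
  shows "lsum A c d = lsum {a \<in> A. P a} c d"
proof -
  have "lsum {a \<in> A. \<not> P a} c d = 0"
    by (rule lsum_cancel[where g = g]) (use assms(2) in \<open>auto intro: locfin_subset[OF assms(1)]\<close>)
  then show ?thesis using lsum_split[OF assms(1), of c P] by simp
qed

text \<open>In the double sum the terms at (a, b) and (b, a) cancel, and only the diagonal is
  left.\<close>

lemma lsum_square:
  fixes c :: "'i \<Rightarrow> 'a::char2"
  assumes "locfin A d"
  shows "(lsum A c d)\<^sup>2 = lsum A (\<lambda>a. (c a)\<^sup>2) (\<lambda>a. 2 * d a)"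
proof -
  have "(lsum A c d)\<^sup>2 = lsum (A \<times> A) (\<lambda>(a, b). c a * c b) (\<lambda>(a, b). d a + d b)"
    by (simp add: power2_eq_square lsum_times assms)
  also have "\<dots> = lsum {x \<in> A \<times> A. fst x = snd x} (\<lambda>(a, b). c a * c b) (\<lambda>(a, b). d a + d b)"
    by (rule lsum_cancel_part[where g = prod.swap]) (auto intro: locfin_times assms simp: mult.commute)
  also have "\<dots> = lsum A (\<lambda>a. (c a)\<^sup>2) (\<lambda>a. 2 * d a)"
    by (rule lsum_reindex[of fst])
      (auto simp: bij_betw_def inj_on_def image_iff power2_eq_square)
  finally show ?thesis .
qed

lemma lsum_sum_coeff:
  assumes "locfin A d" "finite I"
  shows "(\<Sum>i\<in>I. lsum A (c i) d) = lsum A (\<lambda>a. \<Sum>i\<in>I. c i a) d"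
  using assms(2)
proof (induct I)
  case empty
  then show ?case by (simp add: lsum_nth assms fls_eq_iff)
next
  case (insert i I)
  have "lsum A (c i) d + lsum A (\<lambda>a. \<Sum>i\<in>I. c i a) d = lsum A (\<lambda>a. c i a + (\<Sum>i\<in>I. c i a)) d"
    by (rule fls_eqI) (simp add: lsum_nth assms sum.distrib)
  then show ?case using insert by simp
qed

lemma locfin_Sigma_finite:
  assumes "finite I" "\<And>i. i \<in> I \<Longrightarrow> locfin (A i) (d i)"
  shows "locfin (Sigma I A) (\<lambda>(i, a). d i a)"
  unfolding locfin_def
proof
  fix K
  have "{x \<in> Sigma I A. (case x of (i, a) \<Rightarrow> d i a) \<le> K} = Sigma I (\<lambda>i. {a \<in> A i. d i a \<le> K})" by auto
  then show "finite {x \<in> Sigma I A. (case x of (i, a) \<Rightarrow> d i a) \<le> K}"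
    using assms by (auto simp: locfin_def intro!: finite_SigmaI)
qed

lemma lsum_Sigma_finite:
  assumes "finite I" "\<And>i. i \<in> I \<Longrightarrow> locfin (A i) (d i)"
  shows "(\<Sum>i\<in>I. lsum (A i) (c i) (d i)) = lsum (Sigma I A) (\<lambda>(i, a). c i a) (\<lambda>(i, a). d i a)"
proof (rule fls_eqI)
  fix k
  have "{x. x \<in> Sigma I A \<and> (case x of (i, a) \<Rightarrow> d i a) = k} = Sigma I (\<lambda>i. {a. a \<in> A i \<and> d i a = k})" by auto
  then show "(\<Sum>i\<in>I. lsum (A i) (c i) (d i)) $$ k = lsum (Sigma I A) (\<lambda>(i, a). c i a) (\<lambda>(i, a). d i a) $$ k"
    using assms
    by (simp add: fls_nth_sum lsum_nth locfin_Sigma_finite sum.Sigma locfin_fibre)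
qed

lemma lsum_mult_const: "locfin A d \<Longrightarrow> lsum A (\<lambda>a. r * c a) d = fls_const r * lsum A c d"
  by (rule fls_eqI) (simp add: lsum_nth sum_distrib_left)

lemma lsum_shift:
  assumes "locfin A d"
  shows "lsum A c (\<lambda>a. d a + s) = fls_shift (- s) (lsum A c d)"
proof -
  have l: "locfin A (\<lambda>a. d a + s)"
    unfolding locfin_def
  proof
    fix K show "finite {a \<in> A. d a + s \<le> K}"
      using assms[unfolded locfin_def, rule_format, of "K - s"] by (simp add: algebra_simps)
  qed
  show ?thesis
    by (rule fls_eqI) (simp add: lsum_nth[OF l] lsum_nth[OF assms], rule sum.cong, auto)
qed

lemma lsum_leading:
  assumes "locfin A d" "a \<in> A" "\<And>b. b \<in> A \<Longrightarrow> b \<noteq> a \<Longrightarrow> d a < d b"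
  shows "lsum A c d $$ d a = c a" "k < d a \<Longrightarrow> lsum A c d $$ k = 0"
proof -
  have "{b. b \<in> A \<and> d b = d a} = {a}" using assms by force
  then show "lsum A c d $$ d a = c a" by (simp add: lsum_nth assms)
  assume k: "k < d a"
  have "{b. b \<in> A \<and> d b = k} = {}"
  proof -
    have False if "b \<in> A" "d b = k" for b
      using assms(3)[of b] that k by (cases "b = a") auto
    then show ?thesis by auto
  qed
  then show "lsum A c d $$ k = 0" by (simp only: lsum_nth[OF assms(1)] sum.empty)
qed

section \<open>Theta series in characteristic two\<close>

text \<open>Here \<open>q = x\<^sup>M\<close> and \<open>v = c x\<^sup>m\<close>: \<open>theta b M c m\<close> is \<open>\<theta>\<^sub>1(v)\<close> if \<open>b\<close> holds and \<open>\<theta>\<^sub>0(v)\<close> otherwise, \<open>FF M c\<close> is \<open>F(c x\<^sup>M)\<close>,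
  and \<open>lam M c m\<close> is the Lambert series of all \<open>q\<^bsup>2ab\<^esup>(v\<^sup>b + v\<^bsup>-b\<^esup>)\<close> with \<open>a\<close>, \<open>b\<close> odd and positive,
  which converges for \<open>|m| < 2M\<close>. The instances of theta needed are \<open>v = \<zeta> x\<^sup>m\<close> with \<open>\<zeta>\<close> a root of unity.\<close>
definition theta :: "bool \<Rightarrow> int \<Rightarrow> 'a::{field,char2} \<Rightarrow> int \<Rightarrow> 'a fls" where
  "theta b M c m = lsum {n. odd n = b} (\<lambda>n. c powi n) (\<lambda>n. M * n\<^sup>2 + m * n)"

abbreviation posodd :: "int set" where "posodd \<equiv> {n. odd n \<and> 0 < n}"

definition FF :: "int \<Rightarrow> 'a::{field,char2} \<Rightarrow> 'a fls" where
  "FF M c = lsum posodd (\<lambda>n. c powi (n\<^sup>2)) (\<lambda>n. M * n\<^sup>2)"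

definition lam :: "int \<Rightarrow> 'a::{field,char2} \<Rightarrow> int \<Rightarrow> 'a fls" where
  "lam M c m = lsum (posodd \<times> {b. odd b}) (\<lambda>(a, b). c powi b) (\<lambda>(a, b). 2 * M * a * \<bar>b\<bar> + m * b)"

lemma locfin_quadratic: "0 < M \<Longrightarrow> locfin A (\<lambda>n. M * n\<^sup>2 + m * n :: int)"
  unfolding locfin_def
proof
  fix K assume M: "0 < M"
  have "\<bar>n\<bar> \<le> \<bar>m\<bar> + \<bar>K\<bar>" if "M * n\<^sup>2 + m * n \<le> K" for n
  proof (rule ccontr)
    assume "\<not> ?thesis"
    then have n: "\<bar>n\<bar> \<ge> \<bar>m\<bar> + \<bar>K\<bar> + 1" by simp
    have "\<bar>m * n\<bar> = \<bar>m\<bar> * \<bar>n\<bar>" by (simp add: abs_mult)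
    then have "m * n \<ge> - (\<bar>m\<bar> * \<bar>n\<bar>)" by linarith
    moreover have "M * n\<^sup>2 \<ge> 1 * n\<^sup>2" using M by (intro mult_right_mono) auto
    moreover have "n\<^sup>2 = \<bar>n\<bar> * \<bar>n\<bar>" by (simp add: power2_eq_square)
    ultimately have "\<bar>n\<bar> * (\<bar>n\<bar> - \<bar>m\<bar>) \<le> K" using that by (simp add: algebra_simps)
    moreover have "\<bar>n\<bar> * (\<bar>n\<bar> - \<bar>m\<bar>) \<ge> \<bar>n\<bar> * 1" using n by (intro mult_left_mono) auto
    ultimately show False using n by linarith
  qed
  then have "{n \<in> A. M * n\<^sup>2 + m * n \<le> K} \<subseteq> {-(\<bar>m\<bar> + \<bar>K\<bar>)..\<bar>m\<bar> + \<bar>K\<bar>}"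
    by (force simp: abs_le_iff)
  then show "finite {n \<in> A. M * n\<^sup>2 + m * n \<le> K}" by (rule finite_subset) simp
qed

lemma locfin_square: "0 < M \<Longrightarrow> locfin A (\<lambda>n. M * n\<^sup>2 :: int)"
  using locfin_quadratic[of M A 0] by simp

text \<open>Because |m| < 2M, the exponent is at least a |b|, so a bound on it bounds both
  indices.\<close>

lemma locfin_lam:
  assumes "\<bar>m\<bar> < 2 * M"
  shows "locfin (posodd \<times> {b. odd b}) (\<lambda>(a, b). 2 * M * a * \<bar>b\<bar> + m * b)"
  unfolding locfin_def
proof
  fix K
  have *: "a \<le> K \<and> \<bar>b\<bar> \<le> K" if "0 < a" "odd b" "2 * M * a * \<bar>b\<bar> + m * b \<le> K" for a b
  proof -
    have b: "\<bar>b\<bar> \<ge> 1" using that(2) by (cases "b = 0") auto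
    have "\<bar>m * b\<bar> = \<bar>m\<bar> * \<bar>b\<bar>" by (simp add: abs_mult)
    then have "m * b \<ge> - (\<bar>m\<bar> * \<bar>b\<bar>)" by linarith
    moreover have "\<bar>m\<bar> * \<bar>b\<bar> * 1 \<le> \<bar>m\<bar> * \<bar>b\<bar> * a" using that(1) by (intro mult_left_mono) auto
    ultimately have "(2 * M - \<bar>m\<bar>) * (a * \<bar>b\<bar>) \<le> K" using that(3) by (simp add: algebra_simps)
    moreover have "(2 * M - \<bar>m\<bar>) * (a * \<bar>b\<bar>) \<ge> 1 * (a * \<bar>b\<bar>)"
      using assms that(1) by (intro mult_right_mono) auto
    moreover have "a * \<bar>b\<bar> \<ge> a * 1" "a * \<bar>b\<bar> \<ge> 1 * \<bar>b\<bar>"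
      using b that(1) by (auto intro!: mult_left_mono mult_right_mono simp del: mult_1_right mult_1)
    ultimately show ?thesis by linarith
  qed
  have "{x \<in> posodd \<times> {b. odd b}. (case x of (a, b) \<Rightarrow> 2 * M * a * \<bar>b\<bar> + m * b) \<le> K}
      \<subseteq> {0..K} \<times> {-K..K}"
    using * by (fastforce simp: abs_le_iff)
  then show "finite {x \<in> posodd \<times> {b. odd b}. (case x of (a, b) \<Rightarrow> 2 * M * a * \<bar>b\<bar> + m * b) \<le> K}"
    by (rule finite_subset) simp
qed

lemma theta_mult:
  assumes M: "0 < M"
  shows "theta x M c m * theta y M e l = lsum ({n. odd n = x} \<times> {n. odd n = y})
    (\<lambda>(a, b). c powi a * e powi b) (\<lambda>(a, b). M * a\<^sup>2 + m * a + (M * b\<^sup>2 + l * b))"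
  unfolding theta_def by (rule lsum_times) (auto intro: locfin_quadratic M)

text \<open>The bracket is a double series over the pairs (r, s) with r + s of parity
  \<open>b\<close>, and squaring it doubles the exponents. As 2r^2 + 2s^2 = (r + s)^2 + (r - s)^2,
  the map to (r + s, r - s) identifies these pairs with all pairs both of whose entries have parity
  \<open>b\<close>.\<close>

lemma theta_addition:
  fixes c e :: "'a::{field,char2}"
  assumes M: "0 < M" and nz: "c \<noteq> 0" "e \<noteq> 0"
  shows "(theta False M c m * theta b M e l + theta True M c m * theta (\<not> b) M e l)\<^sup>2
    = theta b M (c * e) (m + l) * theta b M (c / e) (m - l)"
proof -
  let ?d = "\<lambda>(a, b). M * a\<^sup>2 + m * a + (M * b\<^sup>2 + l * b)"
  let ?c = "\<lambda>(a::int, b::int). c powi a * e powi b"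
  let ?S = "{(r::int, s::int). odd (r + s) = b}"
  have lf: "locfin A ?d" for A
    by (rule locfin_subset[OF locfin_times[OF locfin_quadratic[OF M, of UNIV m] locfin_quadratic[OF M, of UNIV l]]]) auto
  have "theta False M c m * theta b M e l + theta True M c m * theta (\<not> b) M e l =
      lsum ({n. odd n = False} \<times> {n. odd n = b} \<union> {n. odd n = True} \<times> {n. odd n = (\<not> b)}) ?c ?d"
    unfolding theta_mult[OF M] by (rule lsum_Un[symmetric]) (auto intro: lf)
  also have "{n. odd n = False} \<times> {n. odd n = b} \<union> {n. odd n = True} \<times> {n. odd n = (\<not> b)} = ?S"
    by auto
  finally have "(theta False M c m * theta b M e l + theta True M c m * theta (\<not> b) M e l)\<^sup>2
      = lsum ?S (\<lambda>a. (?c a)\<^sup>2) (\<lambda>a. 2 * ?d a)" by (simp only: lsum_square lf)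
  also have "\<dots> = lsum ({n. odd n = b} \<times> {n. odd n = b}) (\<lambda>(r, s). (c * e) powi r * (c / e) powi s)
      (\<lambda>(a, b). M * a\<^sup>2 + (m + l) * a + (M * b\<^sup>2 + (m - l) * b))"
  proof (rule lsum_reindex[of "\<lambda>(r, s). (r + s, r - s)"])
    show "bij_betw (\<lambda>(r, s). (r + s, r - s)) ?S ({n. odd n = b} \<times> {n. odd n = b})"
    proof (rule bij_betwI[of _ _ _ "\<lambda>(u, v). ((u + v) div 2, (u - v) div 2)"])
      have par: "odd ((u + v) div 2 + (u - v) div 2) = odd u" if "odd u = odd v" for u v :: int
      proof -
        have "even (u + v)" "even (u - v)" using that by auto
        then have "(u + v) div 2 + (u - v) div 2 = u" by (elim evenE) simp
        then show ?thesis by simp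
      qed
      show "(\<lambda>(u, v). ((u + v) div 2, (u - v) div 2)) \<in> {n. odd n = b} \<times> {n. odd n = b} \<rightarrow> ?S"
      proof (rule Pi_I)
        fix y :: "int \<times> int" assume "y \<in> {n. odd n = b} \<times> {n. odd n = b}"
        then obtain u v where y: "y = (u, v)" "odd u = b" "odd v = b" by auto
        show "(case y of (u, v) \<Rightarrow> ((u + v) div 2, (u - v) div 2)) \<in> ?S"
          using par[of u v] unfolding y(1) split mem_Collect_eq by (simp only: y(2,3))
      qed
      fix x :: "int \<times> int" assume "x \<in> {n. odd n = b} \<times> {n. odd n = b}"
      then obtain u v where x: "x = (u, v)" and "odd u = b" "odd v = b" by auto
      then have "even (u + v)" "even (u - v)" by auto
      then show "(case (case x of (u, v) \<Rightarrow> ((u + v) div 2, (u - v) div 2)) of (r, s) \<Rightarrow> (r + s, r - s)) = x"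
        unfolding x by (elim evenE) simp
    qed auto
    fix x assume "x \<in> ?S"
    obtain r s where x: "x = (r, s)" by force
    have "(c * e) powi (r + s) * (c / e) powi (r - s) = (c powi r * e powi s)\<^sup>2"
      using nz by (simp add: power_int_mult_distrib power_int_divide_distrib power_int_add power_int_diff
          field_simps power2_eq_square)
    then show "(case (case x of (r, s) \<Rightarrow> (r + s, r - s)) of (r, s) \<Rightarrow> (c * e) powi r * (c / e) powi s) = (?c x)\<^sup>2"
      by (simp add: x)
    show "(case (case x of (r, s) \<Rightarrow> (r + s, r - s)) of (a, b) \<Rightarrow> M * a\<^sup>2 + (m + l) * a + (M * b\<^sup>2 + (m - l) * b)) = 2 * ?d x"
      by (simp add: x power2_eq_square algebra_simps)
  qed
  also have "\<dots> = theta b M (c * e) (m + l) * theta b M (c / e) (m - l)"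
    by (simp add: theta_mult M)
  finally show ?thesis .
qed

text \<open>The change of variables of the addition formula, applied to an even a and an odd b.
  Given r = a + b and s = |a - b|, the unordered pair is known, and exactly one of its members is
  even; so s runs over the positive odd numbers only, which produces \<open>FF\<close> instead of a
  second theta series.\<close>

lemma theta_double:
  fixes c :: "'a::{field,char2}"
  assumes M: "0 < M" and nz: "c \<noteq> 0"
  shows "(theta False M c m * theta True M c m)\<^sup>2 = FF M 1 * theta True M (c\<^sup>2) (2 * m)"
proof -
  let ?d = "\<lambda>(a, b). M * a\<^sup>2 + m * a + (M * b\<^sup>2 + m * b)"
  let ?c = "\<lambda>(a::int, b::int). c powi a * c powi b"
  let ?S = "{n::int. odd n = False} \<times> {n::int. odd n = True}"
  have lf: "locfin A ?d" for A
    by (rule locfin_subset[OF locfin_times[OF locfin_quadratic[OF M, of UNIV m] locfin_quadratic[OF M, of UNIV m]]]) auto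
  have "(theta False M c m * theta True M c m)\<^sup>2 = lsum ?S (\<lambda>a. (?c a)\<^sup>2) (\<lambda>a. 2 * ?d a)"
    unfolding theta_mult[OF M] by (rule lsum_square) (rule lf)
  also have "\<dots> = lsum (posodd \<times> {n. odd n = True}) (\<lambda>(s, r). 1 powi s\<^sup>2 * (c\<^sup>2) powi r)
      (\<lambda>(s, r). M * s\<^sup>2 + (M * r\<^sup>2 + 2 * m * r))"
  proof (rule lsum_reindex[of "\<lambda>(a, b). (\<bar>a - b\<bar>, a + b)"])
    show "bij_betw (\<lambda>(a, b). (\<bar>a - b\<bar>, a + b)) ?S (posodd \<times> {n. odd n = True})"
      unfolding bij_betw_def
    proof
      show "inj_on (\<lambda>(a, b). (\<bar>a - b\<bar>, a + b)) ?S"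
        by (rule inj_onI) (auto simp: abs_if split: if_splits, presburger+)
      show "(\<lambda>(a, b). (\<bar>a - b\<bar>, a + b)) ` ?S = posodd \<times> {n. odd n = True}"
      proof (intro equalityI subsetI)
        fix x assume "x \<in> posodd \<times> {n::int. odd n = True}"
        then obtain s r where x: "x = (s, r)" "odd s" "0 < s" "odd r" by auto
        define a b where "a = (r + s) div 2" and "b = (r - s) div 2"
        have ab: "a + b = r" "a - b = s" unfolding a_def b_def using x by presburger+
        show "x \<in> (\<lambda>(a, b). (\<bar>a - b\<bar>, a + b)) ` ?S"
        proof (cases "even a")
          case True
          then show ?thesis using ab x by (intro image_eqI[of _ _ "(a, b)"]) auto
        next
          case False
          then show ?thesis using ab x by (intro image_eqI[of _ _ "(b, a)"]) auto
        qed
      qed (auto split: if_splits)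
    qed
    fix x assume "x \<in> ?S"
    obtain a b where x: "x = (a, b)" by force
    show "(case (case x of (a, b) \<Rightarrow> (\<bar>a - b\<bar>, a + b)) of (s, r) \<Rightarrow> 1 powi s\<^sup>2 * (c\<^sup>2) powi r) = (?c x)\<^sup>2"
      using nz by (simp add: x power_int_add power_mult_distrib power_int_power' power_int_power mult.commute)
    show "(case (case x of (a, b) \<Rightarrow> (\<bar>a - b\<bar>, a + b)) of (s, r) \<Rightarrow> M * s\<^sup>2 + (M * r\<^sup>2 + 2 * m * r)) = 2 * ?d x"
      by (simp add: x power2_eq_square algebra_simps)
  qed
  also have "\<dots> = FF M 1 * theta True M (c\<^sup>2) (2 * m)"
    unfolding FF_def theta_def by (rule lsum_times[symmetric]) (auto intro: locfin_quadratic locfin_square M)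
  finally show ?thesis .
qed

lemma theta_inverse: "theta b M (1 / c) (- m) = theta b M c m"
  unfolding theta_def
  by (rule lsum_reindex[of uminus])
    (auto intro!: bij_betwI[of _ _ _ uminus] simp: power_int_minus power_int_divide_distrib field_simps)

lemma theta_True_one: "0 < M \<Longrightarrow> theta True M 1 0 = 0"
  unfolding theta_def by (rule lsum_cancel[where g = uminus]) (auto intro: locfin_quadratic[of _ _ 0, simplified])

lemma theta_False_one: "0 < M \<Longrightarrow> theta False M 1 0 = 1"
proof -
  assume M: "0 < M"
  have "theta False M 1 0 = (lsum {n \<in> {n. odd n = False}. n = 0} (\<lambda>n. 1 powi n) (\<lambda>n. M * n\<^sup>2 + 0 * n) :: 'a fls)"
    unfolding theta_def
    by (rule lsum_cancel_part[where g = uminus]) (auto intro: locfin_quadratic[OF M, of _ 0, simplified])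
  also have "{n \<in> {n::int. odd n = False}. n = 0} = {0}" by auto
  also have "lsum {0::int} (\<lambda>n. 1 powi n) (\<lambda>n. M * n\<^sup>2 + 0 * n) = (1 :: 'a fls)"
  proof (rule fls_eqI)
    fix k :: int
    have "{a. a \<in> {0} \<and> M * a\<^sup>2 + 0 * a = k} = (if k = 0 then {0} else {})" by auto
    moreover have "locfin {0} (\<lambda>n. M * n\<^sup>2 + 0 * n)" by (rule locfin_quadratic[OF M])
    ultimately show "lsum {0::int} (\<lambda>n. 1 powi n) (\<lambda>n. M * n\<^sup>2 + 0 * n) $$ k = (1 :: 'a fls) $$ k"
      by (simp only: lsum_nth) simp
  qed
  finally show ?thesis .
qed

text \<open>Quasi-periodicity under v -> q^4 v: the index shift by 2 preserves the parity of
  n.\<close>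

lemma theta_period:
  assumes M: "0 < M" and c: "c \<noteq> 0"
  shows "theta b M c (m + 4 * M) = fls_shift (4 * M + 2 * m) (fls_const (c powi (- 2)) * theta b M c m)"
proof -
  have "c powi (- 2) * c powi (n + 2) = c powi n" for n
    using c by (simp flip: power_int_add)
  note this[simp] have "theta b M c (m + 4 * M) =
      lsum {n. odd n = b} (\<lambda>n. c powi (- 2) * c powi n) (\<lambda>n. M * n\<^sup>2 + m * n + (- (4 * M + 2 * m)))"
    unfolding theta_def
    by (rule lsum_reindex[of "\<lambda>n. n + 2"])
      (use c in \<open>auto intro!: bij_betwI[of _ _ _ "\<lambda>n. n - 2"]
        simp: power2_eq_square algebra_simps\<close>)
  also have "\<dots> = fls_shift (4 * M + 2 * m) (fls_const (c powi (- 2)) * theta b M c m)"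
    unfolding theta_def
    by (simp only: lsum_shift[OF locfin_quadratic[OF M]] lsum_mult_const[OF locfin_quadratic[OF M]] minus_minus)
  finally show ?thesis .
qed

text \<open>A combinatorial form of the expansion of theta_1/theta_0 into a Lambert series. The
  product on the right is a sum over triples (n, a, b); two sign-free involutions cancel all terms
  but those of the product on the left.\<close>

lemma lambert_identity:
  fixes c :: "'a::{field,char2}"
  assumes m: "\<bar>m\<bar> < 2 * M" and c: "c \<noteq> 0"
  shows "FF M 1 * theta True M c m = theta False M c m * lam M c m"
proof -
  have M: "0 < M" using m by linarith
  let ?B = "posodd \<times> {b::int. odd b}"
  let ?A = "{n::int. odd n = False} \<times> ?B"
  let ?c = "\<lambda>(n::int, a::int, b::int). c powi (n + b)"
  let ?d = "\<lambda>(n, a, b). M * n\<^sup>2 + m * n + (2 * M * a * \<bar>b\<bar> + m * b)"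
  let ?g = "\<lambda>(n, a, b::int). (n + 2 * b, a - 2 * (n + b) * sgn b, - b)"
  have lfA: "locfin ?A ?d"
    using locfin_times[OF locfin_quadratic[OF M, of "{n. odd n = False}" m] locfin_lam[OF m]]
    by (simp add: split_def)
  have "theta False M c m * lam M c m = lsum ?A ?c ?d"
    unfolding theta_def lam_def
    by (subst lsum_times[OF locfin_quadratic[OF M] locfin_lam[OF m]])
      (use c in \<open>auto intro!: lsum_cong simp: power_int_add\<close>)
  \<comment> \<open>The involution \<open>?g\<close> reverses the sign of b and fixes N = n + b. It
    adjusts a so that n^2 + 2a|b| is unchanged, which keeps a positive exactly on the triples
    cancelled here.\<close>
  also have "\<dots> = lsum {x \<in> ?A. (case x of (n, a, b) \<Rightarrow> a < 2 * (n + b) * sgn b)} ?c ?d"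
  proof (rule lsum_cancel_part[where g = ?g])
    fix x assume "x \<in> ?A" "\<not> (case x of (n, a, b) \<Rightarrow> a < 2 * (n + b) * sgn b)"
    then obtain n a b where x: "x = (n, a, b)" and n: "even n" "odd a" "0 < a" "odd b" "2 * (n + b) * sgn b \<le> a"
      by (auto simp: not_less)
    then have b: "b \<noteq> 0" by auto
    have s: "sgn b * sgn b = 1" "b * sgn b = \<bar>b\<bar>" using b by (auto simp: sgn_if)
    \<comment> \<open>The boundary case a = 2(n + b) \<open>sgn b\<close> cannot occur since a is
      odd.\<close>
    have pos: "0 < a - 2 * (n + b) * sgn b"
      using n by (metis dvd_triv_left even_mult_iff le_less_linear less_diff_eq add_0 order_le_less)
    have sq: "(n + 2 * b)\<^sup>2 + 2 * (a - 2 * (n + b) * sgn b) * \<bar>b\<bar> = n\<^sup>2 + 2 * a * \<bar>b\<bar>"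
      using b by (cases "0 < b") (auto simp: sgn_if power2_eq_square algebra_simps)
    have "M * (n + 2 * b)\<^sup>2 + 2 * M * (a - 2 * (n + b) * sgn b) * \<bar>b\<bar> = M * n\<^sup>2 + 2 * M * a * \<bar>b\<bar>"
      using arg_cong[OF sq, of "\<lambda>z. M * z"] by (simp add: algebra_simps)
    then have d: "?d (?g x) = ?d x" by (simp add: x algebra_simps)
    have cc: "c powi (b + n) = c powi (n + b)" by (simp add: add.commute)
    have "?g (?g x) = x" using b by (simp add: x sgn_if)
    moreover have "?g x \<noteq> x" using b by (simp add: x)
    moreover have "\<not> a - 2 * (n + b) * sgn b < 2 * (n + 2 * b + - b) * sgn (- b)"
      using n b by (simp add: sgn_if split: if_splits)
    ultimately show "?g x \<in> ?A \<and> \<not> (case ?g x of (n, a, b) \<Rightarrow> a < 2 * (n + b) * sgn b) \<and>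
        ?g (?g x) = x \<and> ?g x \<noteq> x \<and> ?c (?g x) = ?c x \<and> ?d (?g x) = ?d x"
      using n pos d cc by (simp add: x)
  qed (rule lfA)
  also have "\<dots> = lsum {(N, \<beta>, e). odd N \<and> odd \<beta> \<and> 0 < \<beta> \<and> even e \<and> \<bar>e\<bar> < \<bar>N\<bar>}
      (\<lambda>(N, \<beta>, e). c powi N) (\<lambda>(N, \<beta>, e). M * (N\<^sup>2 + \<beta>\<^sup>2 + 2 * e * \<beta>) + m * N)" (is "_ = lsum ?J ?c' ?d'")
  proof (rule lsum_reindex[of "\<lambda>(n, a, b). (n + b, \<bar>b\<bar>, a - \<bar>n + b\<bar>)"])
    show "bij_betw (\<lambda>(n, a, b). (n + b, \<bar>b\<bar>, a - \<bar>n + b\<bar>))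
        {x \<in> ?A. (case x of (n, a, b) \<Rightarrow> a < 2 * (n + b) * sgn b)} ?J"
    proof (rule bij_betwI[of _ _ _ "\<lambda>(N, \<beta>, e). (N - sgn N * \<beta>, e + \<bar>N\<bar>, sgn N * \<beta>)"])
      show "(\<lambda>(n, a, b). (n + b, \<bar>b\<bar>, a - \<bar>n + b\<bar>)) \<in>
          {x \<in> ?A. (case x of (n, a, b) \<Rightarrow> a < 2 * (n + b) * sgn b)} \<rightarrow> ?J"
        by (auto simp: sgn_if abs_if split: if_splits)
      show "(\<lambda>(N, \<beta>, e). (N - sgn N * \<beta>, e + \<bar>N\<bar>, sgn N * \<beta>)) \<in> ?J \<rightarrow>
          {x \<in> ?A. (case x of (n, a, b) \<Rightarrow> a < 2 * (n + b) * sgn b)}"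
        by (auto simp: sgn_if abs_if split: if_splits)
      show "(\<lambda>(N, \<beta>, e). (N - sgn N * \<beta>, e + \<bar>N\<bar>, sgn N * \<beta>))
          ((\<lambda>(n, a, b). (n + b, \<bar>b\<bar>, a - \<bar>n + b\<bar>)) x) = x"
        if "x \<in> {x \<in> ?A. (case x of (n, a, b) \<Rightarrow> a < 2 * (n + b) * sgn b)}" for x
        using that by (auto simp: sgn_if abs_if split: if_splits)
      show "(\<lambda>(n, a, b). (n + b, \<bar>b\<bar>, a - \<bar>n + b\<bar>))
          ((\<lambda>(N, \<beta>, e). (N - sgn N * \<beta>, e + \<bar>N\<bar>, sgn N * \<beta>)) x) = x" if "x \<in> ?J" for x
        using that by (auto simp: sgn_if abs_if split: if_splits)
    qed
    fix x assume "x \<in> {x \<in> ?A. (case x of (n, a, b) \<Rightarrow> a < 2 * (n + b) * sgn b)}"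
    then obtain n a b where x: "x = (n, a, b)" and n: "even n" "odd a" "0 < a" "odd b" "a < 2 * (n + b) * sgn b"
      by auto
    have "0 < (n + b) * sgn b" using n(3,5) by linarith
    then have "\<bar>n + b\<bar> * \<bar>b\<bar> = (n + b) * b" by (auto simp: sgn_if abs_if zero_less_mult_iff algebra_simps split: if_splits)
    then have "(n + b)\<^sup>2 + \<bar>b\<bar>\<^sup>2 + 2 * (a - \<bar>n + b\<bar>) * \<bar>b\<bar> = n\<^sup>2 + 2 * a * \<bar>b\<bar>"
      by (simp add: power2_eq_square algebra_simps)
    then have "M * ((n + b)\<^sup>2 + \<bar>b\<bar>\<^sup>2 + 2 * (a - \<bar>n + b\<bar>) * \<bar>b\<bar>) = M * (n\<^sup>2 + 2 * a * \<bar>b\<bar>)" by simp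
    then show "?d' ((\<lambda>(n, a, b). (n + b, \<bar>b\<bar>, a - \<bar>n + b\<bar>)) x) = ?d x"
      by (simp add: x algebra_simps)
  qed auto
  \<comment> \<open>Since beta^2 + 2 e beta = (beta + e)^2 - e^2, the exponent depends only on N,
    |beta + e| and |e|. The involution changes the sign of e or of beta + e, whichever keeps beta
    positive; the terms with e = 0 survive.\<close>
  also have "\<dots> = lsum {x \<in> ?J. snd (snd x) = 0} ?c' ?d'"
  proof (rule lsum_cancel_part[where g = "\<lambda>(N, \<beta>, e). if 0 < \<beta> + 2 * e then (N, \<beta> + 2 * e, - e) else (N, - \<beta> - 2 * e, e)"])
    show "locfin ?J ?d'"
    proof (rule locfin_inj[OF lfA, of "\<lambda>(N, \<beta>, e). (N - sgn N * \<beta>, e + \<bar>N\<bar>, sgn N * \<beta>)"])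
      show "inj_on (\<lambda>(N, \<beta>, e). (N - sgn N * \<beta>, e + \<bar>N\<bar>, sgn N * \<beta>)) ?J"
        by (rule inj_on_inverseI[where g = "\<lambda>(n, a, b). (n + b, \<bar>b\<bar>, a - \<bar>n + b\<bar>)"])
          (auto simp: sgn_if abs_if split: if_splits)
      show "(\<lambda>(N, \<beta>, e). (N - sgn N * \<beta>, e + \<bar>N\<bar>, sgn N * \<beta>)) ` ?J \<subseteq> ?A"
        by (auto simp: sgn_if abs_if split: if_splits)
      show "?d ((\<lambda>(N, \<beta>, e). (N - sgn N * \<beta>, e + \<bar>N\<bar>, sgn N * \<beta>)) x) \<le> ?d' x" if "x \<in> ?J" for x
        using that by (auto simp: sgn_if abs_if abs_mult power2_eq_square algebra_simps split: if_splits)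
    qed
    fix x assume "x \<in> ?J" "snd (snd x) \<noteq> 0"
    then obtain N \<beta> e where x: "x = (N, \<beta>, e)" and *: "odd N" "odd \<beta>" "0 < \<beta>" "even e" "\<bar>e\<bar> < \<bar>N\<bar>" "e \<noteq> 0"
      by (cases x) auto
    have "- e < \<bar>N\<bar>" "e < \<bar>N\<bar>" using *(5) by linarith+
    moreover have "\<beta> \<noteq> - \<beta> - 2 * e" using *(2,4) by presburger
    moreover have "\<beta> + 2 * e \<noteq> 0" using *(2) by presburger
    ultimately show "(\<lambda>(N, \<beta>, e). if 0 < \<beta> + 2 * e then (N, \<beta> + 2 * e, - e) else (N, - \<beta> - 2 * e, e)) x \<in> ?J \<and>
        snd (snd ((\<lambda>(N, \<beta>, e). if 0 < \<beta> + 2 * e then (N, \<beta> + 2 * e, - e) else (N, - \<beta> - 2 * e, e)) x)) \<noteq> 0 \<and>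
        (\<lambda>(N, \<beta>, e). if 0 < \<beta> + 2 * e then (N, \<beta> + 2 * e, - e) else (N, - \<beta> - 2 * e, e))
          ((\<lambda>(N, \<beta>, e). if 0 < \<beta> + 2 * e then (N, \<beta> + 2 * e, - e) else (N, - \<beta> - 2 * e, e)) x) = x \<and>
        (\<lambda>(N, \<beta>, e). if 0 < \<beta> + 2 * e then (N, \<beta> + 2 * e, - e) else (N, - \<beta> - 2 * e, e)) x \<noteq> x \<and>
        ?c' ((\<lambda>(N, \<beta>, e). if 0 < \<beta> + 2 * e then (N, \<beta> + 2 * e, - e) else (N, - \<beta> - 2 * e, e)) x) = ?c' x \<and>
        ?d' ((\<lambda>(N, \<beta>, e). if 0 < \<beta> + 2 * e then (N, \<beta> + 2 * e, - e) else (N, - \<beta> - 2 * e, e)) x) = ?d' x"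
      using * by (simp add: x power2_eq_square algebra_simps)
  qed
  also have "\<dots> = lsum (posodd \<times> {n. odd n = True}) (\<lambda>(a, b). 1 powi (a\<^sup>2) * c powi b)
      (\<lambda>(a, b). M * a\<^sup>2 + (M * b\<^sup>2 + m * b))"
    by (rule lsum_reindex[of "\<lambda>(N, \<beta>, e). (\<beta>, N)"])
      (auto intro!: bij_betwI[of _ _ _ "\<lambda>(\<beta>, N). (N, \<beta>, 0)"] simp: algebra_simps split: prod.splits)
  also have "\<dots> = FF M 1 * theta True M c m"
    unfolding FF_def theta_def by (rule lsum_times[symmetric]) (auto intro: locfin_quadratic locfin_square M)
  finally show ?thesis by simp
qed

section \<open>Lambert series summed over subgroups\<close>

lemma locfin_posodd2: "0 < M \<Longrightarrow> locfin (posodd \<times> posodd) (\<lambda>(a, b). 2 * M * a * b)"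
proof -
  assume M: "0 < M"
  have "locfin (posodd \<times> {b. odd b}) (\<lambda>(a, b). 2 * M * a * \<bar>b\<bar> + 0 * b)"
    by (rule locfin_lam) (use M in auto)
  then show ?thesis
    by (rule locfin_inj[of _ _ id]) auto
qed

text \<open>The off-diagonal pairs cancel under (a, b) -> (b, a). In this shape the square of
  \<open>FF\<close> can be compared with Lambert series term by term.\<close>

lemma FF_square:
  assumes M: "0 < M" and c: "c \<noteq> 0"
  shows "(FF M c)\<^sup>2 = lsum (posodd \<times> posodd) (\<lambda>(a, b). c powi (2 * a * b)) (\<lambda>(a, b). 2 * M * a * b)"
proof -
  have sq: "c powi (a * a) * c powi (a * a) = c powi (a * (a * 2))" for a
    using c by (simp add: mult.assoc mult.left_commute flip: power_int_add)
      (simp add: mult_ac)?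
  have "lsum (posodd \<times> posodd) (\<lambda>(a, b). c powi (2 * a * b)) (\<lambda>(a, b). 2 * M * a * b) =
      lsum {x \<in> posodd \<times> posodd. fst x = snd x} (\<lambda>(a, b). c powi (2 * a * b)) (\<lambda>(a, b). 2 * M * a * b)"
    by (rule lsum_cancel_part[OF locfin_posodd2[OF M], where g = prod.swap]) (auto simp: mult_ac)
  also have "\<dots> = lsum posodd (\<lambda>n. (c powi (n\<^sup>2))\<^sup>2) (\<lambda>n. 2 * (M * n\<^sup>2))"
    by (rule lsum_reindex[of fst])
      (auto simp: bij_betw_def inj_on_def image_iff power2_eq_square mult_ac sq)
  also have "\<dots> = (FF M c)\<^sup>2" unfolding FF_def by (rule lsum_square[symmetric]) (rule locfin_square[OF M])
  finally show ?thesis by simp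
qed

lemma lam_one:
  assumes M: "0 < M" and c: "c \<noteq> 0"
  shows "lam M c 0 = lsum (posodd \<times> posodd) (\<lambda>(a, b). c powi b + c powi (- b)) (\<lambda>(a, b). 2 * M * a * b)"
proof -
  have l: "locfin (posodd \<times> {b. odd b}) (\<lambda>(a, b). 2 * M * a * \<bar>b\<bar> + 0 * b)"
    by (rule locfin_lam) (use M in auto)
  let ?c = "\<lambda>(a::int, b). c powi b" and ?d = "\<lambda>(a, b). 2 * M * a * \<bar>b\<bar> + 0 * b"
  have "lam M c 0 = lsum {x \<in> posodd \<times> {b. odd b}. 0 < snd x} ?c ?d + lsum {x \<in> posodd \<times> {b. odd b}. \<not> 0 < snd x} ?c ?d"
    unfolding lam_def by (rule lsum_split[OF l])
  also have "lsum {x \<in> posodd \<times> {b. odd b}. 0 < snd x} ?c ?d = lsum (posodd \<times> posodd) ?c (\<lambda>(a, b). 2 * M * a * b)"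
    by (rule lsum_reindex[of id]) (auto simp: bij_betw_def)
  also have "lsum {x \<in> posodd \<times> {b. odd b}. \<not> 0 < snd x} ?c ?d =
      lsum (posodd \<times> posodd) (\<lambda>(a, b). c powi (- b)) (\<lambda>(a, b). 2 * M * a * b)"
    by (rule lsum_reindex[of "\<lambda>(a, b). (a, - b)"])
     (auto intro!: bij_betwI[of _ _ _ "\<lambda>(a, b). (a, - b)"] simp: less_le not_less)
  also have "lsum (posodd \<times> posodd) ?c (\<lambda>(a, b). 2 * M * a * b) + lsum (posodd \<times> posodd) (\<lambda>(a, b). c powi (- b)) (\<lambda>(a, b). 2 * M * a * b)
    = lsum (posodd \<times> posodd) (\<lambda>(a, b). c powi b + c powi (- b)) (\<lambda>(a, b). 2 * M * a * b)"
    by (rule fls_eqI) (simp add: lsum_nth locfin_posodd2[OF M] sum.distrib[symmetric], rule sum.cong, auto)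
  finally show ?thesis .
qed

lemma half_geometric:
  fixes w :: "'a::{field,char2}"
  assumes "w \<noteq> 0"
  shows "(w + 1) * (1 + (\<Sum>k=1..int h. w powi k + w powi (- k))) = w powi (int h + 1) + w powi (- int h)"
proof (induct h)
  case 0
  show ?case by simp
next
  case (Suc h)
  have "{1..int (Suc h)} = insert (int h + 1) {1..int h}" by auto
  then have "(\<Sum>k=1..int (Suc h). w powi k + w powi (- k)) =
      (w powi (int h + 1) + w powi (- (int h + 1))) + (\<Sum>k=1..int h. w powi k + w powi (- k))"
    by simp
  then have "(w + 1) * (1 + (\<Sum>k=1..int (Suc h). w powi k + w powi (- k))) =
     (w + 1) * (1 + (\<Sum>k=1..int h. w powi k + w powi (- k))) + (w + 1) * (w powi (int h + 1) + w powi (- (int h + 1)))"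
    by (simp add: algebra_simps)
  also have "\<dots> = w powi (int h + 1) + w powi (- int h) + (w powi (int h + 2) + w powi (- int h) + w powi (int h + 1) + w powi (- (int h + 1)))"
  proof -
    have "w * w powi (int h + 1) = w powi (int h + 2)" "w * w powi (- (int h + 1)) = w powi (- int h)"
      using assms by (simp_all add: power_int_add_1' [symmetric] add.commute)
    then show ?thesis unfolding Suc by (simp add: algebra_simps)
  qed
  also have "\<dots> = w powi (int (Suc h) + 1) + w powi (- int (Suc h))"
  proof -
    have *: "x + y + (z + y + x + u) = z + u" for x y z u :: 'a
      using add_self[of x] add_self[of y]
      by (metis (no_types, opaque_lifting) add.assoc add.commute add_self_left)
    show ?thesis by (subst *) (simp add: algebra_simps)
  qed
  finally show ?case .
qed

text \<open>The exponents k and -k run once through the nonzero residues modulo 2h + 1, so adding 1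
  gives the full power sum of a nontrivial root of unity, which is 0.\<close>

lemma half_root_sum:
  fixes w :: "'a::{field,char2}"
  assumes "w ^ (2 * h + 1) = 1" "w \<noteq> 1"
  shows "(\<Sum>k=1..int h. w powi k + w powi (- k)) = 1"
proof -
  have w: "w \<noteq> 0" using assms(1) by (auto simp: power_0_left)
  have "w powi (int h + 1) = w powi (- int h) * w powi (int (2 * h + 1))"
    using w by (simp flip: power_int_add)
  also have "\<dots> = w powi (- int h)" using assms(1) by (simp only: power_int_of_nat mult_1_right)
  finally have "(w + 1) * (1 + (\<Sum>k=1..int h. w powi k + w powi (- k))) = 0"
    by (simp add: half_geometric[OF w] char2)
  moreover have "w + 1 \<noteq> 0" using assms(2) by (simp add: add_eq_0_iff_eq)
  ultimately show ?thesis by (simp add: add_eq_0_iff_eq)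
qed

definition prim_root :: "'a::field \<Rightarrow> nat \<Rightarrow> bool" where
  "prim_root z n \<longleftrightarrow> (\<forall>b::int. z powi b = 1 \<longleftrightarrow> int n dvd b)"

lemma prim_root_nz: "prim_root z n \<Longrightarrow> 0 < n \<Longrightarrow> z \<noteq> 0"
  unfolding prim_root_def by (metis dvd_refl of_nat_0_less_iff power_int_0_left zero_neq_one less_irrefl)

lemma lsum_posodd_multiple:
  assumes n: "odd n" "0 < n"
  shows "lsum {x \<in> posodd \<times> posodd. n dvd fst x} (\<lambda>(a, b). 1) (\<lambda>(a, b). 2 * M * a * b) =
    lsum (posodd \<times> posodd) (\<lambda>(a, b). 1) (\<lambda>(a, b). 2 * (n * M) * a * b)"
proof (rule lsum_reindex[of "\<lambda>(a, b). (n * a, b)", symmetric])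
  show "bij_betw (\<lambda>(a, b). (n * a, b)) (posodd \<times> posodd) {x \<in> posodd \<times> posodd. n dvd fst x}"
    unfolding bij_betw_def
  proof (intro conjI equalityI subsetI)
    fix x assume "x \<in> {x \<in> posodd \<times> posodd. n dvd fst x}"
    then obtain k b where x: "x = (n * k, b)" "odd b" "0 < b" "odd (n * k)" "0 < n * k"
      by (cases x) (auto simp: dvd_def)
    then have "odd k" "0 < k" using n by (auto simp: zero_less_mult_iff)
    then show "x \<in> (\<lambda>(a, b). (n * a, b)) ` (posodd \<times> posodd)"
      using x by (intro image_eqI[of _ _ "(k, b)"]) auto
  qed (use n in \<open>auto simp: inj_on_def\<close>)
qed (auto simp: mult_ac)

text \<open>Summing over the roots of unity leaves the pairs (a, b) with b prime to 2h + 1, each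
  with coefficient 1. They are all pairs minus those with a multiple of 2h + 1, and both families
  are squares of \<open>FF\<close>.\<close>

lemma lam_half_sum_mu:
  fixes z :: "'a::{field,char2}"
  assumes M: "0 < M" and z: "prim_root z (2 * h + 1)"
  shows "(\<Sum>k=1..int h. lam M (z powi k) 0) = (FF M 1)\<^sup>2 + (FF (int (2 * h + 1) * M) 1)\<^sup>2"
proof -
  let ?n = "int (2 * h + 1)"
  have z0: "z \<noteq> 0" using prim_root_nz[OF z] by simp
  have c: "(\<Sum>k=1..int h. (z powi k) powi b + (z powi k) powi (- b)) = (if ?n dvd b then 0 else 1)" for b
  proof -
    have "(\<Sum>k=1..int h. (z powi k) powi b + (z powi k) powi (- b)) =
        (\<Sum>k=1..int h. (z powi b) powi k + (z powi b) powi (- k))"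
      by (simp add: mult.commute flip: power_int_mult)
    also have "\<dots> = (if ?n dvd b then 0 else 1)"
    proof (cases "?n dvd b")
      case True
      then have "z powi b = 1" using z by (simp add: prim_root_def)
      then show ?thesis using True by (simp add: char2 del: one_add_one)
    next
      case False
      have "(z powi b) ^ (2 * h + 1) = z powi (b * ?n)" by (simp only: power_int_mult power_int_of_nat)
      also have "\<dots> = 1" using z by (simp add: prim_root_def)
      finally have "(z powi b) ^ (2 * h + 1) = 1" .
      moreover have "z powi b \<noteq> 1" using z False by (simp add: prim_root_def)
      ultimately show ?thesis using half_root_sum[of "z powi b" h] False by simp
    qed
    finally show ?thesis .
  qed
  have "(\<Sum>k=1..int h. lam M (z powi k) 0) =
      lsum (posodd \<times> posodd) (\<lambda>x. \<Sum>k=1..int h. case x of (a, b) \<Rightarrow> (z powi k) powi b + (z powi k) powi (- b)) (\<lambda>(a, b). 2 * M * a * b)"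
    using z0 by (simp only: lam_one[OF M] power_int_eq_0_iff simp_thms not_True_eq_False)
      (rule lsum_sum_coeff, simp_all add: locfin_posodd2 M)
  also have "\<dots> = lsum (posodd \<times> posodd) (\<lambda>(a, b). if ?n dvd b then 0 else 1) (\<lambda>(a, b). 2 * M * a * b)"
    by (rule lsum_cong) (auto simp only: c split: prod.splits)
  also have "\<dots> = lsum (posodd \<times> posodd) (\<lambda>(a, b). if ?n dvd a then 0 else 1) (\<lambda>(a, b). 2 * M * a * b)"
    by (rule lsum_reindex[of prod.swap]) (auto simp: mult_ac bij_betw_def)
  also have "\<dots> = lsum (posodd \<times> posodd) (\<lambda>(a, b). 1) (\<lambda>(a, b). 2 * M * a * b)
      + lsum {x \<in> posodd \<times> posodd. ?n dvd fst x} (\<lambda>(a, b). 1) (\<lambda>(a, b). 2 * M * a * b)"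
  proof -
    note l = locfin_posodd2[OF M]
    note ls = locfin_subset[OF l]
    have 1: "lsum {x \<in> posodd \<times> posodd. ?n dvd fst x} (\<lambda>(a, b). if ?n dvd a then 0 else 1) (\<lambda>(a, b). 2 * M * a * b) = (0 :: 'a fls)"
      by (rule fls_eqI, subst lsum_nth, rule ls) (auto intro!: sum.neutral)
    have 2: "lsum {x \<in> posodd \<times> posodd. \<not> ?n dvd fst x} (\<lambda>(a, b). if ?n dvd a then 0 else 1) (\<lambda>(a, b). 2 * M * a * b)
       = (lsum {x \<in> posodd \<times> posodd. \<not> ?n dvd fst x} (\<lambda>(a, b). 1) (\<lambda>(a, b). 2 * M * a * b) :: 'a fls)"
      by (rule lsum_cong) auto
    show ?thesis
      unfolding lsum_split[OF l, of _ "\<lambda>x. ?n dvd fst x"] 1 2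
      by (simp add: add.commute add.left_commute char2)
  qed
  also have "\<dots> = (FF M 1)\<^sup>2 + (FF (?n * M) 1)\<^sup>2"
    using M by (simp add: lsum_posodd_multiple FF_square)
  finally show ?thesis .
qed

text \<open>Writes an odd number as \<open>(2h + 1) a + 2k\<close> with \<open>a\<close> odd and \<open>|k| \<le> h\<close>; the result is \<open>(k, a)\<close>.\<close>
definition split_odd :: "int \<Rightarrow> int \<Rightarrow> int \<times> int" where
  "split_odd h a = (let z = (a + (2 * h + 1)) div 2 + h in (z mod (2 * h + 1) - h, 2 * (z div (2 * h + 1)) - 1))"

lemma split_odd_eq:
  assumes "0 \<le> h" "odd a" "- h \<le> k" "k \<le> h"
  shows "split_odd h ((2 * h + 1) * a + 2 * k) = (k, a)"
proof -
  obtain j where j: "a = 2 * j - 1" using assms(2) by (metis odd_two_times_div_two_succ add_diff_cancel_right' diff_add_cancel even_add odd_one evenE)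
  have "((2 * h + 1) * a + 2 * k + (2 * h + 1)) = 2 * ((2 * h + 1) * j + k)" by (simp add: j algebra_simps)
  then have z: "((2 * h + 1) * a + 2 * k + (2 * h + 1)) div 2 + h = (k + h) + (2 * h + 1) * j" by simp
  have "(k + h) div (2 * h + 1) = 0" "(k + h) mod (2 * h + 1) = k + h"
    using assms by (auto intro: div_pos_pos_trivial mod_pos_pos_trivial)
  then show ?thesis unfolding split_odd_def Let_def z using assms(1) by (simp add: j)
qed

lemma split_oddE:
  fixes h a' :: int
  assumes "0 \<le> h" "odd a'" "0 < a'"
  obtains k a where "a' = (2 * h + 1) * a + 2 * k" "odd a" "0 < a" "- h \<le> k" "k \<le> h"
proof -
  let ?n = "2 * h + 1"
  define z where "z = (a' + ?n) div 2 + h"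
  have "even (a' + ?n)" using assms(2) by simp
  then have e: "a' + ?n = 2 * (z - h)" by (simp add: z_def)
  define a where "a = 2 * (z div ?n) - 1"
  define k where "k = z mod ?n - h"
  have "z = ?n * (z div ?n) + z mod ?n" by simp
  then have "2 * z = ?n * (a + 1) + 2 * (k + h)" unfolding a_def k_def by (simp add: algebra_simps)
  then have 1: "a' = ?n * a + 2 * k" using e by (simp add: algebra_simps)
  have "z \<ge> ?n" using e assms(1,3) by presburger
  then have "z div ?n \<ge> 1" using assms(1) by (simp add: pos_imp_zdiv_pos_iff int_one_le_iff_zero_less)
  then have 2: "odd a" "0 < a" by (auto simp: a_def)
  have "0 \<le> z mod ?n" "z mod ?n < ?n" using assms(1) by (intro pos_mod_sign pos_mod_bound; simp)+
  then have "- h \<le> k" "k \<le> h" unfolding k_def by linarith+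
  with 1 2 that show ?thesis by blast
qed

text \<open>With n = 2h + 1, every positive odd a' is uniquely n a + 2k with a odd and positive and
  |k| <= h. So the terms of the right-hand series are distributed over the n series on the left, the
  sign of b deciding between k and -k.\<close>

lemma lam_dual_sum:
  assumes m: "\<bar>m\<bar> < 2 * M" and c: "c \<noteq> 0"
  shows "(\<Sum>k=- int h..int h. lam (int (2 * h + 1) * M) c (m + 4 * M * k)) = lam M c m"
proof -
  let ?n = "2 * int h + 1"
  have n: "int (2 * h + 1) = ?n" by simp
  have M: "0 < M" using m by linarith
  have mk: "\<bar>m + 4 * M * k\<bar> < 2 * (?n * M)" if "k \<in> {- int h..int h}" for k
  proof -
    have "\<bar>4 * M * k\<bar> = 4 * M * \<bar>k\<bar>" using M by (simp add: abs_mult)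
    also have "\<dots> \<le> 4 * M * int h" using that M by (intro mult_left_mono) auto
    finally show ?thesis using m M by (simp add: algebra_simps)
  qed
  have "(\<Sum>k=- int h..int h. lam (?n * M) c (m + 4 * M * k)) =
      lsum (Sigma {- int h..int h} (\<lambda>_. posodd \<times> {b. odd b})) (\<lambda>(k, y). (\<lambda>(a, b). c powi b) y)
       (\<lambda>(k, y). (\<lambda>(a, b). 2 * (?n * M) * a * \<bar>b\<bar> + (m + 4 * M * k) * b) y)"
    unfolding lam_def by (rule lsum_Sigma_finite) (simp, rule locfin_lam[OF mk])
  also have "\<dots> = lam M c m"
    unfolding lam_def
  proof (rule lsum_reindex[of "\<lambda>(k, a, b). (?n * a + 2 * (k * sgn b), b)"])
    show "bij_betw (\<lambda>(k, a, b). (?n * a + 2 * (k * sgn b), b)) ({- int h..int h} \<times> (posodd \<times> {b. odd b})) (posodd \<times> {b::int. odd b})"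
      unfolding bij_betw_def
    proof (intro conjI equalityI subsetI)
      show "inj_on (\<lambda>(k, a, b). (?n * a + 2 * (k * sgn b), b)) ({- int h..int h} \<times> (posodd \<times> {b. odd b}))"
      proof (rule inj_onI)
        fix x y :: "int \<times> int \<times> int"
        assume xy: "x \<in> {- int h..int h} \<times> (posodd \<times> {b. odd b})" "y \<in> {- int h..int h} \<times> (posodd \<times> {b. odd b})"
          and e: "(\<lambda>(k, a, b). (?n * a + 2 * (k * sgn b), b)) x = (\<lambda>(k, a, b). (?n * a + 2 * (k * sgn b), b)) y"
        obtain k a b k' a' where x: "x = (k, a, b)" and y: "y = (k', a', b)" using e by (cases x, cases y) auto
        have b: "sgn b = 1 \<or> sgn b = -1" using xy x by (cases "b = 0") (auto simp: sgn_if)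
        have "split_odd (int h) (?n * a + 2 * (k * sgn b)) = (k * sgn b, a)"
          by (rule split_odd_eq) (use xy x b in auto)
        moreover have "split_odd (int h) (?n * a' + 2 * (k' * sgn b)) = (k' * sgn b, a')"
          by (rule split_odd_eq) (use xy y b in auto)
        ultimately have "(k * sgn b, a) = (k' * sgn b, a')" using e x y by simp
        then show "x = y" using b x y by auto
      qed
      fix y assume "y \<in> posodd \<times> {b::int. odd b}"
      then obtain a' b where y: "y = (a', b)" "odd a'" "0 < a'" "odd b" by auto
      then obtain k a where k: "a' = ?n * a + 2 * k" "odd a" "0 < a" "- int h \<le> k" "k \<le> int h"
        by (metis split_oddE of_nat_0_le_iff)
      have b: "sgn b = 1 \<or> sgn b = -1" using y by (cases "b = 0") (auto simp: sgn_if)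
      show "y \<in> (\<lambda>(k, a, b). (?n * a + 2 * (k * sgn b), b)) ` ({- int h..int h} \<times> (posodd \<times> {b. odd b}))"
        using b k y by (intro image_eqI[of _ _ "(k * sgn b, a, b)"]) auto
    next
      fix y assume "y \<in> (\<lambda>(k, a, b). (?n * a + 2 * (k * sgn b), b)) ` ({- int h..int h} \<times> (posodd \<times> {b. odd b}))"
      then obtain k a b where y: "y = (?n * a + 2 * (k * sgn b), b)" "- int h \<le> k" "k \<le> int h" "odd a" "0 < a" "odd b" by auto
      have b: "sgn b = 1 \<or> sgn b = -1" using y by (cases "b = 0") (auto simp: sgn_if)
      have "?n * a \<ge> ?n * 1" using y by (intro mult_left_mono) auto
      moreover have "- ?n < 2 * (k * sgn b)" using b y by auto
      ultimately have "0 < ?n * a + 2 * (k * sgn b)" by (metis add_le_less_mono mult_1_right add.right_inverse)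
      then show "y \<in> posodd \<times> {b. odd b}" using y by auto
    qed
    fix x assume "x \<in> {- int h..int h} \<times> (posodd \<times> {b::int. odd b})"
    obtain k a b where x: "x = (k, a, b)" by (cases x) auto
    have "sgn b * \<bar>b\<bar> = b" by (simp add: sgn_mult_abs)
    then have "2 * M * (?n * a + 2 * (k * sgn b)) * \<bar>b\<bar> + m * b = 2 * (?n * M) * a * \<bar>b\<bar> + (m + 4 * M * k) * b"
      by (simp add: algebra_simps)
    then show "(\<lambda>(a, b). 2 * M * a * \<bar>b\<bar> + m * b) ((\<lambda>(k, a, b). (?n * a + 2 * (k * sgn b), b)) x) =
       (\<lambda>(k, y). (\<lambda>(a, b). 2 * (?n * M) * a * \<bar>b\<bar> + (m + 4 * M * k) * b) y) x"
      by (simp add: x)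
  qed auto
  finally show ?thesis by (simp only: n)
qed

text \<open>As for the full range of shifts, but with 1 <= k <= h only: a negative remainder k is
  made positive by changing the sign of b, which is why the new second index is |b|. The remainder 0
  is missing, that is, the pairs whose first entry is divisible by 2h + 1; these make up the second
  square.\<close>

lemma lam_half_sum_cyclic:
  fixes z :: "'a::{field,char2}"
  assumes s: "0 < s" and z: "z ^ (2 * h + 1) = 1"
  shows "(\<Sum>k=1..int h. lam (int (2 * h + 1) * s) (z powi (4 * k)) (4 * s * k)) =
    (FF s z)\<^sup>2 + (FF (int (2 * h + 1) * s) 1)\<^sup>2"
proof -
  let ?n = "2 * int h + 1"
  have n: "int (2 * h + 1) = ?n" by simp
  have z0: "z \<noteq> 0" using z by (auto simp: power_0_left)
  have zn: "z powi (?n * b) = 1" for b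
    using z by (metis n power_int_mult power_int_of_nat power_int_1_left)
  have mk: "\<bar>4 * s * k\<bar> < 2 * (?n * s)" if "k \<in> {1..int h}" for k
  proof -
    have "4 * s * k \<le> 4 * s * int h" using that s by (intro mult_left_mono) auto
    moreover have "4 * s * int h < 2 * (?n * s)" using s by (simp add: algebra_simps)
    moreover have "0 \<le> 4 * s * k" using s that by simp
    ultimately show ?thesis by linarith
  qed
  let ?S = "{1..int h} \<times> (posodd \<times> {b::int. odd b})"
  let ?R = "{x \<in> posodd \<times> posodd. \<not> ?n dvd fst x}"
  have "(\<Sum>k=1..int h. lam (?n * s) (z powi (4 * k)) (4 * s * k)) =
      lsum ?S (\<lambda>(k, y). (\<lambda>(a, b). (z powi (4 * k)) powi b) y)
       (\<lambda>(k, y). (\<lambda>(a, b). 2 * (?n * s) * a * \<bar>b\<bar> + (4 * s * k) * b) y)"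
    unfolding lam_def by (rule lsum_Sigma_finite) (simp, rule locfin_lam[OF mk])
  also have "\<dots> = lsum ?R (\<lambda>(a, b). z powi (2 * a * b)) (\<lambda>(a, b). 2 * s * a * b)"
  proof (rule lsum_reindex[of "\<lambda>(k, a, b). (?n * a + 2 * (k * sgn b), \<bar>b\<bar>)"])
    show "bij_betw (\<lambda>(k, a, b). (?n * a + 2 * (k * sgn b), \<bar>b\<bar>)) ?S ?R"
      unfolding bij_betw_def
    proof (intro conjI equalityI subsetI)
      show "inj_on (\<lambda>(k, a, b). (?n * a + 2 * (k * sgn b), \<bar>b\<bar>)) ?S"
      proof (rule inj_onI)
        fix x y :: "int \<times> int \<times> int"
        assume xy: "x \<in> ?S" "y \<in> ?S"
          and e: "(\<lambda>(k, a, b). (?n * a + 2 * (k * sgn b), \<bar>b\<bar>)) x = (\<lambda>(k, a, b). (?n * a + 2 * (k * sgn b), \<bar>b\<bar>)) y"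
        obtain k a b k' a' b' where x: "x = (k, a, b)" and y: "y = (k', a', b')" by (cases x, cases y) auto
        have kx: "1 \<le> k" "k \<le> int h" "odd a" "odd b" and ky: "1 \<le> k'" "k' \<le> int h" "odd a'" "odd b'"
          using xy x y by auto
        have b: "sgn b = 1 \<or> sgn b = -1" using kx by (cases "b = 0") (auto simp: sgn_if)
        have b': "sgn b' = 1 \<or> sgn b' = -1" using ky by (cases "b' = 0") (auto simp: sgn_if)
        have "split_odd (int h) (?n * a + 2 * (k * sgn b)) = (k * sgn b, a)"
          by (rule split_odd_eq) (use kx b in auto)
        moreover have "split_odd (int h) (?n * a' + 2 * (k' * sgn b')) = (k' * sgn b', a')"
          by (rule split_odd_eq) (use ky b' in auto)
        moreover have 2: "?n * a + 2 * (k * sgn b) = ?n * a' + 2 * (k' * sgn b')" and 3: "\<bar>b\<bar> = \<bar>b'\<bar>"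
          using e unfolding x y split prod.inject by blast+
        ultimately have "(k * sgn b, a) = (k' * sgn b', a')" by (simp only:)
        with 3 have 1: "k * sgn b = k' * sgn b'" "a = a'" "\<bar>b\<bar> = \<bar>b'\<bar>" unfolding prod.inject by blast+
        then have "sgn b = sgn b'" using b b' kx(1) ky(1) by auto
        then have "b = b'" using 1(3) by (metis sgn_mult_abs)
        then show "x = y" using 1 \<open>sgn b = sgn b'\<close> b' x y by auto
      qed
      fix y assume "y \<in> ?R"
      then obtain a' b where y: "y = (a', b)" "odd a'" "0 < a'" "odd b" "0 < b" "\<not> ?n dvd a'" by auto
      then obtain k a where k: "a' = ?n * a + 2 * k" "odd a" "0 < a" "- int h \<le> k" "k \<le> int h"
        by (metis split_oddE of_nat_0_le_iff)
      have k0: "k \<noteq> 0" using y(6) k(1) by auto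
      then show "y \<in> (\<lambda>(k, a, b). (?n * a + 2 * (k * sgn b), \<bar>b\<bar>)) ` ?S"
        using k y by (intro image_eqI[of _ _ "(\<bar>k\<bar>, a, sgn k * b)"]) (auto simp: sgn_mult abs_mult sgn_if abs_if)
    next
      fix y assume "y \<in> (\<lambda>(k, a, b). (?n * a + 2 * (k * sgn b), \<bar>b\<bar>)) ` ?S"
      then obtain k a b where y: "y = (?n * a + 2 * (k * sgn b), \<bar>b\<bar>)" "1 \<le> k" "k \<le> int h" "odd a" "0 < a" "odd b" by auto
      have b: "sgn b = 1 \<or> sgn b = -1" using y by (cases "b = 0") (auto simp: sgn_if)
      have "?n * a \<ge> ?n * 1" using y by (intro mult_left_mono) auto
      moreover have "- ?n < 2 * (k * sgn b)" using b y by auto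
      ultimately have pos: "0 < ?n * a + 2 * (k * sgn b)" by (metis add_le_less_mono mult_1_right add.right_inverse)
      have "\<not> ?n dvd 2 * (k * sgn b)"
      proof
        assume "?n dvd 2 * (k * sgn b)"
        moreover have "2 * (k * sgn b) \<noteq> 0" using b y by auto
        ultimately have "\<bar>?n\<bar> \<le> \<bar>2 * (k * sgn b)\<bar>" by (intro dvd_imp_le_int)
        then show False using b y by auto
      qed
      then have "\<not> ?n dvd ?n * a + 2 * (k * sgn b)" by (simp add: dvd_add_right_iff)
      moreover have "0 < \<bar>b\<bar>" using y by auto
      ultimately show "y \<in> ?R" using y pos by auto
    qed
    fix x assume "x \<in> ?S"
    obtain k a b where x: "x = (k, a, b)" by (cases x) auto
    have sb: "sgn b * \<bar>b\<bar> = b" by (simp add: sgn_mult_abs)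
    have e: "2 * (?n * a + 2 * (k * sgn b)) * \<bar>b\<bar> = ?n * (2 * a * \<bar>b\<bar>) + 4 * k * b"
      by (subst (3) sb[symmetric]) (simp add: algebra_simps)
    have "s * (2 * (?n * a + 2 * (k * sgn b)) * \<bar>b\<bar>) = s * (?n * (2 * a * \<bar>b\<bar>) + 4 * k * b)"
      unfolding e ..
    then show "(\<lambda>(a, b). 2 * s * a * b) ((\<lambda>(k, a, b). (?n * a + 2 * (k * sgn b), \<bar>b\<bar>)) x) =
       (\<lambda>(k, y). (\<lambda>(a, b). 2 * (?n * s) * a * \<bar>b\<bar> + (4 * s * k) * b) y) x"
      by (simp add: x algebra_simps)
    have "z powi (2 * (?n * a + 2 * (k * sgn b)) * \<bar>b\<bar>) = (z powi (4 * k)) powi b"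
      unfolding e using z0 by (simp only: power_int_add zn simp_thms mult_1 power_int_mult[symmetric])
    then show "(\<lambda>(a, b). z powi (2 * a * b)) ((\<lambda>(k, a, b). (?n * a + 2 * (k * sgn b), \<bar>b\<bar>)) x) =
       (\<lambda>(k, y). (\<lambda>(a, b). (z powi (4 * k)) powi b) y) x"
      by (simp add: x)
  qed
  also have "\<dots> = (FF s z)\<^sup>2 + (FF (?n * s) 1)\<^sup>2"
  proof -
    have 1: "lsum {x \<in> posodd \<times> posodd. ?n dvd fst x} (\<lambda>(a, b). z powi (2 * a * b)) (\<lambda>(a, b). 2 * s * a * b)
      = lsum {x \<in> posodd \<times> posodd. ?n dvd fst x} (\<lambda>(a, b). 1) (\<lambda>(a, b). 2 * s * a * b)"
    proof (rule lsum_cong)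
      fix x assume "x \<in> {x \<in> posodd \<times> posodd. ?n dvd fst x}"
      then obtain a b where x: "x = (?n * a, b)" by (cases x) (auto elim!: dvdE)
      have "z powi (2 * (?n * a) * b) = z powi (?n * (2 * a * b))" by (simp add: mult_ac)
      then show "(\<lambda>(a, b). 1) x = (\<lambda>(a, b). z powi (2 * a * b)) x" by (simp add: x zn)
    qed simp
    have "lsum {x \<in> posodd \<times> posodd. ?n dvd fst x} (\<lambda>(a, b). z powi (2 * a * b)) (\<lambda>(a, b). 2 * s * a * b)
       = (FF (?n * s) 1)\<^sup>2"
      unfolding 1 using s by (subst lsum_posodd_multiple) (auto simp: FF_square)
    moreover have "(FF s z)\<^sup>2 = lsum {x \<in> posodd \<times> posodd. ?n dvd fst x} (\<lambda>(a, b). z powi (2 * a * b)) (\<lambda>(a, b). 2 * s * a * b)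
      + lsum ?R (\<lambda>(a, b). z powi (2 * a * b)) (\<lambda>(a, b). 2 * s * a * b)"
      unfolding FF_square[OF s z0] by (rule lsum_split[OF locfin_posodd2[OF s]])
    ultimately show ?thesis by (simp add: add.commute add.left_commute char2)
  qed
  finally show ?thesis by (simp only: n)
qed

lemma root_sum:
  fixes w :: "'a::{field,char2}"
  assumes "w ^ n = 1" "w \<noteq> 1"
  shows "(\<Sum>i<n. w ^ i) = 0"
  using geometric_sum[OF assms(2), of n] assms(1) by simp

text \<open>The sum over the n-th roots of unity kills the terms with b prime to the subgroup, that
  is n not dividing b, and multiplies the others by n, which is 1 because n is odd.\<close>

lemma lam_distribution:
  fixes z :: "'a::{field,char2}"
  assumes m: "\<bar>m\<bar> < 2 * M" and z: "prim_root z n" and n: "odd n" and c: "c \<noteq> 0"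
  shows "lam (int n * M) (c ^ n) (int n * m) = (\<Sum>i<n. lam M (z ^ i * c) m)"
proof -
  have n0: "0 < n" using n by (cases n) auto
  have z0: "z \<noteq> 0" using prim_root_nz[OF z n0] .
  let ?S = "posodd \<times> {b::int. odd b}"
  have s: "(\<Sum>i<n. (z ^ i * c) powi b) = (if int n dvd b then c powi b else 0)" for b
  proof -
    have "(z ^ i * c) powi b = (z powi b) ^ i * c powi b" for i
      by (simp add: power_int_mult_distrib flip: power_int_of_nat power_int_mult) (simp add: mult.commute)
    then have "(\<Sum>i<n. (z ^ i * c) powi b) = (\<Sum>i<n. (z powi b) ^ i) * c powi b"
      by (simp add: sum_distrib_right)
    also have "(\<Sum>i<n. (z powi b) ^ i) = (if int n dvd b then 1 else 0)"
    proof (cases "int n dvd b")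
      case True
      obtain j where "n = 2 * j + 1" using n by (rule oddE)
      then have "of_nat n = (1 :: 'a)" by (simp add: two_eq_0)
      moreover have "z powi b = 1" using True z by (simp add: prim_root_def)
      ultimately show ?thesis using True by simp
    next
      case False
      then have "z powi b \<noteq> 1" using z by (simp add: prim_root_def)
      moreover have "(z powi b) ^ n = z powi (b * int n)" by (simp only: power_int_mult power_int_of_nat)
      then have "(z powi b) ^ n = 1" using z by (simp add: prim_root_def)
      ultimately show ?thesis using False by (simp add: root_sum)
    qed
    finally show ?thesis by simp
  qed
  note l = locfin_lam[OF m]
  have "(\<Sum>i<n. lam M (z ^ i * c) m) = lsum ?S (\<lambda>x. \<Sum>i<n. (\<lambda>(a, b). (z ^ i * c) powi b) x) (\<lambda>(a, b). 2 * M * a * \<bar>b\<bar> + m * b)"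
    unfolding lam_def by (rule lsum_sum_coeff[OF l]) simp
  also have "\<dots> = lsum ?S (\<lambda>(a, b). if int n dvd b then c powi b else 0) (\<lambda>(a, b). 2 * M * a * \<bar>b\<bar> + m * b)"
    by (rule lsum_cong) (auto simp only: s split: prod.splits)
  also have "\<dots> = lsum {x \<in> ?S. int n dvd snd x} (\<lambda>(a, b). c powi b) (\<lambda>(a, b). 2 * M * a * \<bar>b\<bar> + m * b)"
  proof -
    have "lsum {x \<in> ?S. \<not> int n dvd snd x} (\<lambda>(a, b). if int n dvd b then c powi b else 0) (\<lambda>(a, b). 2 * M * a * \<bar>b\<bar> + m * b) = 0"
      by (rule fls_eqI, subst lsum_nth, rule locfin_subset[OF l]) (auto intro!: sum.neutral)
    moreover have "lsum {x \<in> ?S. int n dvd snd x} (\<lambda>(a, b). if int n dvd b then c powi b else 0) (\<lambda>(a, b). 2 * M * a * \<bar>b\<bar> + m * b)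
      = lsum {x \<in> ?S. int n dvd snd x} (\<lambda>(a, b). c powi b) (\<lambda>(a, b). 2 * M * a * \<bar>b\<bar> + m * b)"
      by (rule lsum_cong) auto
    ultimately show ?thesis using lsum_split[OF l, of "\<lambda>(a, b). if int n dvd b then c powi b else 0" "\<lambda>x. int n dvd snd x"]
      by simp
  qed
  also have "\<dots> = lam (int n * M) (c ^ n) (int n * m)"
    unfolding lam_def
  proof (rule lsum_reindex[of "\<lambda>(a, b). (a, int n * b)", symmetric])
    show "bij_betw (\<lambda>(a, b). (a, int n * b)) ?S {x \<in> ?S. int n dvd snd x}"
      unfolding bij_betw_def
    proof (intro conjI equalityI subsetI)
      fix x assume "x \<in> {x \<in> ?S. int n dvd snd x}"
      then obtain a k where x: "x = (a, int n * k)" "odd a" "0 < a" "odd (int n * k)"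
        by (cases x) (auto simp: dvd_def)
      then show "x \<in> (\<lambda>(a, b). (a, int n * b)) ` ?S"
        by (intro image_eqI[of _ _ "(a, k)"]) auto
    qed (use n n0 in \<open>auto simp: inj_on_def\<close>)
    next
    fix x assume "x \<in> ?S"
    obtain a b where x: "x = (a, b)" by (cases x)
    have "c powi (int n * b) = (c ^ n) powi b" by (simp add: power_int_mult)
    then show "(\<lambda>(a, b). c powi b) ((\<lambda>(a, b). (a, int n * b)) x) = (\<lambda>(a, b). (c ^ n) powi b) x"
      by (simp add: x)
  qed (use n0 in \<open>auto simp: abs_mult algebra_simps\<close>)
  finally show ?thesis by simp
qed

section \<open>Zeros of the theta series\<close>

lemma theta_nonzero:
  fixes c :: "'a::{field,char2}"
  assumes M: "0 < M" and c: "c \<noteq> 0" and r: "\<bar>2 * M * r + m\<bar> < 2 * M"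
  shows "theta (odd r) M c m \<noteq> 0"
proof -
  have "theta (odd r) M c m $$ (M * r\<^sup>2 + m * r) = c powi r"
    unfolding theta_def
  proof (rule lsum_leading(1)[where d = "\<lambda>n. M * n\<^sup>2 + m * n", OF locfin_quadratic[OF M]])
    fix n assume n: "n \<in> {n. odd n = odd r}" "n \<noteq> r"
    define d where "d = n - r"
    have d: "even d" "d \<noteq> 0" using n by (auto simp: d_def)
    then have d2: "2 \<le> \<bar>d\<bar>" by presburger
    have "M * n\<^sup>2 + m * n - (M * r\<^sup>2 + m * r) = M * (\<bar>d\<bar> * \<bar>d\<bar>) + d * (2 * M * r + m)"
      by (simp add: d_def power2_eq_square algebra_simps)
    moreover have "- (\<bar>d\<bar> * \<bar>2 * M * r + m\<bar>) \<le> d * (2 * M * r + m)"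
      by (metis abs_ge_minus_self abs_mult minus_le_iff)
    moreover have "\<bar>d\<bar> * \<bar>2 * M * r + m\<bar> < \<bar>d\<bar> * (2 * M)" using r d by (intro mult_strict_left_mono) auto
    moreover have "\<bar>d\<bar> * (2 * M) \<le> \<bar>d\<bar> * (\<bar>d\<bar> * M)" using d2 M by (intro mult_left_mono mult_right_mono) auto
    ultimately show "M * r\<^sup>2 + m * r < M * n\<^sup>2 + m * n" by (simp add: algebra_simps)
  qed auto
  then show ?thesis using c by auto
qed

lemma theta_False_nonzero:
  fixes c :: "'a::{field,char2}"
  assumes M: "0 < M" and c: "c \<noteq> 0" and m: "\<And>k. odd k \<Longrightarrow> m \<noteq> 2 * M * k"
  shows "theta False M c m \<noteq> 0"
proof -
  define j where "j = (m + 2 * M) div (4 * M)"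
  have "4 * M * j + (m + 2 * M) mod (4 * M) = m + 2 * M" by (simp add: j_def)
  moreover have "0 \<le> (m + 2 * M) mod (4 * M)" "(m + 2 * M) mod (4 * M) < 4 * M"
    using M by (intro pos_mod_sign pos_mod_bound; simp)+
  moreover have "m \<noteq> 4 * M * j - 2 * M"
    using m[of "2 * j - 1"] by (simp add: algebra_simps)
  ultimately have "\<bar>m - 4 * M * j\<bar> < 2 * M" by linarith
  then have "\<bar>2 * M * (- 2 * j) + m\<bar> < 2 * M" by (simp add: algebra_simps)
  from theta_nonzero[OF M c this] show ?thesis by simp
qed

text \<open>Away from the multiples of 4M a translate by a period has a unique lowest term. At m = 0
  the indices 1 and -1 tie and give the coefficient c + 1/c, which in characteristic 2 vanishes only
  for c = 1.\<close>

lemma theta_True_eq_0_iff: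
  fixes c :: "'a::{field,char2}"
  assumes M: "0 < M" and c: "c \<noteq> 0"
  shows "theta True M c m = 0 \<longleftrightarrow> 4 * M dvd m \<and> c = 1"
proof (cases "4 * M dvd m")
  case False
  define j where "j = m div (4 * M)"
  have "4 * M * j + m mod (4 * M) = m" by (simp add: j_def)
  moreover have "0 \<le> m mod (4 * M)" "m mod (4 * M) < 4 * M"
    using M by (intro pos_mod_sign pos_mod_bound; simp)+
  moreover have "m mod (4 * M) \<noteq> 0" using False by (simp add: dvd_eq_mod_eq_0)
  ultimately have "\<bar>m - 4 * M * j - 2 * M\<bar> < 2 * M" by linarith
  then have "\<bar>2 * M * (- 2 * j - 1) + m\<bar> < 2 * M" by (simp add: algebra_simps)
  from theta_nonzero[OF M c this] show ?thesis using False by simp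
next
  case True
  then obtain l where m: "m = 4 * M * l" by (auto simp: dvd_def)
  have *: "theta True M c (4 * M * (l + 1)) = 0 \<longleftrightarrow> theta True M c (4 * M * l) = 0" for l
    using theta_period[OF M c, of True "4 * M * l"] c
    by (simp add: distrib_left fls_shift_eq0_iff)
  have "theta True M c (4 * M * l) = 0 \<longleftrightarrow> theta True M c 0 = 0"
  proof (induct l rule: int_induct[of _ 0])
    case (step2 i) then show ?case using *[of "i - 1"] by simp
  qed (use * in auto)
  moreover have "theta True M c 0 = 0 \<longleftrightarrow> c = 1"
  proof
    assume 0: "theta True M c 0 = 0"
    have "{n. n \<in> {n::int. odd n = True} \<and> M * n\<^sup>2 + 0 * n = M} = {1, -1}"
      using M by (auto simp: power2_eq_1_iff)
    then have "theta True M c 0 $$ M = c + inverse c"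
      unfolding theta_def by (simp only: lsum_nth[OF locfin_quadratic[OF M]]) (simp add: power_int_minus)
    with 0 have "c + inverse c = 0" by simp
    then have "c\<^sup>2 = 1\<^sup>2" using c by (simp add: add_eq_0_iff_eq field_simps power2_eq_square)
    then show "c = 1" by (rule square_inj)
  qed (simp add: theta_True_one M)
  ultimately show ?thesis using m by simp
qed

text \<open>The zeros of \<open>\<theta>\<^sub>0\<close> are at \<open>v = q\<^bsup>2k\<^esup>\<close> with \<open>k\<close> odd; a regular \<open>m\<close> keeps \<open>v = c x\<^sup>m\<close> away from them whatever \<open>c\<close> is.\<close>
definition regular :: "int \<Rightarrow> int \<Rightarrow> bool" where
  "regular M m \<longleftrightarrow> (\<forall>k. odd k \<longrightarrow> m \<noteq> 2 * M * k)"

lemma theta_regular_nonzero: "0 < M \<Longrightarrow> c \<noteq> 0 \<Longrightarrow> regular M m \<Longrightarrow> theta False M c m \<noteq> 0"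
  by (rule theta_False_nonzero) (auto simp: regular_def)

lemma power4_add: "(x + y :: 'a::char2)^4 = x^4 + y^4"
proof -
  have p: "z^4 = (z\<^sup>2)\<^sup>2" for z :: 'a by (simp flip: power_mult)
  show ?thesis by (simp only: p square_add)
qed

section \<open>The coordinate t: addition, doubling and Lambert series\<close>

definition tt :: "int \<Rightarrow> 'a::{field,char2} \<Rightarrow> int \<Rightarrow> 'a fls" where
  "tt M c m = theta True M c m / theta False M c m"

text \<open>Points of odd order are never at a pole of t: 4sj = 2nsk is impossible when n and k are
  odd.\<close>

lemma regular_multiple: "odd n \<Longrightarrow> s \<noteq> 0 \<Longrightarrow> regular (n * s) (4 * s * j)"
  unfolding regular_def
proof safe
  fix k assume "odd n" "s \<noteq> 0" "odd k" "4 * s * j = 2 * (n * s) * k"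
  then have "2 * s * (2 * j) = 2 * s * (n * k)" by (simp add: algebra_simps)
  then have "2 * j = n * k" using \<open>s \<noteq> 0\<close> by (metis mult_cancel_left mult_eq_0_iff zero_neq_numeral)
  then have "even (n * k)" by (metis dvd_triv_left)
  then show False using \<open>odd n\<close> \<open>odd k\<close> by simp
qed

lemma tt_inverse: "tt M (1 / c) (- m) = tt M c m"
  unfolding tt_def theta_inverse ..

lemma tt_period:
  assumes "0 < M" "c \<noteq> 0"
  shows "tt M c (m + 4 * M) = tt M c m"
proof -
  have "fls_shift k (fls_const r * f) = (fls_shift k 1 * fls_const r) * f" for k r and f :: "'a fls"
    by (simp add: fls_shifted_times_simps mult.assoc)
  moreover have "fls_shift (4 * M + 2 * m) 1 * fls_const (c powi (- 2)) \<noteq> 0"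
    using assms by (simp add: fls_shift_eq0_iff)
  ultimately show ?thesis unfolding tt_def theta_period[OF assms] by simp
qed

lemma FF_nonzero: "0 < M \<Longrightarrow> c \<noteq> 0 \<Longrightarrow> FF M c $$ M = c" "0 < M \<Longrightarrow> k < M \<Longrightarrow> FF M c $$ k = 0"
proof -
  assume M: "0 < M"
  have *: "M * 1\<^sup>2 < M * b\<^sup>2" if "b \<in> posodd" "b \<noteq> 1" for b :: int
  proof -
    have "1 < b" using that by auto
    then have "1\<^sup>2 < b\<^sup>2" by (intro power_strict_mono) auto
    then show ?thesis using M by simp
  qed
  note l = lsum_leading[where d = "\<lambda>n. M * n\<^sup>2" and a = 1 and A = posodd, OF locfin_square[OF M] _ *]
  show "FF M c $$ M = c" unfolding FF_def using l(1)[of "\<lambda>n. c powi (n\<^sup>2)"] by simp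
  show "FF M c $$ k = 0" if "k < M" unfolding FF_def using l(2)[of k "\<lambda>n. c powi (n\<^sup>2)"] that by simp
qed

lemma FF_neq_0: "0 < M \<Longrightarrow> c \<noteq> 0 \<Longrightarrow> FF M c \<noteq> 0"
  using FF_nonzero(1) by fastforce

context
  fixes M m l :: int and c e :: "'a::{field,char2}"
  assumes M: "0 < M" and c: "c \<noteq> 0" and e: "e \<noteq> 0"
    and reg: "regular M m" "regular M l" "regular M (m + l)" "regular M (m - l)"
begin

private lemma nz: "theta False M c m \<noteq> 0" "theta False M e l \<noteq> 0"
  "theta False M (c * e) (m + l) \<noteq> 0" "theta False M (c / e) (m - l) \<noteq> 0"
  using reg c e M by (simp_all add: theta_regular_nonzero)

private lemma add0: "(theta False M c m * theta False M e l + theta True M c m * theta True M e l)\<^sup>2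
    = theta False M (c * e) (m + l) * theta False M (c / e) (m - l)"
  using theta_addition[OF M c e, of m False l] by simp

lemma one_plus_tt_mult: "1 + tt M c m * tt M e l \<noteq> 0"
proof
  assume "1 + tt M c m * tt M e l = 0"
  then have "theta False M c m * theta False M e l + theta True M c m * theta True M e l = 0"
    using nz by (simp add: tt_def field_simps)
  then show False using add0 nz by simp
qed

private lemma den: "theta False M c m * theta False M e l + theta True M c m * theta True M e l =
    theta False M c m * theta False M e l * (1 + tt M c m * tt M e l)"
  using nz by (simp add: tt_def field_simps)

private lemma num: "theta False M c m * theta True M e l + theta True M c m * theta False M e l =
    theta False M c m * theta False M e l * (tt M c m + tt M e l)"
  using nz by (simp add: tt_def field_simps)

lemma tt_add: "tt M (c * e) (m + l) * tt M (c / e) (m - l) =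
    ((tt M c m + tt M e l) / (1 + tt M c m * tt M e l))\<^sup>2"
proof -
  have "tt M (c * e) (m + l) * tt M (c / e) (m - l) =
      (theta False M c m * theta True M e l + theta True M c m * theta False M e l)\<^sup>2 /
      (theta False M c m * theta False M e l + theta True M c m * theta True M e l)\<^sup>2"
    unfolding add0 using theta_addition[OF M c e, of m True l] by (simp add: tt_def)
  also have "\<dots> = ((tt M c m + tt M e l) / (1 + tt M c m * tt M e l))\<^sup>2"
    unfolding den num using nz by (simp add: power_divide power_mult_distrib)
  finally show ?thesis .
qed

text \<open>The addition formula is applied to the points v w and v/w, whose product and quotient
  are v^2 and w^2; \<open>theta_double\<close> rewrites the two values at squares, and the resulting
  equation is between squares.\<close>

lemma tt_sum: "FF M 1 * (tt M (c * e) (m + l) + tt M (c / e) (m - l)) =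
    tt M c m * tt M e l / (1 + tt M c m * tt M e l)\<^sup>2"
proof -
  let ?a = "theta True M (c * e) (m + l)" and ?b = "theta True M (c / e) (m - l)"
  let ?A = "theta False M (c * e) (m + l)" and ?B = "theta False M (c / e) (m - l)"
  let ?x = "theta False M c m * theta True M c m" and ?y = "theta False M e l * theta True M e l"
  have "(?A * ?b + ?a * ?B)\<^sup>2 = theta True M (c\<^sup>2) (2 * m) * theta True M (e\<^sup>2) (2 * l)"
    using theta_addition[OF M _ _, of "c * e" "c / e" "m + l" True "m - l"] c e
    by (simp add: power2_eq_square)
  then have "(FF M 1 * (?A * ?b + ?a * ?B))\<^sup>2 = (FF M 1 * theta True M (c\<^sup>2) (2 * m)) * (FF M 1 * theta True M (e\<^sup>2) (2 * l))"
    by (simp add: power2_eq_square)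
  also have "\<dots> = (?x * ?y)\<^sup>2"
    unfolding theta_double[OF M c, symmetric] theta_double[OF M e, symmetric] by (simp add: power_mult_distrib)
  finally have 1: "FF M 1 * (?A * ?b + ?a * ?B) = ?x * ?y" by (rule square_inj)
  have "FF M 1 * (tt M (c * e) (m + l) + tt M (c / e) (m - l)) = FF M 1 * (?A * ?b + ?a * ?B) / (?A * ?B)"
    using nz by (simp add: tt_def field_simps)
  also have "\<dots> = ?x * ?y / (theta False M c m * theta False M e l * (1 + tt M c m * tt M e l))\<^sup>2"
    unfolding 1 add0[symmetric] den ..
  also have "\<dots> = tt M c m * tt M e l / (1 + tt M c m * tt M e l)\<^sup>2"
    using nz one_plus_tt_mult by (simp add: tt_def[of M c m] tt_def[of M e l] power2_eq_square)
  finally show ?thesis .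
qed

end

lemma theta_False_double:
  assumes "0 < M" "c \<noteq> 0"
  shows "theta False M (c\<^sup>2) (2 * m) = (theta False M c m + theta True M c m)^4"
proof -
  have "(theta False M c m * theta False M c m + theta True M c m * theta True M c m)\<^sup>2 = theta False M (c * c) (m + m)"
    using theta_addition[OF assms(1) assms(2) assms(2), of m False m] assms by (simp add: theta_False_one)
  then show ?thesis
    by (simp add: power4_add square_add power2_eq_square[symmetric])
qed

lemma
  fixes c :: "'a::{field,char2}"
  assumes M: "0 < M" and c: "c \<noteq> 0" and reg: "regular M m" "regular M (2 * m)"
  shows one_plus_tt: "1 + tt M c m \<noteq> 0"
    and tt_double: "FF M 1 * tt M (c\<^sup>2) (2 * m) = (tt M c m)\<^sup>2 / (1 + tt M c m)^4"
proof -
  have nz: "theta False M c m \<noteq> 0" "theta False M (c\<^sup>2) (2 * m) \<noteq> 0"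
    using reg c M by (simp_all add: theta_regular_nonzero)
  have e: "theta False M c m + theta True M c m = theta False M c m * (1 + tt M c m)"
    using nz by (simp add: tt_def field_simps)
  show n1: "1 + tt M c m \<noteq> 0"
    using nz(2) unfolding theta_False_double[OF M c] e by auto
  have "FF M 1 * tt M (c\<^sup>2) (2 * m) = (theta False M c m * theta True M c m)\<^sup>2 / (theta False M c m + theta True M c m)^4"
    unfolding theta_double[OF M c] theta_False_double[OF M c, symmetric] by (simp add: tt_def)
  also have "\<dots> = (tt M c m)\<^sup>2 / (1 + tt M c m)^4"
  proof -
    have aux: "(a * (a * t))\<^sup>2 / (a * u)^4 = t\<^sup>2 / u^4" if "a \<noteq> 0" for a t u :: "'a fls"
      using that by (simp add: power_mult_distrib power2_eq_square power4_eq_xxxx)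
    have "theta True M c m = theta False M c m * tt M c m" using nz by (simp add: tt_def)
    then show ?thesis unfolding e using aux[OF nz(1)] by simp
  qed
  finally show "FF M 1 * tt M (c\<^sup>2) (2 * m) = (tt M c m)\<^sup>2 / (1 + tt M c m)^4" .
qed

lemma tt_eq_0_iff:
  assumes "0 < M" "c \<noteq> 0" "regular M m"
  shows "tt M c m = 0 \<longleftrightarrow> 4 * M dvd m \<and> c = 1"
  using assms theta_True_eq_0_iff theta_False_nonzero unfolding tt_def regular_def
  by (metis divide_eq_0_iff)

text \<open>The Lambert series is linear in the powers of v, so sums of t over subgroups and
  translates reduce to sums of roots of unity and to rearrangements of indices. The price is the
  restriction to |m| < 2M.\<close>

lemma tt_lambert:
  assumes "\<bar>m\<bar> < 2 * M" "c \<noteq> 0"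
  shows "FF M 1 * tt M c m = lam M c m"
proof -
  have M: "0 < M" using assms by linarith
  have "regular M m"
    unfolding regular_def
  proof safe
    fix k :: int assume "odd k" "m = 2 * M * k"
    then have "\<bar>m\<bar> = 2 * M * \<bar>k\<bar>" "1 \<le> \<bar>k\<bar>" using M by (auto simp: abs_mult, cases "k = 0", auto)
    moreover have "2 * M * 1 \<le> 2 * M * \<bar>k\<bar>" using \<open>1 \<le> \<bar>k\<bar>\<close> M by (intro mult_left_mono) auto
    ultimately show False using assms(1) by linarith
  qed
  then have "theta False M c m \<noteq> 0" using M assms by (simp add: theta_regular_nonzero)
  then show ?thesis using lambert_identity[OF assms] by (simp add: tt_def field_simps)
qed

section \<open>Five-torsion and the parametrization of level 5\<close>

lemma numeral_Bit0_char2: "numeral (Num.Bit0 n) = (0 :: 'a::char2)"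
  by (metis add_self numeral_Bit0)

lemma numeral_Bit1_char2: "numeral (Num.Bit1 n) = (1 :: 'a::char2)"
  by (metis add_self numeral_Bit1 add_0_left)

lemmas char2_numeral = numeral_Bit0_char2 numeral_Bit1_char2

text \<open>\<open>a\<close> and \<open>b\<close> are the values of t at P and 2P for P of order 5;
  doubling exchanges them up to sign, and \<open>G\<close> enters through the sum over the subgroup.
  Eliminating \<open>F\<close> from the doubling equations and dividing by s = a + b gives s^2 = p
  (1 + p)^2 with p = a b, a rational curve with parameter r = s/(1 + p). All quantities are then
  expressed in r.\<close>

lemma five_torsion_algebra:
  fixes F G a b :: "'a::{field,char2}"
  assumes F: "F \<noteq> 0" and a: "a \<noteq> 0" "1 + a \<noteq> 0" and b: "b \<noteq> 0" "1 + b \<noteq> 0" and ab: "a \<noteq> b"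
    and 1: "F * b = a\<^sup>2 / (1 + a)^4" and 2: "F * a = b\<^sup>2 / (1 + b)^4"
    and G: "F * (a + b) = F\<^sup>2 + G\<^sup>2"
  obtains r where "r \<noteq> 0" "1 + r \<noteq> 0" "a * b = r\<^sup>2" "a + b = r * (1 + r)\<^sup>2" "F * (1 + r)^6 = r" "G = F * r^4"
proof -
  define s p where "s = a + b" and "p = a * b"
  have e1: "F * b * (1 + a)^4 = a\<^sup>2" using 1 a by (simp add: field_simps)
  have e2: "F * a * (1 + b)^4 = b\<^sup>2" using 2 b by (simp add: field_simps)
  have "F * (b^3 * (1 + a)^4) = F * b * (1 + a)^4 * b\<^sup>2" by (simp add: power2_eq_square power3_eq_cube mult_ac)
  also have "\<dots> = F * a * (1 + b)^4 * a\<^sup>2" unfolding e1 e2 by simp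
  also have "\<dots> = F * (a^3 * (1 + b)^4)" by (simp add: power2_eq_square power3_eq_cube mult_ac)
  finally have "b^3 * (1 + a)^4 = a^3 * (1 + b)^4" using F by simp
  then have "b^3 * (1 + a^4) + a^3 * (1 + b^4) = 0" by (simp add: power4_add add_self)
  moreover have "b^3 * (1 + a^4) + a^3 * (1 + b^4) = s * (s\<^sup>2 + p + p^3)"
    unfolding s_def p_def
    by (simp add: algebra_simps power2_eq_square power3_eq_cube power4_eq_xxxx char2_numeral char2)
  moreover have s0: "s \<noteq> 0" using ab by (simp add: s_def add_eq_0_iff_eq)
  ultimately have "s\<^sup>2 + (p + p^3) = 0" by (simp add: add.assoc)
  then have sp: "s\<^sup>2 = p * (1 + p)\<^sup>2"
    by (simp add: add_eq_0_iff_eq square_add) (simp add: algebra_simps power2_eq_square power3_eq_cube)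
  have p1: "1 + p \<noteq> 0" using sp s0 by auto
  define r where "r = s / (1 + p)"
  have rp: "p = r\<^sup>2" using sp p1 by (simp add: r_def power_divide)
  have s: "s = r * (1 + r)\<^sup>2" using p1 by (simp add: r_def[symmetric] square_add flip: rp) (simp add: r_def)
  have r0: "r \<noteq> 0" using s0 s by auto
  have r1: "1 + r \<noteq> 0" using s0 s by auto
  have "(1 + a) * (1 + b) = 1 + s + p" by (simp add: s_def p_def algebra_simps)
  also have "\<dots> = (1 + r)^3" unfolding s rp
    by (simp add: algebra_simps power2_eq_square power3_eq_cube char2_numeral char2)
  finally have 3: "(1 + a) * (1 + b) = (1 + r)^3" .
  have "F\<^sup>2 * p * ((1 + a) * (1 + b))^4 = (F * b * (1 + a)^4) * (F * a * (1 + b)^4)"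
    by (simp add: p_def power2_eq_square power_mult_distrib mult_ac)
  also have "\<dots> = p\<^sup>2" unfolding e1 e2 by (simp add: p_def power2_eq_square mult_ac)
  finally have "F\<^sup>2 * ((1 + r)^3)^4 = p" using r0 rp unfolding 3 by (simp add: power2_eq_square mult.assoc)
  then have "(F * (1 + r)^6)\<^sup>2 = r\<^sup>2" by (simp add: rp power_mult_distrib flip: power_mult)
  then have Fr: "F * (1 + r)^6 = r" by (rule square_inj)
  have "(1 + r)^8 = ((1 + r)^4)\<^sup>2" by (simp flip: power_mult)
  then have r8: "(1 + r)^8 = 1 + r^8" by (simp add: power4_add square_add flip: power_mult)
  have "F\<^sup>2 * x^8 = F * x\<^sup>2 * (F * x^6)" for x
    by (simp add: power2_eq_square eval_nat_numeral mult_ac)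
  from this[of "1 + r"] have "F * s = F\<^sup>2 * (1 + r)^8"
    unfolding s Fr by (simp add: mult_ac)
  then have "G\<^sup>2 = (F * r^4)\<^sup>2"
    using G unfolding s_def[symmetric] r8
    by (simp add: distrib_left power_mult_distrib flip: power_mult)
  then have "G = F * r^4" by (rule square_inj)
  with that r0 r1 rp s Fr show ?thesis by (simp add: s_def p_def)
qed

text \<open>The product and the sum of the two values of \<open>t\<close> on the nonzero points of \<open>\<mu>\<^sub>5\<close> up to sign are \<open>pi5 h\<close> and \<open>sig5 h\<close>;
  \<open>F t + iso5 h t\<close> is \<open>G\<close> times the value of \<open>t\<close> at the image point under division by \<open>\<mu>\<^sub>5\<close>.\<close>
definition sig5 :: "'a::field \<Rightarrow> 'a" where "sig5 h = h / (1 + h)^3"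
definition pi5 :: "'a::field \<Rightarrow> 'a" where "pi5 h = h\<^sup>2 / (1 + h)\<^sup>2"
definition den5 :: "'a::field \<Rightarrow> 'a \<Rightarrow> 'a" where "den5 h t = 1 + sig5 h * t + pi5 h * t\<^sup>2"
definition iso5 :: "'a::field \<Rightarrow> 'a \<Rightarrow> 'a" where
  "iso5 h t = t * sig5 h * (1 + pi5 h * t\<^sup>2) / (den5 h t)\<^sup>2"

lemma prim_root_powi_eq_1: "prim_root z n \<Longrightarrow> z powi b = 1 \<longleftrightarrow> int n dvd b"
  by (simp add: prim_root_def)

lemma iso5_split:
  assumes "a * b = pi5 h" "a + b = sig5 h" "1 + t * a \<noteq> 0" "1 + t * b \<noteq> (0::'a::{field,char2})"
  shows "t * a / (1 + t * a)\<^sup>2 + t * b / (1 + t * b)\<^sup>2 = iso5 h t" "den5 h t \<noteq> 0"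
proof -
  have d: "den5 h t = (1 + t * a) * (1 + t * b)"
    unfolding den5_def assms(1,2)[symmetric] by (simp add: algebra_simps power2_eq_square)
  show "den5 h t \<noteq> 0" using assms by (simp add: d)
  have "t * a * (1 + t * b)\<^sup>2 + t * b * (1 + t * a)\<^sup>2 = t * sig5 h * (1 + pi5 h * t\<^sup>2)"
    unfolding square_add assms(1,2)[symmetric]
    by (simp add: algebra_simps power2_eq_square)
  then show "t * a / (1 + t * a)\<^sup>2 + t * b / (1 + t * b)\<^sup>2 = iso5 h t"
    unfolding iso5_def d power_mult_distrib using assms(3,4) by (simp add: add_frac_eq)
qed

lemma regular_0 [simp]: "0 < M \<Longrightarrow> regular M 0"
  by (auto simp: regular_def)

lemma prim_root5_facts:
  assumes w: "prim_root w 5"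
  shows "w \<noteq> 0" "w \<noteq> 1" "w\<^sup>2 \<noteq> 1" "w^3 \<noteq> 1" "w^5 = 1"
proof -
  show "w \<noteq> 0" using prim_root_nz[OF w] by simp
  note p = prim_root_powi_eq_1[OF w]
  show "w \<noteq> 1" using p[of 1] by simp
  show "w\<^sup>2 \<noteq> 1" using p[of "int 2"] unfolding power_int_of_nat by simp
  show "w^3 \<noteq> 1" using p[of "int 3"] unfolding power_int_of_nat by simp
  show "w^5 = 1" using p[of "int 5"] unfolding power_int_of_nat by simp
qed

lemma level5_mu:
  fixes w :: "'a::{field,char2}"
  assumes M: "0 < M" and w: "prim_root w 5"
  obtains h where "h \<noteq> 0" "1 + h \<noteq> 0" "FF M 1 = h * (1 + h)^5" "FF (5 * M) 1 = h^5 * (1 + h)"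
    "tt M w 0 * tt M (w\<^sup>2) 0 = pi5 h" "tt M w 0 + tt M (w\<^sup>2) 0 = sig5 h"
proof -
  note wf = prim_root5_facts[OF w]
  note reg = regular_0[OF M]
  let ?F = "FF M 1 :: 'a fls" and ?a = "tt M w 0" and ?b = "tt M (w\<^sup>2) 0"
  have a0: "?a \<noteq> 0" using tt_eq_0_iff[OF M wf(1) reg] wf by simp
  have b0: "?b \<noteq> 0" using tt_eq_0_iff[OF M _ reg, of "w\<^sup>2"] wf by simp
  have "tt M (w^3) 0 \<noteq> 0" using tt_eq_0_iff[OF M _ reg, of "w^3"] wf by simp
  then have "tt M (w\<^sup>2 * w) (0 + 0) * tt M (w\<^sup>2 / w) (0 - 0) \<noteq> 0"
    using a0 wf(1) by (simp add: power2_eq_square power3_eq_cube)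
  then have ab: "?a \<noteq> ?b"
    using tt_add[OF M, of "w\<^sup>2" w 0 0] wf(1) M by (auto simp: add_self)
  have a1: "1 + ?a \<noteq> 0" using one_plus_tt[OF M wf(1), of 0] M by simp
  have b1: "1 + ?b \<noteq> 0" using one_plus_tt[OF M, of "w\<^sup>2" 0] wf(1) M by simp
  have 1: "?F * ?b = ?a\<^sup>2 / (1 + ?a)^4" using tt_double[OF M wf(1), of 0] M by simp
  have "w^4 = 1 / w" using wf(1,5) by (simp add: field_simps eval_nat_numeral)
  then have "tt M ((w\<^sup>2)\<^sup>2) (2 * 0) = ?a" using tt_inverse[of M w 0] by simp
  then have 2: "?F * ?a = ?b\<^sup>2 / (1 + ?b)^4" using tt_double[OF M, of "w\<^sup>2" 0] wf(1) M by simp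
  have "{1..int 2} = {1, 2}" by auto
  then have "(\<Sum>k=1..int 2. lam M (w powi k) 0) = lam M w 0 + lam M (w\<^sup>2) 0"
    by (simp add: power_int_numeral)
  then have "lam M w 0 + lam M (w\<^sup>2) 0 = ?F\<^sup>2 + (FF (5 * M) 1)\<^sup>2"
    using lam_half_sum_mu[OF M, of w 2] w by simp
  then have G: "?F * (?a + ?b) = ?F\<^sup>2 + (FF (5 * M) 1)\<^sup>2"
    using tt_lambert[of 0 M w] tt_lambert[of 0 M "w\<^sup>2"] M wf(1) by (simp add: distrib_left)
  obtain r where r: "r \<noteq> 0" "1 + r \<noteq> 0" "?a * ?b = r\<^sup>2" "?a + ?b = r * (1 + r)\<^sup>2"
      "?F * (1 + r)^6 = r" "FF (5 * M) 1 = ?F * r^4"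
    using five_torsion_algebra[OF FF_neq_0[OF M] a0 a1 b0 b1 ab 1 2 G] by auto
  \<comment> \<open>This change of parameter makes F = r/(1 + r)^6 and G = F r^4 polynomials,
    because 1 + h = 1/(1 + r).\<close>
  define h where "h = r / (1 + r)"
  have h1: "1 + h = 1 / (1 + r)" using r(2) by (simp add: h_def field_simps char2_numeral)
  have rh: "r = h / (1 + h)" using r(2) by (simp add: h1) (simp add: h_def)
  have hn: "h \<noteq> 0" "1 + h \<noteq> 0" using r h1 by (auto simp: h_def)
  have F: "?F = h * (1 + h)^5"
  proof -
    have aux: "(x / u) * (1 / u)^5 = x / u^6" for x u :: "'a fls"
      by (simp add: power_one_over eval_nat_numeral divide_simps)
    have "?F = r / (1 + r)^6" using r(2,5) by (metis nonzero_eq_divide_eq power_not_zero)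
    then show ?thesis unfolding h1 by (simp only: h_def aux)
  qed
  moreover have "FF (5 * M) 1 = h^5 * (1 + h)"
  proof -
    have aux: "x * u^5 * (x / u)^4 = x^5 * u" if "u \<noteq> 0" for x u :: "'a fls"
      using that by (simp add: power_divide divide_simps eval_nat_numeral)
    show ?thesis unfolding r(6) F unfolding rh by (rule aux[OF hn(2)])
  qed
  moreover have "?a * ?b = pi5 h" unfolding r(3) pi5_def rh by (simp add: power_divide)
  moreover have "?a + ?b = sig5 h"
  proof -
    have aux: "x / u * (1 / u)\<^sup>2 = x / u^3" for x u :: "'a fls"
      by (simp add: power_one_over divide_simps eval_nat_numeral)
    have "1 + r = 1 / (1 + h)" using h1 r(2) by simp
    then show ?thesis unfolding r(4) sig5_def by (simp only: aux) (simp only: rh aux)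
  qed
  ultimately show ?thesis using that hn by blast
qed

text \<open>The same algebra with the two series exchanged: on the curve with q = x^(5M) the
  subgroup is generated by x^(4M), and the quotient returns to \<open>FF M 1\<close>.\<close>

lemma level5_cyclic:
  fixes h :: "'a::{field,char2} fls"
  assumes M: "0 < M" and h: "h \<noteq> 0" "1 + h \<noteq> 0"
    and F: "FF M 1 = h * (1 + h)^5" and G: "FF (5 * M) 1 = h^5 * (1 + h)"
  shows "tt (5 * M) (1::'a) (4 * M) * tt (5 * M) 1 (8 * M) = pi5 (1 + h)"
    "tt (5 * M) (1::'a) (4 * M) + tt (5 * M) 1 (8 * M) = sig5 (1 + h)"
proof -
  let ?G = "FF (5 * M) 1 :: 'a fls" and ?a = "tt (5 * M) (1::'a) (4 * M)" and ?b = "tt (5 * M) (1::'a) (8 * M)"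
  have M5: "0 < 5 * M" using M by simp
  have reg: "regular (5 * M) (4 * M * k)" for k using regular_multiple[of 5 M k] M by simp
  have reg4: "regular (5 * M) (4 * M)" using reg[of 1] by simp
  have reg8: "regular (5 * M) (8 * M)" using reg[of 2] by simp
  have reg12: "regular (5 * M) (12 * M)" using reg[of 3] by simp
  have reg16: "regular (5 * M) (16 * M)" using reg[of 4] by simp
  have dv: "\<not> 20 * M dvd k * M" if "0 < k" "k < 20" for k
    using M that by (simp add: zdvd_not_zless)
  have a0: "?a \<noteq> 0" using tt_eq_0_iff[OF M5 _ reg4, of 1] dv[of 4] by simp
  have b0: "?b \<noteq> 0" using tt_eq_0_iff[OF M5 _ reg8, of 1] dv[of 8] by simp
  have "tt (5 * M) (1::'a) (12 * M) \<noteq> 0" using tt_eq_0_iff[OF M5 _ reg12, of 1] dv[of 12] by simp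
  note n12 = this
  have ab: "?a \<noteq> ?b"
  proof
    assume "?a = ?b"
    then have "?b + ?a = 0" by (simp only: add_self)
    with tt_add[OF M5 _ _ reg8 reg4, of "1::'a" "1::'a"] reg12 reg4 a0 n12
    show False by simp
  qed
  have a1: "1 + ?a \<noteq> 0" using one_plus_tt[OF M5 _ reg4, of 1] reg8 by simp
  have b1: "1 + ?b \<noteq> 0" using one_plus_tt[OF M5 _ reg8, of 1] reg16 by simp
  have 1: "?G * ?b = ?a\<^sup>2 / (1 + ?a)^4" using tt_double[OF M5 _ reg4, of 1] reg8 by simp
  have "tt (5 * M) (1::'a) (16 * M) = tt (5 * M) 1 (- 4 * M)"
    using tt_period[OF M5, of 1 "- 4 * M"] by simp
  also have "\<dots> = ?a" using tt_inverse[of "5 * M" 1 "4 * M"] by simp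
  finally have 2: "?G * ?a = ?b\<^sup>2 / (1 + ?b)^4" using tt_double[OF M5 _ reg8, of "1::'a"] reg16 by simp
  have "{1..int 2} = {1, 2}" by auto
  then have "(\<Sum>k=1..int 2. lam (5 * M) 1 (4 * M * k)) = lam (5 * M) (1::'a) (4 * M) + lam (5 * M) 1 (8 * M)"
    by simp
  then have "lam (5 * M) (1::'a) (4 * M) + lam (5 * M) 1 (8 * M) = (FF M 1)\<^sup>2 + ?G\<^sup>2"
    using lam_half_sum_cyclic[OF M, of "1::'a" 2] by simp
  then have G2: "?G * (?a + ?b) = ?G\<^sup>2 + (FF M 1)\<^sup>2"
    using tt_lambert[of "4 * M" "5 * M" "1::'a"] tt_lambert[of "8 * M" "5 * M" "1::'a"] M
    by (simp add: distrib_left add.commute)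
  obtain r where r: "r \<noteq> 0" "1 + r \<noteq> 0" "?a * ?b = r\<^sup>2" "?a + ?b = r * (1 + r)\<^sup>2"
      "?G * (1 + r)^6 = r" "FF M 1 = ?G * r^4"
    using five_torsion_algebra[OF FF_neq_0[OF M5] a0 a1 b0 b1 ab 1 2 G2] by auto
  \<comment> \<open>Two expressions for \<open>FF M 1\<close> give (h r)^4 = (1 + h)^4. Hence r = (1
    + h)/h, which is the parameter h/(1 + h) with \<open>1 + h\<close> in place of
    \<open>h\<close>.\<close>
  have "h^5 * (1 + h) * r^4 = h * (1 + h)^5" using r(6) F G by simp
  then have "(h * (1 + h)) * (h * r)^4 = (h * (1 + h)) * (1 + h)^4"
    by (simp add: power_mult_distrib eval_nat_numeral mult_ac)
  then have "((h * r)\<^sup>2)\<^sup>2 = ((1 + h)\<^sup>2)\<^sup>2" using h by (simp flip: power_mult)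
  then have hr: "h * r = 1 + h" by (metis square_inj)
  have rh: "r = (1 + h) / (1 + (1 + h))" using hr h by (simp add: field_simps add_self_left)
  have h2: "1 + (1 + h) = h" by (rule add_self_left)
  show "?a * ?b = pi5 (1 + h)" unfolding r(3) pi5_def rh by (simp add: power_divide)
  have "1 + r = 1 / h" using h by (simp add: rh h2 field_simps char2)
  then show "?a + ?b = sig5 (1 + h)"
    unfolding r(4) sig5_def h2 using h by (simp add: rh h2 power_one_over power2_eq_square power3_eq_cube)
qed

text \<open>The distribution relation writes the left-hand side as a sum of F t over the five
  translates of v by fifth roots of unity. The nontrivial ones are paired as w, 1/w and w^2, 1/w^2;
  \<open>tt_sum\<close> makes each pair a function of t(v), and \<open>iso5\<close> is the sum of
  the two.\<close>

lemma level5_isogeny: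
  fixes w c :: "'a::{field,char2}"
  assumes w: "prim_root w 5" and m: "\<bar>m\<bar> < 2 * M" and c: "c \<noteq> 0"
    and h: "tt M w 0 * tt M (w\<^sup>2) 0 = pi5 h" "tt M w 0 + tt M (w\<^sup>2) 0 = sig5 h"
  shows "FF (5 * M) 1 * tt (5 * M) (c^5) (5 * m) = FF M 1 * tt M c m + iso5 h (tt M c m)"
    and "den5 h (tt M c m) \<noteq> 0"
proof -
  have M: "0 < M" using m by linarith
  note wf = prim_root5_facts[OF w]
  note reg = regular_0[OF M]
  have regm: "regular M m"
    unfolding regular_def
  proof safe
    fix k :: int assume "odd k" "m = 2 * M * k"
    then have "\<bar>m\<bar> = 2 * M * \<bar>k\<bar>" "1 \<le> \<bar>k\<bar>" using M by (auto simp: abs_mult, cases "k = 0", auto)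
    moreover have "2 * M * 1 \<le> 2 * M * \<bar>k\<bar>" using \<open>1 \<le> \<bar>k\<bar>\<close> M by (intro mult_left_mono) auto
    ultimately show False using m by linarith
  qed
  have nz: "1 + tt M c m * tt M e 0 \<noteq> 0" if "e \<noteq> 0" for e
    using one_plus_tt_mult[OF M c that regm reg] regm by simp
  have sum: "FF M 1 * (tt M (c * e) m + tt M (c / e) m) = tt M c m * tt M e 0 / (1 + tt M c m * tt M e 0)\<^sup>2"
    if "e \<noteq> 0" for e
    using tt_sum[OF M c that regm reg] regm by simp
  have w2: "w\<^sup>2 \<noteq> 0" using wf by simp
  have split: "tt M c m * tt M w 0 / (1 + tt M c m * tt M w 0)\<^sup>2 +
      tt M c m * tt M (w\<^sup>2) 0 / (1 + tt M c m * tt M (w\<^sup>2) 0)\<^sup>2 = iso5 h (tt M c m)"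
    and "den5 h (tt M c m) \<noteq> 0"
    using iso5_split[OF h nz[OF wf(1)] nz[OF w2]] by auto
  then show "den5 h (tt M c m) \<noteq> 0" by simp
  have "w^4 * c = c / w" "w^3 * c = c / w\<^sup>2" using wf(1,5) by (simp_all add: field_simps eval_nat_numeral)
  then have exp: "(\<Sum>i<5. f (w ^ i * c)) = f c + (f (c * w) + f (c / w)) + (f (c * w\<^sup>2) + f (c / w\<^sup>2))"
    for f :: "'a \<Rightarrow> 'a fls"
    by (simp add: lessThan_nat_numeral lessThan_Suc numeral_eq_Suc[of "Num.Bit1 (Num.Bit0 Num.One)"] eval_nat_numeral)
      (simp add: algebra_simps power2_eq_square power3_eq_cube eval_nat_numeral)
  have "FF (5 * M) 1 * tt (5 * M) (c^5) (5 * m) = lam (5 * M) (c^5) (5 * m)"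
    by (rule tt_lambert) (use m c in auto)
  also have "\<dots> = (\<Sum>i<5. lam M (w ^ i * c) m)"
    using lam_distribution[OF m w _ c] by simp
  also have "\<dots> = (\<Sum>i<5. FF M 1 * tt M (w ^ i * c) m)"
    by (rule sum.cong) (use m c wf in \<open>auto simp: tt_lambert\<close>)
  also have "\<dots> = FF M 1 * tt M c m + (FF M 1 * (tt M (c * w) m + tt M (c / w) m)
      + FF M 1 * (tt M (c * w\<^sup>2) m + tt M (c / w\<^sup>2) m))"
    unfolding exp[of "\<lambda>x. FF M 1 * tt M x m"] by (simp only: distrib_left add.assoc)
  also have "\<dots> = FF M 1 * tt M c m + iso5 h (tt M c m)"
    unfolding sum[OF wf(1)] sum[OF w2] split ..
  finally show "FF (5 * M) 1 * tt (5 * M) (c^5) (5 * m) = FF M 1 * tt M c m + iso5 h (tt M c m)" .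
qed

lemma level5_dual_isogeny:
  fixes c :: "'a::{field,char2}"
  assumes s: "0 < s" and n: "odd n" "0 < n" and c: "c \<noteq> 0"
    and M: "M = n * s" and m: "m = 4 * s * j"
    and h: "tt (5 * M) (1::'a) (4 * M) * tt (5 * M) 1 (8 * M) = pi5 h'"
       "tt (5 * M) (1::'a) (4 * M) + tt (5 * M) 1 (8 * M) = sig5 h'"
  shows "FF M 1 * tt M c m = FF (5 * M) 1 * tt (5 * M) c m + iso5 h' (tt (5 * M) c m)"
    and "den5 h' (tt (5 * M) c m) \<noteq> 0"
proof -
  have M0: "0 < M" using M s n by simp
  have M5: "0 < 5 * M" using M0 by simp
  have reg5: "regular (5 * M) (m + 4 * M * k)" for k
    using regular_multiple[of "5 * n" s "j + n * k"] s n by (simp add: M m algebra_simps)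
  have reg5': "regular (5 * M) (4 * M * k)" for k
    using regular_multiple[of "5 * n" s "n * k"] s n by (simp add: M algebra_simps)
  have reg: "regular M m" using regular_multiple[of n s j] s n by (simp add: M m)
  let ?t = "tt (5 * M) c m"
  have nz: "1 + ?t * tt (5 * M) 1 (4 * M * k) \<noteq> 0" for k
    using one_plus_tt_mult[OF M5 c, of 1 m "4 * M * k"] reg5[of 0] reg5[of k] reg5[of "- k"] reg5'[of k] by simp
  have sum: "FF (5 * M) 1 * (tt (5 * M) c (m + 4 * M * k) + tt (5 * M) c (m - 4 * M * k))
      = ?t * tt (5 * M) 1 (4 * M * k) / (1 + ?t * tt (5 * M) 1 (4 * M * k))\<^sup>2" for k
    using tt_sum[OF M5 c, of 1 m "4 * M * k"] reg5[of 0] reg5[of k] reg5[of "- k"] reg5'[of k] by simp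
  have k12: "4 * M * 1 = 4 * M" "4 * M * 2 = 8 * M" by auto
  have split: "?t * tt (5 * M) 1 (4 * M) / (1 + ?t * tt (5 * M) 1 (4 * M))\<^sup>2 +
      ?t * tt (5 * M) 1 (8 * M) / (1 + ?t * tt (5 * M) 1 (8 * M))\<^sup>2 = iso5 h' ?t"
    and "den5 h' ?t \<noteq> 0"
    using iso5_split[OF h, of ?t] nz[of 1] nz[of 2] unfolding k12 by auto
  then show "den5 h' ?t \<noteq> 0" by simp
  \<comment> \<open>The Lambert expansion is valid only for |m| < 2M, while m is arbitrary. The
    difference \<open>D\<close> of the two sides has period 4M in m, so it may be evaluated in that
    range.\<close>
  define D where "D = (\<lambda>m. FF M 1 * tt M c m + FF (5 * M) 1 * (\<Sum>k=- int 2..int 2. tt (5 * M) c (m + 4 * M * k)))"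
  have I: "{- int 2..int 2} = {-2, -1, 0, 1, 2}" by auto
  have D_step: "D (m + 4 * M) = D m" for m
  proof -
    have "tt (5 * M) c (m + 12 * M) = tt (5 * M) c (m - 8 * M)"
      using tt_period[OF M5 c, of "m - 8 * M"] by (simp add: algebra_simps)
    then show ?thesis unfolding D_def I tt_period[OF M0 c] by (simp add: algebra_simps)
  qed
  have D_shift: "D (m + 4 * M * l) = D m" for l m
  proof (induct l rule: int_induct[of _ 0])
    case (step1 i) then show ?case using D_step[of "m + 4 * M * i"] by (simp add: algebra_simps)
  next
    case (step2 i) then show ?case using D_step[of "m + 4 * M * (i - 1)"] by (simp add: algebra_simps)
  qed simp
  define l where "l = (m + 2 * M) div (4 * M)"
  have "4 * M * l + (m + 2 * M) mod (4 * M) = m + 2 * M" by (simp add: l_def)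
  moreover have "0 \<le> (m + 2 * M) mod (4 * M)" "(m + 2 * M) mod (4 * M) < 4 * M"
    using M0 by (intro pos_mod_sign pos_mod_bound; simp)+
  moreover have "m \<noteq> 4 * M * l - 2 * M"
    using reg unfolding regular_def by (auto dest!: spec[of _ "2 * l - 1"] simp: algebra_simps)
  ultimately have m0: "\<bar>m - 4 * M * l\<bar> < 2 * M" by linarith
  have "D (m - 4 * M * l) = 0"
  proof -
    have "lam (int (2 * 2 + 1) * M) c (m - 4 * M * l + 4 * M * k) = FF (5 * M) 1 * tt (5 * M) c (m - 4 * M * l + 4 * M * k)"
      if "k \<in> {- int 2..int 2}" for k
    proof -
      have "\<bar>m - 4 * M * l + 4 * M * k\<bar> < 2 * (5 * M)"
        using m0 that M0 unfolding I by auto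
      from tt_lambert[OF this c] show ?thesis by simp
    qed
    then have "FF (5 * M) 1 * (\<Sum>k=- int 2..int 2. tt (5 * M) c (m - 4 * M * l + 4 * M * k)) = lam M c (m - 4 * M * l)"
      unfolding sum_distrib_left by (subst lam_dual_sum[OF m0 c, of 2, symmetric]) (rule sum.cong, auto)
    then show ?thesis unfolding D_def tt_lambert[OF m0 c] by (simp add: add_self)
  qed
  then have "D m = 0" using D_shift[of "m - 4 * M * l" l] by simp
  then have "FF M 1 * tt M c m = FF (5 * M) 1 * (\<Sum>k=- int 2..int 2. tt (5 * M) c (m + 4 * M * k))"
    unfolding D_def by (simp add: add_eq_0_iff_eq)
  also have "\<dots> = FF (5 * M) 1 * ?t + (FF (5 * M) 1 * (tt (5 * M) c (m + 4 * M * 1) + tt (5 * M) c (m - 4 * M * 1))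
     + FF (5 * M) 1 * (tt (5 * M) c (m + 4 * M * 2) + tt (5 * M) c (m - 4 * M * 2)))"
    unfolding I by (simp add: algebra_simps)
  also have "\<dots> = FF (5 * M) 1 * ?t + iso5 h' ?t"
    unfolding sum unfolding k12 split ..
  finally show "FF M 1 * tt M c m = FF (5 * M) 1 * tt (5 * M) c m + iso5 h' (tt (5 * M) c m)" .
qed

section \<open>Division polynomials\<close>

definition is_hom :: "('a::comm_ring_1 \<Rightarrow> 'b::comm_ring_1) \<Rightarrow> bool" where
  "is_hom f \<longleftrightarrow> f 0 = 0 \<and> f 1 = 1 \<and> (\<forall>x y. f (x + y) = f x + f y) \<and> (\<forall>x y. f (x * y) = f x * f y)"

lemma is_homD:
  assumes "is_hom f"
  shows "f 0 = 0" "f 1 = 1" "f (x + y) = f x + f y" "f (x * y) = f x * f y"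
  using assms by (auto simp: is_hom_def)

lemma is_hom_power: "is_hom f \<Longrightarrow> f (x ^ n) = f x ^ n"
  by (induct n) (auto simp: is_homD)

lemma is_hom_sum: "is_hom f \<Longrightarrow> f (sum g A) = (\<Sum>a\<in>A. f (g a))"
  by (induct A rule: infinite_finite_induct) (auto simp: is_homD)

lemma is_hom_inject:
  fixes f :: "'a::field \<Rightarrow> 'b::idom"
  assumes "is_hom f" shows "f x = 0 \<longleftrightarrow> x = 0"
  using is_homD[OF assms] by (metis mult_zero_left right_inverse zero_neq_one)

lemma is_hom_inverse:
  fixes f :: "'a::field \<Rightarrow> 'b::field"
  assumes "is_hom f" shows "f (inverse x) = inverse (f x)"
proof (cases "x = 0")
  case False
  then have "f x * f (inverse x) = 1" using is_homD[OF assms] by (metis right_inverse)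
  then show ?thesis by (metis inverse_unique)
qed (simp add: is_homD[OF assms])

definition pev :: "('a::comm_ring_1 \<Rightarrow> 'b::comm_ring_1) \<Rightarrow> 'b \<Rightarrow> 'a poly \<Rightarrow> 'b" where
  "pev f t p = poly (map_poly f p) t"

lemma pev_pCons: "is_hom f \<Longrightarrow> pev f t (pCons a p) = f a + t * pev f t p"
  by (cases "p = 0 \<and> a = 0") (auto simp: pev_def map_poly_pCons is_homD)

lemma is_hom_pev: assumes f: "is_hom f" shows "is_hom (pev f t)"
proof -
  have z: "pev f t 0 = 0" by (simp add: pev_def)
  have add: "pev f t (p + q) = pev f t p + pev f t q" for p q
    by (induct p q rule: poly_induct2) (auto simp: z pev_pCons f is_homD[OF f] algebra_simps)
  have smult: "pev f t (smult a p) = f a * pev f t p" for a p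
    by (induct p) (auto simp: z pev_pCons f is_homD[OF f] algebra_simps)
  have "pev f t (p * q) = pev f t p * pev f t q" for p q
    by (induct p) (auto simp: z pev_pCons f is_homD[OF f] algebra_simps add smult)
  moreover have "pev f t 1 = 1" unfolding one_pCons by (simp add: pev_pCons f is_homD[OF f] z)
  ultimately show ?thesis unfolding is_hom_def using z add by blast
qed

lemma map_poly_pderiv: "is_hom f \<Longrightarrow> map_poly f (pderiv p) = pderiv (map_poly f p)"
proof (rule poly_eqI)
  fix n assume f: "is_hom f"
  have "f (of_nat m) = of_nat m" for m by (induct m) (simp_all add: is_homD[OF f])
  from this[of "Suc n"] show "coeff (map_poly f (pderiv p)) n = coeff (pderiv (map_poly f p)) n"
    using f by (simp add: coeff_map_poly is_homD coeff_pderiv del: of_nat_Suc)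
qed

lemma pev_eq_sum: "is_hom f \<Longrightarrow> degree p \<le> n \<Longrightarrow> pev f t p = (\<Sum>k\<le>n. f (coeff p k) * t ^ k)"
proof -
  assume f: "is_hom f" and d: "degree p \<le> n"
  have "pev f t p = (\<Sum>k\<le>degree (map_poly f p). f (coeff p k) * t ^ k)"
    by (simp add: pev_def poly_altdef coeff_map_poly is_homD[OF f])
  also have "\<dots> = (\<Sum>k\<le>n. f (coeff p k) * t ^ k)"
  proof (rule sum.mono_neutral_left)
    have "degree (map_poly f p) \<le> degree p" by (rule degree_le) (simp add: coeff_map_poly is_homD[OF f] coeff_eq_0)
    then show "{..degree (map_poly f p)} \<subseteq> {..n}" using d by auto
    show "\<forall>i\<in>{..n} - {..degree (map_poly f p)}. f (coeff p i) * t ^ i = 0"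
      using coeff_eq_0[of "map_poly f p"] by (auto simp: coeff_map_poly is_homD[OF f])
  qed simp
  finally show ?thesis .
qed

text \<open>The quotient of the components times t is t(v^n), for c = 1/F. Even indices use the
  doubling formula; odd ones use the product t(v^(2n+1)) t(v), whose squared numerator contains t^2.
  One factor t cancels t(v), and the other is the one kept outside the first component.\<close>

function dp :: "'a::comm_ring_1 \<Rightarrow> nat \<Rightarrow> 'a poly \<times> 'a poly" where
  "dp c n = (if n = 0 then (0, 1) else if n = 1 then (1, 1) else
    let x = dp c (n div 2) in
    if even n then ([:0, c:] * fst x ^ 2 * snd x ^ 2, (snd x + [:0, 1:] * fst x) ^ 4)
    else let y = dp c (n div 2 + 1) in
      ((fst y * snd x + snd y * fst x) ^ 2, (snd y * snd x + [:0, 1:] ^ 2 * fst y * fst x) ^ 2))"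
  by pat_completeness auto
termination by (relation "measure snd") (auto, presburger)

declare dp.simps [simp del]

definition da :: "'a::comm_ring_1 \<Rightarrow> nat \<Rightarrow> 'a poly" where "da c n = fst (dp c n)"
definition db :: "'a::comm_ring_1 \<Rightarrow> nat \<Rightarrow> 'a poly" where "db c n = snd (dp c n)"

lemma da_simps: "da c 0 = 0" "da c (Suc 0) = 1" "db c 0 = 1" "db c (Suc 0) = 1"
  by (simp_all add: da_def db_def dp.simps)

lemma da_even: "da c (2 * n) = [:0, c:] * da c n ^ 2 * db c n ^ 2"
  by (cases "n = 0") (simp_all add: Let_def da_def db_def dp.simps[of c "2 * n"] dp.simps[of c 0])

lemma db_even: "db c (2 * n) = (db c n + [:0, 1:] * da c n) ^ 4"
  by (cases "n = 0") (simp_all add: Let_def da_def db_def dp.simps[of c "2 * n"] dp.simps[of c 0])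

text \<open>In characteristic 2 the division polynomial of an odd index 2n + 1 is a square, and this
  is its root. Its degree 2n^2 + 2n = ((2n + 1)^2 - 1)/2 is the number of nonzero torsion points up
  to sign, so it has room for simple roots only.\<close>

definition dn :: "'a::comm_ring_1 \<Rightarrow> nat \<Rightarrow> 'a poly" where
  "dn c n = da c (n + 1) * db c n + db c (n + 1) * da c n"

lemma da_odd: "da c (2 * n + 1) = dn c n ^ 2"
  by (cases "n = 0")
    (simp_all add: Let_def dn_def da_def db_def dp.simps[of c "Suc (2 * n)"] dp.simps[of c 0] dp.simps[of c 1] dp.simps[of c "Suc 0"])

lemma db_odd: "db c (2 * n + 1) = (db c (n + 1) * db c n + [:0, 1:] ^ 2 * da c (n + 1) * da c n) ^ 2"
  by (cases "n = 0")
    (simp_all add: Let_def dn_def da_def db_def dp.simps[of c "Suc (2 * n)"] dp.simps[of c 0] dp.simps[of c 1] dp.simps[of c "Suc 0"])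

lemma nat_double_induct [case_names zero one even odd]:
  fixes P :: "nat \<Rightarrow> bool"
  assumes "P 0" "P 1" "\<And>n. 0 < n \<Longrightarrow> P n \<Longrightarrow> P (2 * n)" "\<And>n. 0 < n \<Longrightarrow> P n \<Longrightarrow> P (n + 1) \<Longrightarrow> P (2 * n + 1)"
  shows "P n"
proof (induct n rule: less_induct)
  case (less n)
  show ?case
  proof (cases "n \<le> 1")
    case True then show ?thesis using assms(1,2) by (cases n) auto
  next
    case False
    show ?thesis
    proof (cases "even n")
      case True
      then obtain k where "n = 2 * k" by (rule evenE)
      then show ?thesis using assms(3)[of k] less[of k] False by simp
    next
      case f: False
      then obtain k where "n = 2 * k + 1" by (rule oddE)
      then show ?thesis using assms(4)[of k] less[of k] less[of "k + 1"] False by simp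
    qed
  qed
qed

text \<open>Evaluating at \<open>t = \<theta>\<^sub>1(v)/\<theta>\<^sub>0(v)\<close>, the polynomials compute \<open>\<theta>\<^sub>0(v\<^sup>n)\<close> and \<open>\<theta>\<^sub>1(v\<^sup>n)\<close>
  up to the factor \<open>\<theta>\<^sub>0(v)\<close> to the power \<open>n\<^sup>2\<close>.\<close>
lemma division_poly_theta:
  fixes c :: "'a::{field,char2}" and f :: "'b::comm_ring_1 \<Rightarrow> 'a fls"
  assumes M: "0 < M" and c: "c \<noteq> 0" and f: "is_hom f" and r: "f r = 1 / FF M 1"
    and nz: "theta False M c m \<noteq> 0" "theta True M c m \<noteq> 0"
  shows "pev f (tt M c m) (db r n) * theta False M c m ^ (n\<^sup>2) = theta False M (c ^ n) (int n * m)"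
    and "tt M c m * pev f (tt M c m) (da r n) * theta False M c m ^ (n\<^sup>2) = theta True M (c ^ n) (int n * m)"
proof -
  let ?t = "tt M c m" and ?\<theta> = "theta False M c m"
  define A where "A n = pev f ?t (da r n)" for n
  define B where "B n = pev f ?t (db r n)" for n
  note h = is_hom_pev[OF f, of ?t]
  have X: "pev f ?t [:0, u:] = ?t * f u" for u by (simp add: pev_pCons f is_homD[OF f] is_homD(1)[OF h])
  have F0: "FF M 1 \<noteq> (0 :: 'a fls)" using FF_neq_0[OF M, of 1] by simp
  have Ae: "?t * A (2 * n) = (?t * A n * B n)\<^sup>2 / FF M 1" for n
    unfolding A_def B_def da_even using r
    by (simp add: is_homD[OF h] is_hom_power[OF h] X power2_eq_square del: mult_pCons_left)
  have Be: "B (2 * n) = (B n + ?t * A n) ^ 4" for n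
    unfolding A_def B_def db_even by (simp add: is_homD[OF h] is_hom_power[OF h] X is_homD[OF f] del: mult_pCons_left)
  have Ao: "?t * (?t * A (2 * n + 1)) = (B n * (?t * A (n + 1)) + (?t * A n) * B (n + 1))\<^sup>2" for n
    unfolding A_def B_def da_odd dn_def
    by (simp add: is_homD[OF h] is_hom_power[OF h] square_add power_mult_distrib distrib_left)
      (simp add: power2_eq_square mult_ac)
  have Bo: "B (2 * n + 1) = (B n * B (n + 1) + (?t * A n) * (?t * A (n + 1)))\<^sup>2" for n
    unfolding A_def B_def db_odd
    by (simp add: is_homD[OF h] is_hom_power[OF h] X is_homD[OF f] square_add power_mult_distrib mult_ac del: mult_pCons_left)
  have t: "theta True M c m = ?t * ?\<theta>" using nz by (simp add: tt_def)
  have "B n * ?\<theta> ^ (n\<^sup>2) = theta False M (c ^ n) (int n * m) \<and> ?t * A n * ?\<theta> ^ (n\<^sup>2) = theta True M (c ^ n) (int n * m)"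
  proof (induct n rule: nat_double_induct)
    case zero
    show ?case
      using M by (simp add: A_def B_def da_simps is_homD[OF h] theta_False_one theta_True_one)
  next
    case one
    show ?case by (simp add: A_def B_def da_simps is_homD[OF h] t)
  next
    case (even n)
    have sq: "(2 * n)\<^sup>2 = n\<^sup>2 * 4" by (simp add: power2_eq_square)
    have e1: "c ^ (2 * n) = (c ^ n)\<^sup>2" "int (2 * n) * m = 2 * (int n * m)" by (simp_all add: power_mult mult.commute[of 2] flip: power_mult)
    have cn: "c ^ n \<noteq> 0" using c by simp
    have "B (2 * n) * ?\<theta> ^ ((2 * n)\<^sup>2) = (B n * ?\<theta> ^ (n\<^sup>2) + ?t * A n * ?\<theta> ^ (n\<^sup>2)) ^ 4"
      unfolding Be sq by (simp add: power_mult power_mult_distrib flip: distrib_right)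
    also have "\<dots> = theta False M (c ^ (2 * n)) (int (2 * n) * m)"
      unfolding e1 theta_False_double[OF M cn] using even by simp
    finally have 1: "B (2 * n) * ?\<theta> ^ ((2 * n)\<^sup>2) = theta False M (c ^ (2 * n)) (int (2 * n) * m)" .
    have "FF M 1 * (?t * A (2 * n) * ?\<theta> ^ ((2 * n)\<^sup>2)) = ((B n * ?\<theta> ^ (n\<^sup>2)) * (?t * A n * ?\<theta> ^ (n\<^sup>2)))\<^sup>2"
      unfolding Ae sq using F0 by (simp add: power_mult_distrib mult_ac flip: power_mult power_add)
    also have "\<dots> = FF M 1 * theta True M (c ^ (2 * n)) (int (2 * n) * m)"
      unfolding e1 theta_double[OF M cn, symmetric] using even by simp
    finally have "?t * A (2 * n) * ?\<theta> ^ ((2 * n)\<^sup>2) = theta True M (c ^ (2 * n)) (int (2 * n) * m)" using F0 by simp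
    with 1 show ?case by blast
  next
    case (odd n)
    \<comment> \<open>The quotient of the points v^(n+1) and v^n is v itself, which brings in one
      more factor theta_0(v); hence the + 1.\<close>
    have sq: "(2 * n + 1)\<^sup>2 + 1 = (n\<^sup>2 + (n + 1)\<^sup>2) * 2" by (simp add: power2_eq_square algebra_simps)
    have cn: "c ^ n \<noteq> 0" "c ^ (n + 1) \<noteq> 0" using c by simp_all
    have e1: "c ^ (n + 1) * c ^ n = c ^ (2 * n + 1)" "c ^ (n + 1) / c ^ n = c"
      "int (n + 1) * m + int n * m = int (2 * n + 1) * m" "int (n + 1) * m - int n * m = m"
      using c by (simp_all add: algebra_simps power_add power_mult power2_eq_square power_mult_distrib flip: mult_2)
    note add = theta_addition[OF M cn(2) cn(1), of "int (n + 1) * m" _ "int n * m", unfolded e1]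
    have E: "?\<theta> ^ ((2 * n + 1)\<^sup>2) * ?\<theta> = (?\<theta> ^ (n\<^sup>2) * ?\<theta> ^ ((n + 1)\<^sup>2))\<^sup>2"
      unfolding power_add[symmetric] power_mult[symmetric] sq[symmetric] by simp
    have "B (2 * n + 1) * ?\<theta> ^ ((2 * n + 1)\<^sup>2) * ?\<theta> = B (2 * n + 1) * (?\<theta> ^ ((2 * n + 1)\<^sup>2) * ?\<theta>)" by simp
    also have "\<dots> = ((B n * ?\<theta> ^ (n\<^sup>2)) * (B (n + 1) * ?\<theta> ^ ((n + 1)\<^sup>2)) +
        (?t * A n * ?\<theta> ^ (n\<^sup>2)) * (?t * A (n + 1) * ?\<theta> ^ ((n + 1)\<^sup>2)))\<^sup>2"
      unfolding Bo E power_mult_distrib[symmetric] by (rule arg_cong[where f = "\<lambda>x. x\<^sup>2"]) (simp add: algebra_simps)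
    also have "\<dots> = theta False M (c ^ (2 * n + 1)) (int (2 * n + 1) * m) * ?\<theta>"
      unfolding odd(2)[THEN conjunct1] odd(2)[THEN conjunct2] odd(3)[THEN conjunct1] odd(3)[THEN conjunct2]
        add[of False, symmetric] by (simp add: mult.commute)
    finally have 1: "B (2 * n + 1) * ?\<theta> ^ ((2 * n + 1)\<^sup>2) = theta False M (c ^ (2 * n + 1)) (int (2 * n + 1) * m)"
      using nz by simp
    have "(?t * A (2 * n + 1) * ?\<theta> ^ ((2 * n + 1)\<^sup>2)) * (?t * ?\<theta>) = ?t * (?t * A (2 * n + 1)) * (?\<theta> ^ ((2 * n + 1)\<^sup>2) * ?\<theta>)"
      by (simp add: mult_ac)
    also have "\<dots> = ((B n * ?\<theta> ^ (n\<^sup>2)) * (?t * A (n + 1) * ?\<theta> ^ ((n + 1)\<^sup>2)) +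
        (?t * A n * ?\<theta> ^ (n\<^sup>2)) * (B (n + 1) * ?\<theta> ^ ((n + 1)\<^sup>2)))\<^sup>2"
      unfolding Ao E power_mult_distrib[symmetric] by (rule arg_cong[where f = "\<lambda>x. x\<^sup>2"]) (simp add: algebra_simps)
    also have "\<dots> = theta True M (c ^ (2 * n + 1)) (int (2 * n + 1) * m) * theta True M c m"
      unfolding odd(2)[THEN conjunct1] odd(2)[THEN conjunct2] odd(3)[THEN conjunct1] odd(3)[THEN conjunct2]
        add[of True, symmetric] by (simp add: mult.commute add.commute)
    finally have "?t * A (2 * n + 1) * ?\<theta> ^ ((2 * n + 1)\<^sup>2) = theta True M (c ^ (2 * n + 1)) (int (2 * n + 1) * m)"
      using nz unfolding t[symmetric] by simp
    with 1 show ?case by blast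
  qed
  then show "pev f ?t (db r n) * ?\<theta> ^ (n\<^sup>2) = theta False M (c ^ n) (int n * m)"
    and "?t * pev f ?t (da r n) * ?\<theta> ^ (n\<^sup>2) = theta True M (c ^ n) (int n * m)"
    by (simp_all add: A_def B_def)
qed

text \<open>With \<open>c = 1/f\<close>, a bound on the total degree in \<open>(T, c)\<close> is expressed by clearing denominators.\<close>
definition td :: "'a::comm_ring_1 set \<Rightarrow> 'a \<Rightarrow> nat \<Rightarrow> 'a poly \<Rightarrow> bool" where
  "td R f m p \<longleftrightarrow> (\<forall>k. m < k \<longrightarrow> coeff p k = 0) \<and> (\<forall>k\<le>m. coeff p k * f ^ (m - k) \<in> R)"

definition is_subring :: "'a::comm_ring_1 set \<Rightarrow> bool" where
  "is_subring R \<longleftrightarrow> 0 \<in> R \<and> 1 \<in> R \<and> (\<forall>x\<in>R. \<forall>y\<in>R. x + y \<in> R \<and> x * y \<in> R)"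

lemma is_subringD:
  assumes "is_subring R"
  shows "0 \<in> R" "1 \<in> R" "x \<in> R \<Longrightarrow> y \<in> R \<Longrightarrow> x + y \<in> R" "x \<in> R \<Longrightarrow> y \<in> R \<Longrightarrow> x * y \<in> R"
  using assms by (auto simp: is_subring_def)

lemma is_subring_sum: "is_subring R \<Longrightarrow> (\<And>i. i \<in> I \<Longrightarrow> g i \<in> R) \<Longrightarrow> sum g I \<in> R"
  by (induct I rule: infinite_finite_induct) (auto simp: is_subringD)

lemma is_subring_power: "is_subring R \<Longrightarrow> x \<in> R \<Longrightarrow> x ^ n \<in> R"
  by (induct n) (auto simp: is_subringD)

lemma td_add: "is_subring R \<Longrightarrow> td R f m p \<Longrightarrow> td R f m q \<Longrightarrow> td R f m (p + q)"
  by (simp add: td_def distrib_right is_subringD)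

lemma td_mult:
  assumes R: "is_subring R" and p: "td R f m p" and q: "td R f n q"
  shows "td R f (m + n) (p * q)"
  unfolding td_def
proof (intro conjI allI impI)
  fix k
  have z: "coeff p i * coeff q (k - i) = 0" if "\<not> (i \<le> m \<and> k - i \<le> n)" for i
    using that p q by (auto simp: td_def not_le)
  show "coeff (p * q) k = 0" if "m + n < k"
    unfolding coeff_mult using that by (intro sum.neutral ballI z) auto
  assume k: "k \<le> m + n"
  show "coeff (p * q) k * f ^ (m + n - k) \<in> R"
    unfolding coeff_mult sum_distrib_right
  proof (rule is_subring_sum[OF R])
    fix i assume i: "i \<in> {..k}"
    show "coeff p i * coeff q (k - i) * f ^ (m + n - k) \<in> R"
    proof (cases "i \<le> m \<and> k - i \<le> n")
      case True
      then have "f ^ (m + n - k) = f ^ (m - i) * f ^ (n - (k - i))"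
        using i by (simp only: power_add[symmetric]) (rule arg_cong[where f = "power f"], auto)
      then have "coeff p i * coeff q (k - i) * f ^ (m + n - k) =
          (coeff p i * f ^ (m - i)) * (coeff q (k - i) * f ^ (n - (k - i)))" by (simp add: mult_ac)
      moreover have "coeff p i * f ^ (m - i) \<in> R" "coeff q (k - i) * f ^ (n - (k - i)) \<in> R"
        using True p q by (simp_all add: td_def)
      ultimately show ?thesis using R by (simp only: is_subringD(4))
    next
      case False
      then show ?thesis using z[OF False] R by (simp add: is_subringD)
    qed
  qed
qed

lemma td_mono:
  assumes R: "is_subring R" and f: "f \<in> R" and p: "td R f m p" and "m \<le> n"
  shows "td R f n p"
  unfolding td_def
proof (intro conjI allI impI)
  fix k show "n < k \<Longrightarrow> coeff p k = 0" using p assms(4) by (auto simp: td_def)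
  assume k: "k \<le> n"
  show "coeff p k * f ^ (n - k) \<in> R"
  proof (cases "k \<le> m")
    case True
    then have "f ^ (n - k) = f ^ (m - k) * f ^ (n - m)" using assms(4) by (simp flip: power_add)
    then have "coeff p k * f ^ (n - k) = (coeff p k * f ^ (m - k)) * f ^ (n - m)" by (simp add: mult_ac)
    moreover have "coeff p k * f ^ (m - k) \<in> R" using p True by (simp add: td_def)
    ultimately show ?thesis using R f by (simp only: is_subringD(4) is_subring_power)
  next
    case False
    then show ?thesis using p R by (simp add: td_def is_subringD)
  qed
qed

lemma td_square: "is_subring R \<Longrightarrow> td R f m p \<Longrightarrow> td R f (2 * m) (p ^ 2)"
  using td_mult[of R f m p m p] by (simp add: power2_eq_square mult_2)

lemma coeff_mult_top:
  assumes "\<forall>k>m. coeff p k = 0" "\<forall>k>n. coeff q k = 0"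
  shows "coeff (p * q) (m + n) = coeff p m * coeff q n"
proof -
  have "(\<Sum>i\<le>m + n. coeff p i * coeff q (m + n - i)) = (\<Sum>i\<in>{m}. coeff p i * coeff q (m + n - i))"
  proof (rule sum.mono_neutral_right)
    show "\<forall>i\<in>{..m + n} - {m}. coeff p i * coeff q (m + n - i) = 0"
    proof
      fix i assume "i \<in> {..m + n} - {m}"
      then have "m < i \<or> n < m + n - i" by auto
      then show "coeff p i * coeff q (m + n - i) = 0" using assms by auto
    qed
  qed auto
  then show ?thesis by (simp add: coeff_mult)
qed

lemma td_top: "td R f m p \<Longrightarrow> td R f n q \<Longrightarrow> coeff (p * q) (m + n) = coeff p m * coeff q n"
  by (rule coeff_mult_top) (auto simp: td_def)

lemma td_X: "is_subring R \<Longrightarrow> td R f 1 [:0, 1:]"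
  by (auto simp: td_def is_subringD coeff_pCons split: nat.split)

lemma td_cX: "is_subring R \<Longrightarrow> c * f = 1 \<Longrightarrow> td R f 2 [:0, c:]"
  unfolding td_def by (auto simp: is_subringD coeff_pCons numeral_2_eq_2 le_Suc_eq split: nat.split)

lemma td_1: "is_subring R \<Longrightarrow> td R f 0 1" and td_0: "is_subring R \<Longrightarrow> td R f m 0"
  by (auto simp: td_def is_subringD)

text \<open>The leading term sits in the denominator for even n and in the numerator for odd n, and
  for even n the other component is smaller by 2. Therefore only one of the two products in
  \<open>dn\<close> reaches the top degree, and the leading coefficient 1 cannot cancel.\<close>

definition dp_bounds :: "'a::comm_ring_1 set \<Rightarrow> 'a \<Rightarrow> 'a \<Rightarrow> nat \<Rightarrow> bool" where
  "dp_bounds R f c n \<longleftrightarrow>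
    (if even n then td R f (n\<^sup>2) (db c n) \<and> coeff (db c n) (n\<^sup>2) = 1 \<and> td R f (n\<^sup>2 - 2) (da c n)
     else td R f (n\<^sup>2 - 1) (da c n) \<and> coeff (da c n) (n\<^sup>2 - 1) = 1 \<and> td R f (n\<^sup>2 - 1) (db c n))"

lemma td_pow4: "is_subring R \<Longrightarrow> td R f m p \<Longrightarrow> td R f (4 * m) (p ^ 4)"
  using td_square[of R f "2 * m" "p ^ 2"] td_square[of R f m p] by simp

lemma coeff_pow4: "td R f m p \<Longrightarrow> is_subring R \<Longrightarrow> coeff (p ^ 4) (4 * m) = coeff p m ^ 4"
proof -
  assume p: "td R f m p" and R: "is_subring R"
  have "coeff (p ^ 2) (2 * m) = coeff p m ^ 2"
    using td_top[OF p p] by (simp add: power2_eq_square mult_2)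
  moreover have "coeff ((p ^ 2) ^ 2) (2 * (2 * m)) = coeff (p ^ 2) (2 * m) ^ 2"
    using td_top[OF td_square[OF R p] td_square[OF R p]] by (simp add: power2_eq_square mult_2)
  ultimately show ?thesis by (simp flip: power_mult)
qed

lemma dn_bounds:
  assumes R: "is_subring R" and f: "f \<in> R" and n: "0 < n"
    and b: "dp_bounds R f c n" "dp_bounds R f c (n + 1)"
  shows "td R f (2 * n\<^sup>2 + 2 * n) (dn c n)" "coeff (dn c n) (2 * n\<^sup>2 + 2 * n) = 1"
    "td R f (2 * n\<^sup>2 + 2 * n) (db c (n + 1) * db c n + [:0, 1:] ^ 2 * da c (n + 1) * da c n)"
proof -
  note mono = td_mono[OF R f]
  note X2 = td_square[OF R td_X[OF R], of f]
  have n1: "1 \<le> n\<^sup>2" using n by (simp add: power2_eq_square)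
  have sq: "(n + 1)\<^sup>2 = n\<^sup>2 + 2 * n + 1" by (simp add: power2_eq_square)
  have "td R f (2 * n\<^sup>2 + 2 * n) (dn c n) \<and> coeff (dn c n) (2 * n\<^sup>2 + 2 * n) = 1 \<and>
    td R f (2 * n\<^sup>2 + 2 * n) (db c (n + 1) * db c n + [:0, 1:] ^ 2 * da c (n + 1) * da c n)"
  proof (cases "even n")
    case True
    then have "2 \<le> n" using n by (cases "n = 1") auto
    then have n2: "2 \<le> n\<^sup>2" by (metis le_square order_trans power2_eq_square)
    from True b have a: "td R f (n\<^sup>2) (db c n)" "coeff (db c n) (n\<^sup>2) = 1" "td R f (n\<^sup>2 - 2) (da c n)"
      and a': "td R f (n\<^sup>2 + 2 * n) (da c (n + 1))" "coeff (da c (n + 1)) (n\<^sup>2 + 2 * n) = 1" "td R f (n\<^sup>2 + 2 * n) (db c (n + 1))"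
      unfolding dp_bounds_def sq by simp_all
    have 1: "td R f (2 * n\<^sup>2 + 2 * n) (da c (n + 1) * db c n)"
      by (rule mono[OF td_mult[OF R a'(1) a(1)]]) simp
    have c1: "coeff (da c (n + 1) * db c n) (2 * n\<^sup>2 + 2 * n) = 1"
      using td_top[OF a'(1) a(1)] a a' by (simp add: mult_2 add_ac)
    have 2: "td R f (2 * n\<^sup>2 + 2 * n - 2) (db c (n + 1) * da c n)"
      by (rule mono[OF td_mult[OF R a'(3) a(3)]]) (use n2 in simp)
    from 2 have c2: "coeff (db c (n + 1) * da c n) (2 * n\<^sup>2 + 2 * n) = 0" using n2 by (simp add: td_def)
    have 3: "td R f (2 * n\<^sup>2 + 2 * n) (db c (n + 1) * db c n)"
      by (rule mono[OF td_mult[OF R a'(3) a(1)]]) simp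
    have 4: "td R f (2 * n\<^sup>2 + 2 * n) ([:0, 1:] ^ 2 * da c (n + 1) * da c n)"
      by (rule mono[OF td_mult[OF R td_mult[OF R X2 a'(1)] a(3)]]) (use n2 in simp)
    show ?thesis
      unfolding dn_def using td_add[OF R 1 mono[OF 2]] td_add[OF R 3 4] c1 c2 by simp
  next
    case False
    from False b have a: "td R f (n\<^sup>2 - 1) (da c n)" "coeff (da c n) (n\<^sup>2 - 1) = 1" "td R f (n\<^sup>2 - 1) (db c n)"
      and a': "td R f (n\<^sup>2 + 2 * n + 1) (db c (n + 1))" "coeff (db c (n + 1)) (n\<^sup>2 + 2 * n + 1) = 1" "td R f (n\<^sup>2 + 2 * n - 1) (da c (n + 1))"
      unfolding dp_bounds_def sq by simp_all
    have e: "n\<^sup>2 + 2 * n + 1 + (n\<^sup>2 - 1) = 2 * n\<^sup>2 + 2 * n" using n1 by simp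
    have 1: "td R f (2 * n\<^sup>2 + 2 * n) (db c (n + 1) * da c n)"
      using td_mult[OF R a'(1) a(1)] by (simp only: e)
    have c1: "coeff (db c (n + 1) * da c n) (2 * n\<^sup>2 + 2 * n) = 1"
      using td_top[OF a'(1) a(1)] by (simp only: e a a' mult_1)
    have 2: "td R f (2 * n\<^sup>2 + 2 * n - 2) (da c (n + 1) * db c n)"
      by (rule mono[OF td_mult[OF R a'(3) a(3)]]) (use n1 in simp)
    from 2 have c2: "coeff (da c (n + 1) * db c n) (2 * n\<^sup>2 + 2 * n) = 0" using n1 by (simp add: td_def)
    have 3: "td R f (2 * n\<^sup>2 + 2 * n) (db c (n + 1) * db c n)"
      using td_mult[OF R a'(1) a(3)] by (simp only: e)
    have 4: "td R f (2 * n\<^sup>2 + 2 * n) ([:0, 1:] ^ 2 * da c (n + 1) * da c n)"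
      by (rule mono[OF td_mult[OF R td_mult[OF R X2 a'(3)] a(1)]]) (use n1 in simp)
    have 5: "td R f (2 * n\<^sup>2 + 2 * n) (da c (n + 1) * db c n)" by (rule mono[OF 2]) simp
    have 6: "coeff (dn c n) (2 * n\<^sup>2 + 2 * n) = 1" unfolding dn_def coeff_add c1 c2 by simp
    have 7: "td R f (2 * n\<^sup>2 + 2 * n) (dn c n)" unfolding dn_def by (rule td_add[OF R 5 1])
    note 8 = td_add[OF R 3 4]
    from 7 6 8 show ?thesis by blast
  qed
  then show "td R f (2 * n\<^sup>2 + 2 * n) (dn c n)" "coeff (dn c n) (2 * n\<^sup>2 + 2 * n) = 1"
    "td R f (2 * n\<^sup>2 + 2 * n) (db c (n + 1) * db c n + [:0, 1:] ^ 2 * da c (n + 1) * da c n)" by auto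
qed

lemma dp_bounds:
  assumes R: "is_subring R" and f: "f \<in> R" and c: "c * f = 1"
  shows "dp_bounds R f c n"
proof (induct n rule: nat_double_induct)
  case zero
  show ?case using R by (simp add: dp_bounds_def da_simps td_1 td_0)
next
  case one
  show ?case using R by (simp add: dp_bounds_def da_simps td_1 td_0)
next
  case (even n)
  note mono = td_mono[OF R f]
  have n1: "1 \<le> n\<^sup>2" using even(1) by (simp add: power2_eq_square)
  have sq: "(2 * n)\<^sup>2 = 4 * n\<^sup>2" by (simp add: power2_eq_square)
  note cX = td_cX[OF R c]
  show ?case
  proof (cases "even n")
    case True
    then have "2 \<le> n" using even(1) by (cases "n = 1") auto
    then have n2: "2 \<le> n\<^sup>2" by (metis le_square order_trans power2_eq_square)
    from True even(2) have a: "td R f (n\<^sup>2) (db c n)" "coeff (db c n) (n\<^sup>2) = 1" "td R f (n\<^sup>2 - 2) (da c n)"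
      unfolding dp_bounds_def by simp_all
    have x: "td R f (n\<^sup>2 - 1) ([:0, 1:] * da c n)"
      by (rule mono[OF td_mult[OF R td_X[OF R] a(3)]]) (use n2 in simp)
    have s: "td R f (n\<^sup>2) (db c n + [:0, 1:] * da c n)" by (rule td_add[OF R a(1) mono[OF x]]) simp
    have "coeff ([:0, 1:] * da c n) (n\<^sup>2) = 0" using x n1 by (simp add: td_def)
    then have "coeff (db c n + [:0, 1:] * da c n) (n\<^sup>2) = 1" using a by simp
    moreover have "td R f (4 * n\<^sup>2 - 2) (da c (2 * n))"
      unfolding da_even
      by (rule mono[OF td_mult[OF R td_mult[OF R cX td_square[OF R a(3)]] td_square[OF R a(1)]]]) (use n2 in simp)
    ultimately show ?thesis
      unfolding dp_bounds_def sq db_even using td_pow4[OF R s] coeff_pow4[OF s R] by simp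
  next
    case False
    from False even(2) have a: "td R f (n\<^sup>2 - 1) (da c n)" "coeff (da c n) (n\<^sup>2 - 1) = 1" "td R f (n\<^sup>2 - 1) (db c n)"
      unfolding dp_bounds_def by simp_all
    have x: "td R f (n\<^sup>2) ([:0, 1:] * da c n)"
      by (rule mono[OF td_mult[OF R td_X[OF R] a(1)]]) (use n1 in simp)
    have s: "td R f (n\<^sup>2) (db c n + [:0, 1:] * da c n)" by (rule td_add[OF R mono[OF a(3)] x]) simp
    have "coeff ([:0, 1:] * da c n) (n\<^sup>2) = 1"
      using a n1 by (cases "n\<^sup>2") auto
    moreover have "coeff (db c n) (n\<^sup>2) = 0" using a n1 by (simp add: td_def)
    ultimately have "coeff (db c n + [:0, 1:] * da c n) (n\<^sup>2) = 1" by simp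
    moreover have "td R f (4 * n\<^sup>2 - 2) (da c (2 * n))"
      unfolding da_even
      by (rule mono[OF td_mult[OF R td_mult[OF R cX td_square[OF R a(1)]] td_square[OF R a(3)]]]) (use n1 in simp)
    ultimately show ?thesis
      unfolding dp_bounds_def sq db_even using td_pow4[OF R s] coeff_pow4[OF s R] by simp
  qed
next
  case (odd n)
  note d = dn_bounds[OF R f odd]
  have sq: "(2 * n + 1)\<^sup>2 - 1 = 2 * (2 * n\<^sup>2 + 2 * n)" by (simp add: power2_eq_square algebra_simps)
  have "coeff (dn c n ^ 2) (2 * (2 * n\<^sup>2 + 2 * n)) = 1"
    using td_top[OF d(1) d(1)] unfolding d(2) mult_2[symmetric] power2_eq_square[of "dn c n", symmetric] by simp
  then show ?case
    unfolding dp_bounds_def sq da_odd db_odd using td_square[OF R d(1)] td_square[OF R d(3)] by simp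
qed

lemma dn_monic:
  assumes R: "is_subring R" and f: "f \<in> R" and c: "c * f = 1" and n: "0 < n"
  shows "td R f (2 * n\<^sup>2 + 2 * n) (dn c n)" "coeff (dn c n) (2 * n\<^sup>2 + 2 * n) = 1"
  using dn_bounds[OF R f n dp_bounds[OF R f c] dp_bounds[OF R f c]] by auto

lemma poly_bezout:
  fixes a b :: "'a::field poly"
  shows "\<exists>u v d. u * a + v * b = d \<and> d dvd a \<and> d dvd b"
proof (induct "if b = 0 then 0 else Suc (degree b)" arbitrary: a b rule: less_induct)
  case less
  show ?case
  proof (cases "b = 0")
    case True
    then show ?thesis by (intro exI[of _ 1] exI[of _ 0] exI[of _ a]) simp
  next
    case False
    then have "a mod b = 0 \<or> degree (a mod b) < degree b" by (rule degree_mod_less)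
    then have "(if a mod b = 0 then 0 else Suc (degree (a mod b))) < (if b = 0 then 0 else Suc (degree b))"
      using False by auto
    from less[OF this, of b] obtain u v d where d: "u * b + v * (a mod b) = d" "d dvd b" "d dvd a mod b" by blast
    have "a mod b = a - (a div b) * b" by (simp add: minus_div_mult_eq_mod)
    then have "u * b + v * (a - (a div b) * b) = d" using d(1) by (simp only:)
    then have "v * a + (u - v * (a div b)) * b = d" by (simp add: algebra_simps)
    moreover have "d dvd a" using d(2,3) by (simp add: dvd_mod_iff)
    ultimately show ?thesis using d(2) by blast
  qed
qed

lemma monic_poly_split:
  fixes p :: "'a::idom poly"
  assumes S: "finite S" and d: "degree p = card S" "lead_coeff p = 1" and r: "\<And>x. x \<in> S \<Longrightarrow> poly p x = 0"
  shows "p = (\<Prod>x\<in>S. [:- x, 1:])"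
proof (cases "S = {}")
  case True
  then have "degree p = 0" using d(1) by simp
  then obtain x where "p = [:x:]" by (rule degree_eq_zeroE)
  then show ?thesis using d(2) True by simp
next
  case False
  let ?q = "\<Prod>x\<in>S. [:- x, 1:]"
  have q: "degree ?q = card S" "lead_coeff ?q = 1"
    by (subst degree_prod_sum_eq, auto simp: lead_coeff_prod)
  show ?thesis
  proof (rule ccontr)
    assume "p \<noteq> ?q"
    then have n0: "p - ?q \<noteq> 0" by simp
    have "degree (p - ?q) < card S"
    proof (rule degree_lessI)
      show "p - ?q \<noteq> 0 \<or> 0 < card S" using n0 by simp
      show "\<forall>k\<ge>card S. coeff (p - ?q) k = 0"
      proof (intro allI impI)
        fix k assume "card S \<le> k"
        then consider "k = card S" | "card S < k" by linarith
        then show "coeff (p - ?q) k = 0"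
        proof cases
          case 1 then show ?thesis using d q by simp
        next
          case 2 then show ?thesis using d q by (simp add: coeff_eq_0)
        qed
      qed
    qed
    moreover have "S \<subseteq> {x. poly (p - ?q) x = 0}" using r S by (auto simp: poly_prod)
    then have "card S \<le> card {x. poly (p - ?q) x = 0}" by (rule card_mono[OF poly_roots_finite[OF n0]])
    ultimately show False using card_poly_roots_bound[OF n0] by simp
  qed
qed

section \<open>Traces over the division points\<close>

text \<open>Two specializations of a monic separable polynomial \<open>\<psi>\<close>, with root families \<open>\<tau>1\<close> and \<open>\<tau>2\<close> indexed by the same set.
  A pair of functions on \<open>I\<close> is representable if one polynomial over the common field interpolates both.\<close>
locale two_fibres =
  fixes \<phi>1 \<phi>2 :: "'k::field \<Rightarrow> 'l::field" and I :: "'i set" and \<tau>1 \<tau>2 :: "'i \<Rightarrow> 'l" and \<psi> :: "'k poly"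
  assumes hom1: "is_hom \<phi>1" and hom2: "is_hom \<phi>2" and fin: "finite I"
    and deg: "degree \<psi> = card I" "lead_coeff \<psi> = 1"
    and inj1: "inj_on \<tau>1 I" and inj2: "inj_on \<tau>2 I"
    and root1: "\<And>a. a \<in> I \<Longrightarrow> pev \<phi>1 (\<tau>1 a) \<psi> = 0" and root2: "\<And>a. a \<in> I \<Longrightarrow> pev \<phi>2 (\<tau>2 a) \<psi> = 0"
begin

definition rep :: "('i \<Rightarrow> 'l) \<Rightarrow> ('i \<Rightarrow> 'l) \<Rightarrow> bool" where
  "rep f f' \<longleftrightarrow> (\<exists>g. \<forall>a\<in>I. f a = pev \<phi>1 (\<tau>1 a) g \<and> f' a = pev \<phi>2 (\<tau>2 a) g)"

lemma rep_const: "rep (\<lambda>_. \<phi>1 x) (\<lambda>_. \<phi>2 x)"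
  unfolding rep_def
  by (rule exI[of _ "[:x:]"]) (simp add: pev_pCons hom1 hom2 is_homD[OF is_hom_pev[OF hom1]] is_homD[OF is_hom_pev[OF hom2]])

lemma rep_one: "rep (\<lambda>_. 1) (\<lambda>_. 1)"
  using rep_const[of 1] by (simp add: is_homD[OF hom1] is_homD[OF hom2])

lemma rep_zero: "rep (\<lambda>_. 0) (\<lambda>_. 0)"
  using rep_const[of 0] by (simp add: is_homD[OF hom1] is_homD[OF hom2])

lemma rep_pev: "rep (\<lambda>a. pev \<phi>1 (\<tau>1 a) g) (\<lambda>a. pev \<phi>2 (\<tau>2 a) g)"
  unfolding rep_def by blast

lemma rep_root: "rep \<tau>1 \<tau>2"
  unfolding rep_def
  by (rule exI[of _ "[:0, 1:]"]) (simp add: pev_pCons hom1 hom2 is_homD[OF hom1] is_homD[OF hom2]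
      is_homD[OF is_hom_pev[OF hom1]] is_homD[OF is_hom_pev[OF hom2]])

lemma rep_add: assumes "rep f f'" "rep g g'" shows "rep (\<lambda>a. f a + g a) (\<lambda>a. f' a + g' a)"
proof -
  obtain p q where "\<forall>a\<in>I. f a = pev \<phi>1 (\<tau>1 a) p \<and> f' a = pev \<phi>2 (\<tau>2 a) p"
    "\<forall>a\<in>I. g a = pev \<phi>1 (\<tau>1 a) q \<and> g' a = pev \<phi>2 (\<tau>2 a) q"
    using assms unfolding rep_def by blast
  then show ?thesis unfolding rep_def
    by (intro exI[of _ "p + q"]) (simp add: is_homD[OF is_hom_pev[OF hom1]] is_homD[OF is_hom_pev[OF hom2]])
qed

lemma rep_mult: assumes "rep f f'" "rep g g'" shows "rep (\<lambda>a. f a * g a) (\<lambda>a. f' a * g' a)"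
proof -
  obtain p q where "\<forall>a\<in>I. f a = pev \<phi>1 (\<tau>1 a) p \<and> f' a = pev \<phi>2 (\<tau>2 a) p"
    "\<forall>a\<in>I. g a = pev \<phi>1 (\<tau>1 a) q \<and> g' a = pev \<phi>2 (\<tau>2 a) q"
    using assms unfolding rep_def by blast
  then show ?thesis unfolding rep_def
    by (intro exI[of _ "p * q"]) (simp add: is_homD[OF is_hom_pev[OF hom1]] is_homD[OF is_hom_pev[OF hom2]])
qed

lemma rep_cong:
  assumes "rep f f'" "\<And>a. a \<in> I \<Longrightarrow> g a = f a" "\<And>a. a \<in> I \<Longrightarrow> g' a = f' a"
  shows "rep g g'"
  using assms unfolding rep_def by auto

lemma rep_power: "rep f f' \<Longrightarrow> rep (\<lambda>a. f a ^ n) (\<lambda>a. f' a ^ n)"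
  by (induct n) (auto intro: rep_one rep_mult)

lemma rep_sum: "(\<And>j. j \<in> J \<Longrightarrow> rep (f j) (f' j)) \<Longrightarrow> rep (\<lambda>a. \<Sum>j\<in>J. f j a) (\<lambda>a. \<Sum>j\<in>J. f' j a)"
  by (induct J rule: infinite_finite_induct) (auto intro: rep_zero rep_add)

lemma \<psi>_split: "map_poly \<phi>1 \<psi> = (\<Prod>x\<in>\<tau>1 ` I. [:- x, 1:])" "map_poly \<phi>2 \<psi> = (\<Prod>x\<in>\<tau>2 ` I. [:- x, 1:])"
proof -
  have d: "degree (map_poly f \<psi>) = card I \<and> lead_coeff (map_poly f \<psi>) = 1" if f: "is_hom f" for f :: "'k \<Rightarrow> 'l"
  proof -
    have "degree (map_poly f \<psi>) = degree \<psi>"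
      by (rule degree_map_poly) (simp add: is_hom_inject[OF f])
    then show ?thesis using deg by (simp add: coeff_map_poly is_homD[OF f])
  qed
  show "map_poly \<phi>1 \<psi> = (\<Prod>x\<in>\<tau>1 ` I. [:- x, 1:])"
    by (rule monic_poly_split) (use d[OF hom1] fin root1 in \<open>auto simp: card_image[OF inj1] pev_def\<close>)
  show "map_poly \<phi>2 \<psi> = (\<Prod>x\<in>\<tau>2 ` I. [:- x, 1:])"
    by (rule monic_poly_split) (use d[OF hom2] fin root2 in \<open>auto simp: card_image[OF inj2] pev_def\<close>)
qed

text \<open>Nonvanishing is assumed on the first fibre only. A nonconstant common divisor of g and
  \<open>\<psi>\<close> would leave a cofactor with too few roots, so some root of the first fibre
  would be a zero of g. Hence g is invertible modulo \<open>\<psi>\<close> over the common field,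
  and this forces nonvanishing on the second fibre too.\<close>

lemma rep_inverse:
  assumes "rep f f'" and nz: "\<And>a. a \<in> I \<Longrightarrow> f a \<noteq> 0"
  shows "rep (\<lambda>a. inverse (f a)) (\<lambda>a. inverse (f' a))" and "\<And>a. a \<in> I \<Longrightarrow> f' a \<noteq> 0"
proof -
  obtain g where g: "\<And>a. a \<in> I \<Longrightarrow> f a = pev \<phi>1 (\<tau>1 a) g \<and> f' a = pev \<phi>2 (\<tau>2 a) g"
    using assms unfolding rep_def by blast
  obtain u v d where d: "u * g + v * \<psi> = d" "d dvd g" "d dvd \<psi>" using poly_bezout by blast
  obtain e where e: "\<psi> = d * e" using d(3) by (auto simp: dvd_def)
  have \<psi>0: "\<psi> \<noteq> 0" using deg(2) by auto
  then have nz': "d \<noteq> 0" "e \<noteq> 0" using e by auto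
  have "degree d = 0"
  proof (rule ccontr)
    assume "degree d \<noteq> 0"
    then have "degree e < card I" using deg(1) nz' by (simp add: e degree_mult_eq)
    moreover have e0: "map_poly \<phi>1 e \<noteq> 0"
      using nz'(2) is_hom_inject[OF hom1] by (auto simp: poly_eq_iff coeff_map_poly is_homD[OF hom1])
    moreover have "degree (map_poly \<phi>1 e) \<le> degree e"
      by (rule degree_le) (simp add: coeff_map_poly is_homD[OF hom1] coeff_eq_0)
    ultimately have "card {x. poly (map_poly \<phi>1 e) x = 0} < card (\<tau>1 ` I)"
      using card_poly_roots_bound[OF e0] by (simp add: card_image[OF inj1])
    then have "\<not> \<tau>1 ` I \<subseteq> {x. poly (map_poly \<phi>1 e) x = 0}"
      using card_mono[OF poly_roots_finite[OF e0], of "\<tau>1 ` I"] by auto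
    then obtain a where a: "a \<in> I" "pev \<phi>1 (\<tau>1 a) e \<noteq> 0" by (auto simp: pev_def)
    note h = is_homD[OF is_hom_pev[OF hom1, of "\<tau>1 a"]]
    have "pev \<phi>1 (\<tau>1 a) d * pev \<phi>1 (\<tau>1 a) e = 0" using root1[OF a(1)] e h by simp
    then have "pev \<phi>1 (\<tau>1 a) d = 0" using a(2) by simp
    moreover obtain q where "g = d * q" using d(2) by (auto simp: dvd_def)
    ultimately have "pev \<phi>1 (\<tau>1 a) g = 0" using h by simp
    then show False using g[OF a(1)] nz[OF a(1)] by simp
  qed
  then obtain x where x: "d = [:x:]" by (rule degree_eq_zeroE)
  have x0: "x \<noteq> 0" using nz' x by auto
  define w where "w = smult (inverse x) u"
  have "w * g + smult (inverse x) v * \<psi> = smult (inverse x) d" unfolding w_def d(1)[symmetric] by (simp add: smult_add_right)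
  then have w: "w * g + smult (inverse x) v * \<psi> = 1" using x x0 by simp
  have 1: "pev \<phi>1 (\<tau>1 a) w * f a = 1" if "a \<in> I" for a
  proof -
    note h = is_homD[OF is_hom_pev[OF hom1, of "\<tau>1 a"]]
    have "pev \<phi>1 (\<tau>1 a) (w * g + smult (inverse x) v * \<psi>) = pev \<phi>1 (\<tau>1 a) 1" by (simp only: w)
    then show ?thesis using g[OF that] by (simp only: h root1[OF that] mult_zero_right add_0_right)
  qed
  have 2: "pev \<phi>2 (\<tau>2 a) w * f' a = 1" if "a \<in> I" for a
  proof -
    note h = is_homD[OF is_hom_pev[OF hom2, of "\<tau>2 a"]]
    have "pev \<phi>2 (\<tau>2 a) (w * g + smult (inverse x) v * \<psi>) = pev \<phi>2 (\<tau>2 a) 1" by (simp only: w)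
    then show ?thesis using g[OF that] by (simp only: h root2[OF that] mult_zero_right add_0_right)
  qed
  show "rep (\<lambda>a. inverse (f a)) (\<lambda>a. inverse (f' a))"
    unfolding rep_def
    by (rule exI[of _ w]) (metis 1 2 inverse_unique mult.commute)
  show "f' a \<noteq> 0" if "a \<in> I" for a using 2[OF that] by auto
qed

lemma rep_divide:
  assumes "rep f f'" "rep g g'" "\<And>a. a \<in> I \<Longrightarrow> g a \<noteq> 0"
  shows "rep (\<lambda>a. f a / g a) (\<lambda>a. f' a / g' a)"
  unfolding divide_inverse by (rule rep_mult[OF assms(1) rep_inverse(1)[OF assms(2,3)]])

text \<open>The trace is read off as the coefficient of degree \<open>card I - 1\<close> of \<open>g \<psi>' mod \<psi>\<close>, by Lagrange interpolation.\<close>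
lemma trace_one:
  fixes f :: "'k \<Rightarrow> 'l" and \<tau> :: "'i \<Rightarrow> 'l"
  assumes f: "is_hom f" and inj: "inj_on \<tau> I" and root: "\<And>a. a \<in> I \<Longrightarrow> pev f (\<tau> a) \<psi> = 0"
    and split: "map_poly f \<psi> = (\<Prod>x\<in>\<tau> ` I. [:- x, 1:])" and I: "I \<noteq> {}"
  shows "f (coeff ((g * pderiv \<psi>) mod \<psi>) (card I - 1)) = (\<Sum>a\<in>I. pev f (\<tau> a) g)"
proof -
  let ?r = "(g * pderiv \<psi>) mod \<psi>"
  let ?Q = "\<lambda>a. \<Prod>b\<in>I - {a}. [:- \<tau> b, 1:]"
  define P where "P = (\<Sum>a\<in>I. smult (pev f (\<tau> a) g) (?Q a))"
  have cI: "0 < card I" using I fin by (simp add: card_gt_0_iff)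
  have \<psi>0: "\<psi> \<noteq> 0" using deg(2) by auto
  have dQ: "degree (?Q a) = card I - 1" "coeff (?Q a) (card I - 1) = 1" if "a \<in> I" for a
  proof -
    show 1: "degree (?Q a) = card I - 1" using that fin by (subst degree_prod_sum_eq) auto
    have "lead_coeff (?Q a) = 1" by (simp add: lead_coeff_prod)
    then show "coeff (?Q a) (card I - 1) = 1" by (simp only: 1)
  qed
  have split': "map_poly f \<psi> = (\<Prod>a\<in>I. [:- \<tau> a, 1:])" unfolding split by (rule prod.reindex_cong[OF inj]) auto
  have der: "poly (pderiv (map_poly f \<psi>)) (\<tau> a) = poly (?Q a) (\<tau> a)" if a: "a \<in> I" for a
  proof -
    have "map_poly f \<psi> = [:- \<tau> a, 1:] * ?Q a" unfolding split' by (rule prod.remove[OF fin a])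
    then have "pderiv (map_poly f \<psi>) = [:- \<tau> a, 1:] * pderiv (?Q a) + ?Q a * pderiv [:- \<tau> a, 1:]"
      by (simp only: pderiv_mult)
    then show ?thesis by (simp add: pderiv_pCons)
  qed
  have Pv: "poly P (\<tau> a) = pev f (\<tau> a) g * poly (?Q a) (\<tau> a)" if a: "a \<in> I" for a
  proof -
    have "poly (?Q b) (\<tau> a) = 0" if "b \<in> I" "b \<noteq> a" for b
      using that a fin by (auto simp: poly_prod)
    then have "poly P (\<tau> a) = (\<Sum>b\<in>I. if b = a then pev f (\<tau> a) g * poly (?Q a) (\<tau> a) else 0)"
      unfolding P_def by (simp add: poly_sum) (rule sum.cong, auto)
    then show ?thesis using a fin by simp
  qed
  have rv: "poly (map_poly f ?r) (\<tau> a) = pev f (\<tau> a) g * poly (?Q a) (\<tau> a)" if a: "a \<in> I" for a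
  proof -
    note h = is_homD[OF is_hom_pev[OF f, of "\<tau> a"]]
    have "pev f (\<tau> a) ?r = pev f (\<tau> a) ((g * pderiv \<psi>) div \<psi> * \<psi> + ?r)"
      by (simp only: h root[OF a] mult_zero_right add_0_left)
    also have "\<dots> = pev f (\<tau> a) (g * pderiv \<psi>)" by (simp only: div_mult_mod_eq)
    also have "\<dots> = pev f (\<tau> a) g * poly (?Q a) (\<tau> a)"
      unfolding h(4) der[OF a, symmetric] by (simp add: pev_def map_poly_pderiv[OF f])
    finally show ?thesis by (simp only: pev_def)
  qed
  have "degree ?r < card I" using degree_mod_less[OF \<psi>0, of "g * pderiv \<psi>"] deg(1) cI by auto
  then have dr: "degree (map_poly f ?r) < card I"
    by (metis degree_le coeff_map_poly is_homD(1)[OF f] coeff_eq_0 le_less_trans)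
  have "degree P \<le> card I - 1"
    unfolding P_def by (rule degree_sum_le[OF fin]) (metis degree_smult_le dQ(1))
  then have dP: "degree P < card I" using cI by simp
  have "map_poly f ?r = P"
  proof (rule ccontr)
    assume "map_poly f ?r \<noteq> P"
    then have n0: "map_poly f ?r - P \<noteq> 0" by simp
    have "degree (map_poly f ?r - P) < card I" using dr dP by (meson degree_diff_le_max le_less_trans max_less_iff_conj)
    moreover have "\<tau> ` I \<subseteq> {x. poly (map_poly f ?r - P) x = 0}" using Pv rv by auto
    then have "card (\<tau> ` I) \<le> card {x. poly (map_poly f ?r - P) x = 0}" by (rule card_mono[OF poly_roots_finite[OF n0]])
    ultimately show False using card_poly_roots_bound[OF n0] by (simp add: card_image[OF inj])
  qed
  then have "f (coeff ?r (card I - 1)) = coeff P (card I - 1)" by (metis coeff_map_poly is_homD(1)[OF f])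
  also have "\<dots> = (\<Sum>a\<in>I. pev f (\<tau> a) g)"
    unfolding P_def coeff_sum by (rule sum.cong) (simp_all only: coeff_smult dQ(2) mult_1_right)
  finally show ?thesis .
qed

lemma rep_trace:
  assumes "rep f f'" "I \<noteq> {}"
  obtains x where "\<phi>1 x = (\<Sum>a\<in>I. f a)" "\<phi>2 x = (\<Sum>a\<in>I. f' a)"
proof -
  obtain g where g: "\<And>a. a \<in> I \<Longrightarrow> f a = pev \<phi>1 (\<tau>1 a) g \<and> f' a = pev \<phi>2 (\<tau>2 a) g"
    using assms unfolding rep_def by blast
  show ?thesis
    by (rule that[OF trace_one[OF hom1 inj1 root1 \<psi>_split(1) assms(2), of g, THEN trans]
          trace_one[OF hom2 inj2 root2 \<psi>_split(2) assms(2), of g, THEN trans]])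
      (auto simp: g)
qed

end

section \<open>Integrality and denominators\<close>

definition integral_over :: "('k::field \<Rightarrow> 'l::field) \<Rightarrow> 'k set \<Rightarrow> 'l \<Rightarrow> bool" where
  "integral_over f R z \<longleftrightarrow> (\<exists>n r. (\<forall>k<n. r k \<in> R) \<and> z ^ n = (\<Sum>k<n. f (r k) * z ^ k))"

definition rspan :: "('k::field \<Rightarrow> 'l::field) \<Rightarrow> 'k set \<Rightarrow> 'l set \<Rightarrow> 'l set" where
  "rspan f R B = {\<Sum>b\<in>B. f (r b) * b | r. \<forall>b. r b \<in> R}"

lemma rspan_add:
  assumes "is_hom f" "is_subring R" "x \<in> rspan f R B" "y \<in> rspan f R B"
  shows "x + y \<in> rspan f R B"
proof -
  obtain r r' where "\<forall>b. r b \<in> R" "\<forall>b. r' b \<in> R" "x = (\<Sum>b\<in>B. f (r b) * b)" "y = (\<Sum>b\<in>B. f (r' b) * b)"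
    using assms(3,4) by (auto simp: rspan_def)
  then have "(\<forall>b. r b + r' b \<in> R) \<and> x + y = (\<Sum>b\<in>B. f (r b + r' b) * b)"
    by (simp add: is_subringD[OF assms(2)] is_homD[OF assms(1)] sum.distrib distrib_right)
  then show ?thesis unfolding rspan_def by (intro CollectI exI[of _ "\<lambda>b. r b + r' b"]) auto
qed

lemma rspan_smult:
  assumes "is_hom f" "is_subring R" "x \<in> rspan f R B" "a \<in> R"
  shows "f a * x \<in> rspan f R B"
proof -
  obtain r where "\<forall>b. r b \<in> R" "x = (\<Sum>b\<in>B. f (r b) * b)"
    using assms(3) by (auto simp: rspan_def)
  then have "(\<forall>b. a * r b \<in> R) \<and> f a * x = (\<Sum>b\<in>B. f (a * r b) * b)"
    by (simp add: is_subringD[OF assms(2)] is_homD[OF assms(1)] sum_distrib_left mult.assoc assms(4))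
  then show ?thesis unfolding rspan_def by (intro CollectI exI[of _ "\<lambda>b. a * r b"]) auto
qed

lemma rspan_0: "is_hom f \<Longrightarrow> is_subring R \<Longrightarrow> 0 \<in> rspan f R B"
  unfolding rspan_def by (intro CollectI exI[of _ "\<lambda>_. 0"]) (auto simp: is_homD is_subringD)

lemma rspan_base:
  assumes "is_hom f" "is_subring R" "b \<in> B" "finite B"
  shows "b \<in> rspan f R B"
  unfolding rspan_def
proof (intro CollectI exI[of _ "\<lambda>x. if x = b then 1 else 0"] conjI allI)
  have "(\<Sum>x\<in>B. f (if x = b then 1 else 0) * x) = (\<Sum>x\<in>B. if x = b then x else 0)"
    by (rule sum.cong) (auto simp: is_homD[OF assms(1)])
  then show "b = (\<Sum>x\<in>B. f (if x = b then 1 else 0) * x)" using assms(3,4) by simp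
qed (auto simp: is_subringD[OF assms(2)])

lemma rspan_sum:
  assumes "is_hom f" "is_subring R" "\<And>i. i \<in> J \<Longrightarrow> g i \<in> rspan f R B"
  shows "sum g J \<in> rspan f R B"
  using assms(3) by (induct J rule: infinite_finite_induct) (auto intro: rspan_0 rspan_add assms)

lemma integral_ring_extend:
  fixes f :: "'k::field \<Rightarrow> 'l::field"
  assumes f: "is_hom f" and R: "is_subring R" and A: "is_subring A" "f ` R \<subseteq> A" and B: "finite B" "A \<subseteq> rspan f R B"
    and z: "integral_over f R z"
  obtains A' B' where "is_subring A'" "A \<subseteq> A'" "z \<in> A'" "finite B'" "A' \<subseteq> rspan f R B'"
proof -
  obtain n r where r: "\<forall>k<n. r k \<in> R" "z ^ n = (\<Sum>k<n. f (r k) * z ^ k)" using z unfolding integral_over_def by blast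
  have n: "0 < n" using r(2) by (cases n) auto
  define A' where "A' = {\<Sum>k<n. a k * z ^ k | a. \<forall>k<n. a k \<in> A}"
  have A'I: "(\<forall>k<n. a k \<in> A) \<Longrightarrow> (\<Sum>k<n. a k * z ^ k) \<in> A'" for a unfolding A'_def by blast
  have add: "x + y \<in> A'" if xy: "x \<in> A'" "y \<in> A'" for x y
  proof -
    obtain a b where "\<forall>k<n. a k \<in> A" "\<forall>k<n. b k \<in> A" "x = (\<Sum>k<n. a k * z ^ k)" "y = (\<Sum>k<n. b k * z ^ k)"
      using xy unfolding A'_def by blast
    then show ?thesis using A'I[of "\<lambda>k. a k + b k"] by (simp add: is_subringD[OF A(1)] sum.distrib distrib_right)
  qed
  have smult: "c * x \<in> A'" if xy: "x \<in> A'" "c \<in> A" for x c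
  proof -
    obtain a where "\<forall>k<n. a k \<in> A" "x = (\<Sum>k<n. a k * z ^ k)"
      using xy unfolding A'_def by blast
    then show ?thesis using A'I[of "\<lambda>k. c * a k"] xy by (simp add: is_subringD[OF A(1)] sum_distrib_left mult.assoc)
  qed
  have zmult: "z * x \<in> A'" if xy: "x \<in> A'" for x
  proof -
    obtain a where a: "\<forall>k<n. a k \<in> A" "x = (\<Sum>k<n. a k * z ^ k)"
      using xy unfolding A'_def by blast
    obtain m where m: "n = Suc m" using n by (cases n) auto
    have "z * x = (\<Sum>k<m. a k * z ^ Suc k) + a m * z ^ n"
      unfolding a(2) m by (simp add: sum_distrib_left distrib_left mult_ac)
    also have "(\<Sum>k<m. a k * z ^ Suc k) = (\<Sum>k<n. (if k = 0 then 0 else a (k - 1)) * z ^ k)"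
      unfolding m sum.lessThan_Suc_shift by simp
    finally have e: "z * x = (\<Sum>k<n. (if k = 0 then 0 else a (k - 1)) * z ^ k) + a m * (\<Sum>k<n. f (r k) * z ^ k)"
      unfolding r(2) .
    show ?thesis unfolding e
    proof (intro add smult A'I allI impI)
      show "(if k = 0 then 0 else a (k - 1)) \<in> A" if "k < n" for k
        using that a(1) is_subringD[OF A(1)] by auto
      show "a m \<in> A" using a(1) m by simp
      show "f (r k) \<in> A" if "k < n" for k using that r(1) A(2) by auto
    qed
  qed
  have zpow: "z ^ k * x \<in> A'" if "x \<in> A'" for k x
    using that by (induct k) (auto intro: zmult simp: mult.assoc)
  have sumA: "sum g J \<in> A'" if "\<And>j. j \<in> J \<Longrightarrow> g j \<in> A'" "0 \<in> A'" for g and J :: "nat set"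
    using that by (induct J rule: infinite_finite_induct) (auto intro: add)
  have A_sub: "c \<in> A'" if "c \<in> A" for c
  proof -
    have "(\<Sum>k<n. (if k = 0 then c else 0) * z ^ k) = (\<Sum>k<n. if k = 0 then c else 0)"
      by (rule sum.cong) auto
    then have "(\<Sum>k<n. (if k = 0 then c else 0) * z ^ k) = c" using n by simp
    then show ?thesis using A'I[of "\<lambda>k. if k = 0 then c else 0"] that is_subringD[OF A(1)] by auto
  qed
  have z0: "0 \<in> A'" and o1: "1 \<in> A'" using A_sub is_subringD[OF A(1)] by auto
  have mult: "x * y \<in> A'" if xy: "x \<in> A'" "y \<in> A'" for x y
  proof -
    obtain a where a: "\<forall>k<n. a k \<in> A" "x = (\<Sum>k<n. a k * z ^ k)" using xy unfolding A'_def by blast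
    have "x * y = (\<Sum>k<n. a k * (z ^ k * y))" unfolding a(2) by (simp add: sum_distrib_right mult.assoc)
    also have "\<dots> \<in> A'" using a(1) xy(2) by (intro sumA smult zpow z0) auto
    finally show ?thesis .
  qed
  define B' where "B' = (\<lambda>(b, k). b * z ^ k) ` (B \<times> {..<n})"
  have finB': "finite B'" using B(1) by (simp add: B'_def)
  show ?thesis
  proof (rule that[of A' B'])
    show "is_subring A'" unfolding is_subring_def using z0 o1 add mult by blast
    show "A \<subseteq> A'" using A_sub by blast
    have "z ^ 1 * 1 \<in> A'" by (rule zpow[OF o1])
    then show "z \<in> A'" by simp
    show "finite B'" by fact
    show "A' \<subseteq> rspan f R B'"
    proof
      fix x assume "x \<in> A'"
      then obtain a where a: "\<forall>k<n. a k \<in> A" "x = (\<Sum>k<n. a k * z ^ k)" unfolding A'_def by blast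
      show "x \<in> rspan f R B'"
        unfolding a(2)
      proof (rule rspan_sum[OF f R])
        fix k assume k: "k \<in> {..<n}"
        then obtain s where s: "\<forall>b. s b \<in> R" "a k = (\<Sum>b\<in>B. f (s b) * b)" using a(1) B(2) by (auto simp: rspan_def)
        have "a k * z ^ k = (\<Sum>b\<in>B. f (s b) * (b * z ^ k))" unfolding s(2) by (simp add: sum_distrib_right mult.assoc)
        also have "\<dots> \<in> rspan f R B'"
          by (intro rspan_sum[OF f R] rspan_smult[OF f R] rspan_base[OF f R _ finB'])
            (use s(1) k in \<open>auto simp: B'_def\<close>)
        finally show "a k * z ^ k \<in> rspan f R B'" .
      qed
    qed
  qed
qed

text \<open>A ring inside a finitely generated module takes the place of the integral closure: every
  polynomial in the elements of \<open>Z\<close> lies in it, and the finite generation is what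
  bounds denominators of all powers of an element at once.\<close>

lemma integral_ring_exists:
  fixes f :: "'k::field \<Rightarrow> 'l::field"
  assumes f: "is_hom f" and R: "is_subring R" and Z: "finite Z" "\<And>z. z \<in> Z \<Longrightarrow> integral_over f R z"
  shows "\<exists>A B. is_subring A \<and> f ` R \<subseteq> A \<and> Z \<subseteq> A \<and> finite B \<and> A \<subseteq> rspan f R B"
  using Z
proof (induct Z)
  case empty
  have "is_subring (f ` R)"
    unfolding is_subring_def using is_homD[OF f] is_subringD[OF R]
    by (auto simp: image_iff) (metis+)
  moreover have "f ` R \<subseteq> rspan f R {1}"
  proof
    fix x assume "x \<in> f ` R"
    then obtain r where r: "r \<in> R" "x = f r" by blast
    then show "x \<in> rspan f R {1}" unfolding rspan_def by (intro CollectI exI[of _ "\<lambda>_. r"]) auto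
  qed
  ultimately show ?case by (intro exI[of _ "f ` R"] exI[of _ "{1}"]) auto
next
  case (insert z Z)
  then obtain A B where A: "is_subring A" "f ` R \<subseteq> A" "Z \<subseteq> A" "finite B" "A \<subseteq> rspan f R B" by auto
  obtain A' B' where "is_subring A'" "A \<subseteq> A'" "z \<in> A'" "finite B'" "A' \<subseteq> rspan f R B'"
    using integral_ring_extend[OF f R A(1,2,4,5), of z] insert(4) by blast
  then show ?case using A by (intro exI[of _ A'] exI[of _ B']) auto
qed

text \<open>A \<open>K\<close>-linear functional on \<open>L\<close> fixing \<open>K\<close> sends a finitely generated \<open>R\<close>-module into a module with bounded denominators.\<close>
lemma bounded_denominator:
  fixes f :: "'k::field \<Rightarrow> 'l::field"
  assumes f: "is_hom f" and R: "is_subring R" and B: "finite B"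
    and frac: "\<And>x. \<exists>d\<in>R. d \<noteq> 0 \<and> d * x \<in> R"
  shows "\<exists>d\<in>R. d \<noteq> 0 \<and> (\<forall>x. f x \<in> rspan f R B \<longrightarrow> d * x \<in> R)"
proof -
  interpret L: vector_space "\<lambda>c x. f c * x"
    by unfold_locales (simp_all add: is_homD[OF f] algebra_simps)
  interpret K: vector_space "(*) :: 'k \<Rightarrow> 'k \<Rightarrow> 'k"
    by unfold_locales (simp_all add: algebra_simps)
  interpret LK: vector_space_pair "\<lambda>c x. f c * x" "(*) :: 'k \<Rightarrow> 'k \<Rightarrow> 'k" ..
  have "L.independent {1 :: 'l}" by (simp add: L.independent_insert)
  from LK.linear_independent_extend[OF this, of "\<lambda>_. 1"]
  obtain g where g: "Vector_Spaces.linear (\<lambda>c x. f c * x) (*) g" "g 1 = 1" by auto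
  interpret g: Vector_Spaces.linear "\<lambda>c x. f c * x" "(*)" g by (rule g(1))
  have gf: "g (f x) = x" for x using g.scale[of x 1] g(2) by simp
  have "\<exists>d\<in>R. d \<noteq> 0 \<and> (\<forall>b\<in>B. d * g b \<in> R)" using B
  proof (induct B)
    case empty then show ?case using is_subringD[OF R] by (intro bexI[of _ 1]) auto
  next
    case (insert b B)
    then obtain d where d: "d \<in> R" "d \<noteq> 0" "\<forall>b\<in>B. d * g b \<in> R" by blast
    obtain e where e: "e \<in> R" "e \<noteq> 0" "e * g b \<in> R" using frac by blast
    show ?case
    proof (intro bexI[of _ "d * e"] conjI ballI)
      fix x assume "x \<in> insert b B"
      moreover have "d * e * g b \<in> R" using is_subringD(4)[OF R d(1) e(3)] by (simp only: mult.assoc)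
      moreover have "d * e * g x \<in> R" if "x \<in> B"
        using is_subringD(4)[OF R e(1) d(3)[rule_format, OF that]] by (simp only: mult.assoc mult.left_commute)
      ultimately show "d * e * g x \<in> R" by auto
    qed (use d e is_subringD[OF R] in auto)
  qed
  then obtain d where d: "d \<in> R" "d \<noteq> 0" "\<And>b. b \<in> B \<Longrightarrow> d * g b \<in> R" by blast
  have "d * x \<in> R" if x: "f x \<in> rspan f R B" for x
  proof -
    obtain r where r: "\<forall>b. r b \<in> R" "f x = (\<Sum>b\<in>B. f (r b) * b)" using x by (auto simp: rspan_def)
    have "x = g (f x)" by (simp only: gf)
    also have "\<dots> = (\<Sum>b\<in>B. r b * g b)" by (simp only: r(2) g.sum g.scale)
    finally have "d * x = (\<Sum>b\<in>B. d * (r b * g b))" by (simp only: sum_distrib_left)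
    also have "\<dots> \<in> R"
    proof (rule is_subring_sum[OF R])
      fix b assume "b \<in> B"
      then show "d * (r b * g b) \<in> R"
        using is_subringD(4)[OF R r(1)[rule_format, of b] d(3)[of b]] by (simp only: mult.left_commute simp_thms)
    qed
    finally show ?thesis .
  qed
  then show ?thesis using d by blast
qed

definition fpoly :: "'a::field poly \<Rightarrow> 'a poly fract" where "fpoly p = Fract p 1"

lemma is_hom_fpoly: "is_hom (fpoly :: 'a::field poly \<Rightarrow> _)"
  by (simp add: is_hom_def fpoly_def Zero_fract_def One_fract_def)

lemma fpoly_inject: "fpoly p = fpoly q \<longleftrightarrow> p = q"
  by (simp add: fpoly_def eq_fract)

lemma fract_fpoly: "\<exists>a b. b \<noteq> 0 \<and> x = fpoly a / fpoly b"
  by (cases x) (auto simp: fpoly_def divide_fract)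

lemma is_subring_range_fpoly: "is_subring (range (fpoly :: 'a::field poly \<Rightarrow> _))"
proof -
  note h = is_homD[OF is_hom_fpoly[where 'a = 'a]]
  have "fpoly p + fpoly q \<in> range fpoly" "fpoly p * fpoly q \<in> range fpoly" for p q :: "'a poly"
    by (simp_all only: h[symmetric] rangeI)
  moreover have "0 \<in> range (fpoly :: 'a poly \<Rightarrow> _)" "1 \<in> range (fpoly :: 'a poly \<Rightarrow> _)"
    using h(1,2) by (metis rangeI)+
  ultimately show ?thesis unfolding is_subring_def by blast
qed

text \<open>Integral closedness of \<open>k[H]\<close> in its field of fractions: if \<open>x = a/b\<close> in lowest terms lies in \<open>A\<close>,
  then so does \<open>1/b\<close>, and its powers would have unbounded denominators.\<close>
lemma integral_fract_is_poly:
  fixes f :: "'a::field poly fract \<Rightarrow> 'l::field"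
  assumes f: "is_hom f" and A: "is_subring A" "f ` range fpoly \<subseteq> A" and B: "finite B" "A \<subseteq> rspan f (range fpoly) B"
    and x: "f x \<in> A"
  shows "x \<in> range fpoly"
proof -
  note h = is_homD[OF is_hom_fpoly[where 'a = 'a]]
  have "\<exists>d\<in>range fpoly. d \<noteq> 0 \<and> d * y \<in> range fpoly" for y :: "'a poly fract"
  proof -
    obtain a b where "b \<noteq> 0" "y = fpoly a / fpoly b" using fract_fpoly by blast
    then show ?thesis using fpoly_inject[of b 0] by (intro bexI[of _ "fpoly b"]) (auto simp: h(1))
  qed
  from bounded_denominator[OF f is_subring_range_fpoly B(1) this]
  obtain d where d: "fpoly d \<noteq> 0" "\<And>y. f y \<in> A \<Longrightarrow> fpoly d * y \<in> range fpoly" using B(2) by blast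
  have d0: "d \<noteq> 0" using d(1) h(1) by auto
  obtain a b where ab: "b \<noteq> 0" "x = fpoly a / fpoly b" using fract_fpoly by blast
  obtain u v g where g: "u * a + v * b = g" "g dvd a" "g dvd b" using poly_bezout by blast
  obtain a' b' where ab': "a = g * a'" "b = g * b'" using g(2,3) by (auto simp: dvd_def)
  have g0: "g \<noteq> 0" "b' \<noteq> 0" using ab ab' by auto
  have nz: "fpoly g \<noteq> 0" "fpoly b' \<noteq> 0" using g0 fpoly_inject[of _ 0] h(1) by metis+
  have x': "x = fpoly a' / fpoly b'" using ab nz by (simp add: ab' h)
  have "g * (u * a' + v * b') = g * 1" using g(1) by (simp add: ab' algebra_simps)
  then have "u * a' + v * b' = 1" using g0 by simp
  then have "fpoly u * fpoly a' + fpoly v * fpoly b' = 1" using h by metis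
  then have inv: "1 / fpoly b' = fpoly u * x + fpoly v" using nz by (simp add: x' field_simps)
  have iA: "f (1 / fpoly b') \<in> A"
    unfolding inv using x A by (auto simp: is_homD[OF f] intro!: is_subringD)
  have "b' ^ n dvd d" for n
  proof -
    have "f ((1 / fpoly b') ^ n) \<in> A" using is_subring_power[OF A(1) iA] by (simp add: is_hom_power[OF f])
    then obtain q where "fpoly d * (1 / fpoly b') ^ n = fpoly q" using d(2) by blast
    then have "fpoly d = fpoly (b' ^ n * q)" using nz by (simp add: h is_hom_power[OF is_hom_fpoly] field_simps)
    then show ?thesis by (simp add: fpoly_inject)
  qed
  then have "n * degree b' \<le> degree d" for n
    using dvd_imp_degree_le[OF _ d0, of "b' ^ n"] g0 by (simp add: degree_power_eq)
  from this[of "Suc (degree d)"] have "degree b' = 0" by (cases "degree b'") auto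
  then obtain y where y: "b' = [:y:]" by (rule degree_eq_zeroE)
  have "y \<noteq> 0" using g0 y by auto
  then have "b' * [:inverse y:] = 1" by (simp add: y)
  then have "fpoly b' * fpoly [:inverse y:] = 1" using h by metis
  then have "x = fpoly (a' * [:inverse y:])" using nz by (simp only: x' h) (simp add: field_simps)
  then show ?thesis by blast
qed

lemma fract_hom_exists:
  fixes e :: "'a::field poly \<Rightarrow> 'l::field"
  assumes e: "is_hom e" and inj: "\<And>p. p \<noteq> 0 \<Longrightarrow> e p \<noteq> 0"
  obtains f :: "'a poly fract \<Rightarrow> 'l" where "is_hom f" "\<And>p. f (fpoly p) = e p"
proof -
  define f where "f x = (let ab = (SOME ab. snd ab \<noteq> 0 \<and> x = Fract (fst ab) (snd ab)) in e (fst ab) / e (snd ab))" for x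
  have f: "f (Fract a b) = e a / e b" if b: "b \<noteq> 0" for a b
  proof -
    define ab where "ab = (SOME ab. snd ab \<noteq> 0 \<and> Fract a b = Fract (fst ab) (snd ab))"
    have "snd ab \<noteq> 0 \<and> Fract a b = Fract (fst ab) (snd ab)"
      unfolding ab_def by (rule someI[of _ "(a, b)"]) (use b in simp)
    then have ab: "snd ab \<noteq> 0" "a * snd ab = fst ab * b" using b by (auto simp: eq_fract)
    have "e a * e (snd ab) = e (fst ab) * e b" using ab(2) is_homD[OF e] by metis
    then show ?thesis unfolding f_def Let_def ab_def[symmetric] using inj ab b by (simp add: frac_eq_eq)
  qed
  show ?thesis
  proof (rule that[of f])
    note h = is_homD[OF e]
    have add: "f (x + y) = f x + f y" and mult: "f (x * y) = f x * f y" for x y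
    proof -
      obtain a b c d where xy: "x = Fract a b" "b \<noteq> 0" "y = Fract c d" "d \<noteq> 0" by (cases x, cases y) auto
      show "f (x + y) = f x + f y" using xy inj[of b] inj[of d] by (simp add: f h add_frac_eq)
      show "f (x * y) = f x * f y" using xy by (simp add: f h)
    qed
    show "is_hom f" unfolding is_hom_def
      using add mult f[of 1 0] f[of 1 1] h by (simp add: Zero_fract_def One_fract_def)
    show "f (fpoly p) = e p" for p by (simp add: fpoly_def f h)
  qed
qed

section \<open>Torsion points\<close>

text \<open>The subgroups of order \<open>p = 2h + 1\<close> of the Tate curve with \<open>q = x\<^sup>M\<close>, \<open>M = p s\<close>, are indexed by \<open>l \<le> p\<close>: for \<open>l < p\<close> the one
  generated by \<open>v = \<zeta>\<^bsup>4l\<^esup> x\<^bsup>4s\<^esup>\<close>, a \<open>p\<close>-th root of \<open>q\<^sup>4\<close>, and for \<open>l = p\<close> the one generated by \<open>v = \<zeta>\<close>. The \<open>k\<close>-th multiple of the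
  generator is \<open>pc l k * x\<^bsup>pm l k\<^esup>\<close>, its coordinate is \<open>tp l k\<close>, and \<open>Fl l\<close> is the series \<open>F\<close> of the quotient curve.\<close>
locale torsion =
  fixes z :: "'a::{field,char2}" and h :: nat and s :: int
  assumes s: "0 < s" and h: "0 < h" and prime_p: "prime (2 * h + 1)" and z: "prim_root z (2 * h + 1)"
begin

definition p :: int where "p = int (2 * h + 1)"
definition M :: int where "M = p * s"
definition pc :: "nat \<Rightarrow> int \<Rightarrow> 'a" where
  "pc l k = (if l < 2 * h + 1 then z powi (4 * int l * k) else z powi k)"
definition pm :: "nat \<Rightarrow> int \<Rightarrow> int" where
  "pm l k = (if l < 2 * h + 1 then 4 * s * k else 0)"
definition tp :: "nat \<Rightarrow> int \<Rightarrow> 'a fls" where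
  "tp l k = tt M (pc l k) (pm l k)"
definition Fl :: "nat \<Rightarrow> 'a fls" where
  "Fl l = (if l < 2 * h + 1 then FF s (z ^ l) else FF (p * M) 1)"

lemma p_pos: "0 < p" "odd p" "3 \<le> p"
  using h unfolding p_def by auto

lemma prime_int_p: "prime p"
  unfolding p_def prime_nat_int_transfer by (rule prime_p)

lemma M_pos: "0 < M" using p_pos s by (simp add: M_def)

lemma z_nz: "z \<noteq> 0" using prim_root_nz[OF z] by simp

lemma z_powi_eq_1: "z powi b = 1 \<longleftrightarrow> p dvd b"
  using z by (simp only: prim_root_def p_def)

lemma pc_nz: "pc l k \<noteq> 0" using z_nz by (simp add: pc_def)

lemma pc_add: "pc l (a + b) = pc l a * pc l b"
  and pc_diff: "pc l (a - b) = pc l a / pc l b"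
  using z_nz by (simp_all add: pc_def power_int_add power_int_diff distrib_left right_diff_distrib)

lemma pm_add: "pm l (a + b) = pm l a + pm l b" and pm_diff: "pm l (a - b) = pm l a - pm l b"
  by (simp_all add: pm_def algebra_simps)

lemma pc_mult: "pc l (int n * k) = pc l k ^ n"
  by (induct n) (simp_all add: pc_add distrib_right, simp add: pc_def)

lemma pm_mult: "pm l (int n * k) = int n * pm l k"
  by (simp add: pm_def)

lemma pm_regular: "regular M (pm l k)" "regular M (pm l k + pm l' k')" "regular M (pm l k - pm l' k')"
proof -
  have *: "\<exists>j. pm l k = 4 * s * j" for l k by (cases "l < 2 * h + 1") (auto simp: pm_def)
  obtain j j' where j: "pm l k = 4 * s * j" "pm l' k' = 4 * s * j'" using * by meson
  have reg: "regular M (4 * s * i)" for i unfolding M_def using p_pos s by (intro regular_multiple) auto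
  show "regular M (pm l k)" using reg j by simp
  show "regular M (pm l k + pm l' k')" using reg[of "j + j'"] j by (simp add: distrib_left)
  show "regular M (pm l k - pm l' k')" using reg[of "j - j'"] j by (simp add: right_diff_distrib)
qed

lemma tp_minus: "tp l (- k) = tp l k"
proof -
  have "pc l (- k) = 1 / pc l k" "pm l (- k) = - pm l k"
    using pc_diff[of l 0 k] by (simp_all add: pc_def pm_def)
  then show ?thesis by (simp only: tp_def tt_inverse)
qed

lemma tp_add_p: "tp l (k + p) = tp l k"
proof -
  have "pc l p = 1" using z_powi_eq_1[of "4 * int l * p"] z_powi_eq_1[of p] by (simp add: pc_def)
  moreover have "pm l p = 4 * M \<or> pm l p = 0" by (auto simp: pm_def M_def)
  ultimately show ?thesis
    unfolding tp_def pc_add pm_add using tt_period[OF M_pos pc_nz] by auto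
qed

lemma tp_mod: "tp l (k + p * i) = tp l k"
proof (induct i rule: int_induct[of _ 0])
  case (step1 i) then show ?case using tp_add_p[of l "k + p * i"] by (simp add: algebra_simps)
next
  case (step2 i) then show ?case using tp_add_p[of l "k + p * (i - 1)"] by (simp add: algebra_simps)
qed simp

lemma fold_residue:
  obtains k' i where "0 \<le> k'" "k' \<le> int h" "k = k' + p * i \<or> k = - k' + p * i"
proof -
  have e: "k = k mod p + p * (k div p)" by simp
  have b: "0 \<le> k mod p" "k mod p < p" using p_pos by simp_all
  show ?thesis
  proof (cases "k mod p \<le> int h")
    case True then show ?thesis using that[of "k mod p" "k div p"] e b by blast
  next
    case False
    have "k = - (p - k mod p) + p * (k div p + 1)" using e by (simp add: algebra_simps)
    moreover have "p - k mod p \<le> int h" using False by (simp add: p_def)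
    moreover have "0 \<le> p - k mod p" using b by linarith
    ultimately show ?thesis using that[of "p - k mod p" "k div p + 1"] by blast
  qed
qed

lemma tp_eq_0_iff: "tp l k = 0 \<longleftrightarrow> p dvd k"
proof (cases "l < 2 * h + 1")
  case True
  have "4 * M dvd pm l k \<longleftrightarrow> (4 * s) * p dvd (4 * s) * k" using True by (simp add: pm_def M_def mult_ac)
  also have "\<dots> \<longleftrightarrow> p dvd k" using s by simp
  finally have "4 * M dvd pm l k \<longleftrightarrow> p dvd k" .
  moreover have "p dvd k \<Longrightarrow> pc l k = 1" using True z_powi_eq_1 by (simp add: pc_def)
  ultimately show ?thesis unfolding tp_def tt_eq_0_iff[OF M_pos pc_nz pm_regular(1)] by blast
next
  case False
  then show ?thesis unfolding tp_def tt_eq_0_iff[OF M_pos pc_nz pm_regular(1)]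
    by (simp add: pm_def pc_def z_powi_eq_1)
qed

lemma pm_regular_double: "regular M (2 * pm l k)"
  using pm_regular(2)[of l k l k] by (simp only: mult_2)

lemma tp_one_plus: "1 + tp l k \<noteq> 0"
  unfolding tp_def by (rule one_plus_tt[OF M_pos pc_nz pm_regular(1) pm_regular_double])

lemma tp_double: "FF M 1 * tp l (2 * k) = (tp l k)\<^sup>2 / (1 + tp l k)^4"
proof -
  have "pc l (2 * k) = (pc l k)\<^sup>2" "pm l (2 * k) = 2 * pm l k"
    using pc_mult[of l 2 k] pm_mult[of l 2 k] by simp_all
  then show ?thesis
    unfolding tp_def by (simp only: tt_double[OF M_pos pc_nz pm_regular(1) pm_regular_double])
qed

text \<open>Equal values of t make the numerator in \<open>tt_add\<close> vanish, so t is 0 at the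
  sum or at the difference of the two points. Since t vanishes only at the origin, the points agree
  up to sign, and distinct subgroups of prime order meet only in the origin.\<close>

lemma tp_inj:
  assumes "1 \<le> k" "k \<le> int h" "1 \<le> k'" "k' \<le> int h" "l \<le> 2 * h + 1" "l' \<le> 2 * h + 1" and eq: "tp l k = tp l' k'"
  shows "l = l' \<and> k = k'"
proof -
  have small: "\<not> p dvd k" "\<not> p dvd k'" "\<not> p dvd k + k'" "p dvd k - k' \<Longrightarrow> k = k'"
  proof -
    show "\<not> p dvd k" "\<not> p dvd k'" "\<not> p dvd k + k'" using assms(1-4) unfolding p_def by (auto dest!: zdvd_imp_le)
    assume "p dvd k - k'"
    moreover have "\<bar>k - k'\<bar> < p" using assms(1-4) unfolding p_def by auto
    ultimately show "k = k'" using dvd_imp_le_int[of "k - k'" p] by force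
  qed
  have "tt M (pc l k * pc l' k') (pm l k + pm l' k') * tt M (pc l k / pc l' k') (pm l k - pm l' k') = 0"
    unfolding tt_add[OF M_pos pc_nz pc_nz pm_regular(1) pm_regular(1) pm_regular(2,3)]
    using eq by (simp add: tp_def add_self)
  then have zero: "(4 * M dvd pm l k + pm l' k' \<and> pc l k * pc l' k' = 1) \<or> (4 * M dvd pm l k - pm l' k' \<and> pc l k / pc l' k' = 1)"
    using tt_eq_0_iff[OF M_pos _ pm_regular(2), of "pc l k * pc l' k'" l k l' k']
      tt_eq_0_iff[OF M_pos _ pm_regular(3), of "pc l k / pc l' k'" l k l' k'] pc_nz by simp
  have dv: "4 * M dvd 4 * s * i \<longleftrightarrow> p dvd i" for i
    using s by (metis M_def dvd_times_left_cancel_iff mult.assoc mult.commute mult_eq_0_iff less_irrefl zero_neq_numeral)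
  consider "l < 2 * h + 1" "l' < 2 * h + 1" | "l = 2 * h + 1" "l' = 2 * h + 1"
    | "l < 2 * h + 1" "l' = 2 * h + 1" | "l = 2 * h + 1" "l' < 2 * h + 1" using assms by linarith
  then show ?thesis
  proof cases
    case 1
    have "\<not> 4 * M dvd pm l k + pm l' k'" using dv[of "k + k'"] small 1 by (simp add: pm_def distrib_left)
    with zero have c: "4 * M dvd pm l k - pm l' k'" "pc l k = pc l' k'" using pc_nz[of l' k'] by auto
    have k: "k = k'" using c(1) dv[of "k - k'"] small 1 by (simp add: pm_def right_diff_distrib)
    have "z powi (4 * int l * k - 4 * int l' * k) = 1"
      using c(2) 1 z_nz unfolding k by (simp add: pc_def power_int_diff)
    then have "p dvd 4 * k * (int l - int l')" unfolding z_powi_eq_1 by (simp add: algebra_simps)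
    moreover have "\<not> p dvd 4 * k"
    proof
      assume "p dvd 4 * k"
      moreover have "4 * k = 2 * (2 * k)" by simp
      ultimately have "p dvd 2" using small(1) by (simp only: prime_dvd_mult_iff[OF prime_int_p]) blast
      then show False using p_pos by (auto dest!: zdvd_imp_le)
    qed
    ultimately have "p dvd int l - int l'" using prime_dvd_mult_iff[OF prime_int_p] by blast
    moreover have "\<bar>int l - int l'\<bar> < p" using 1 unfolding p_def by auto
    ultimately have "l = l'" using dvd_imp_le_int[of "int l - int l'" p] by force
    then show ?thesis using k by simp
  next
    case 2
    have "pc l k * pc l' k' = 1 \<longleftrightarrow> p dvd k + k'"
      using 2 z_nz z_powi_eq_1[of "k + k'"] by (simp add: pc_def power_int_add)
    moreover have "pc l k / pc l' k' = 1 \<longleftrightarrow> p dvd k - k'"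
      using 2 z_nz z_powi_eq_1[of "k - k'"] by (simp add: pc_def power_int_diff)
    ultimately show ?thesis using zero small 2 by auto
  next
    case 3
    then show ?thesis using zero dv[of k] small by (simp add: pm_def)
  next
    case 4
    then show ?thesis using zero dv[of k'] small by (simp add: pm_def)
  qed
qed

text \<open>Multiplication by a permutes the nonzero residues modulo p up to sign, for which 1, ...,
  h are representatives; injectivity suffices by finiteness.\<close>

lemma half_sum_mult:
  fixes f :: "int \<Rightarrow> 'b::comm_monoid_add"
  assumes even: "\<And>k. f (- k) = f k" and per: "\<And>k i. f (k + p * i) = f k" and a: "\<not> p dvd a"
  shows "(\<Sum>k=1..int h. f (a * k)) = (\<Sum>k=1..int h. f k)"
proof -
  have "\<exists>g. \<forall>k. 0 \<le> g k \<and> g k \<le> int h \<and> (\<exists>i. a * k = g k + p * i \<or> a * k = - g k + p * i)"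
    using fold_residue by (intro choice allI) metis
  then obtain g where g: "\<And>k. 0 \<le> g k" "\<And>k. g k \<le> int h" "\<And>k. \<exists>i. a * k = g k + p * i \<or> a * k = - g k + p * i" by blast
  have fg: "f (a * k) = f (g k)" for k
  proof -
    obtain i where "a * k = g k + p * i \<or> a * k = - g k + p * i" using g(3) by blast
    then show ?thesis using per[of "g k" i] per[of "- g k" i] even[of "g k"] by (elim disjE) (simp_all only:)
  qed
  have small: "\<not> p dvd k" if "1 \<le> k" "k \<le> int h" for k using that unfolding p_def by (auto dest!: zdvd_imp_le)
  have sub: "g ` {1..int h} \<subseteq> {1..int h}"
  proof
    fix y assume "y \<in> g ` {1..int h}"
    then obtain k where k: "k \<in> {1..int h}" "y = g k" by blast
    have "g k \<noteq> 0"
    proof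
      assume "g k = 0"
      then have "p dvd a * k" using g(3)[of k] by auto
      then have "p dvd k" using a prime_dvd_mult_iff[OF prime_int_p] by blast
      then show False using small k by auto
    qed
    then show "y \<in> {1..int h}" using k g(1)[of k] g(2)[of k] by auto
  qed
  have inj: "inj_on g {1..int h}"
  proof (rule inj_onI)
    fix k k' assume k: "k \<in> {1..int h}" "k' \<in> {1..int h}" "g k = g k'"
    obtain i i' where "a * k = g k + p * i \<or> a * k = - g k + p * i" "a * k' = g k + p * i' \<or> a * k' = - g k + p * i'"
      using g(3)[of k] g(3)[of k'] k(3) by auto
    then have "a * (k - k') = p * (i - i') \<or> a * (k + k') = p * (i + i')" by (auto simp: algebra_simps)
    then have "p dvd a * (k - k') \<or> p dvd a * (k + k')" by (metis dvd_triv_left)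
    then have "p dvd k - k' \<or> p dvd k + k'" using a prime_dvd_mult_iff[OF prime_int_p] by blast
    moreover have "\<not> p dvd k + k'" using k unfolding p_def by (auto dest!: zdvd_imp_le)
    moreover have "\<bar>k - k'\<bar> < p" using k unfolding p_def by auto
    ultimately show "k = k'" using dvd_imp_le_int[of "k - k'" p] by force
  qed
  have "bij_betw g {1..int h} {1..int h}"
    using inj sub by (simp add: bij_betw_def endo_inj_surj)
  then show ?thesis unfolding fg by (rule sum.reindex_bij_betw)
qed

lemma pm_bound: "1 \<le> k \<Longrightarrow> k \<le> int h \<Longrightarrow> \<bar>pm l k\<bar> < 2 * M"
proof -
  assume k: "1 \<le> k" "k \<le> int h"
  then have "4 * s * k \<le> 4 * s * int h" "0 \<le> 4 * s * k" using s by (auto intro!: mult_left_mono)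
  moreover have "4 * s * int h < 2 * M" using s by (simp add: M_def p_def algebra_simps)
  ultimately have "\<bar>4 * s * k\<bar> < 2 * M" by linarith
  then show ?thesis using M_pos by (simp add: pm_def)
qed

text \<open>The representatives k <= h stay in the range where F t is a Lambert series, so the two
  evaluations of Lambert sums apply, one to the subgroups generated by a root of q^4 and one to the
  roots of unity.\<close>

lemma line_sum: "FF M 1 * (\<Sum>k=1..int h. tp l k) = (FF M 1)\<^sup>2 + (Fl l)\<^sup>2"
proof -
  have "FF M 1 * (\<Sum>k=1..int h. tp l k) = (\<Sum>k=1..int h. lam M (pc l k) (pm l k))"
    unfolding sum_distrib_left tp_def by (rule sum.cong[OF refl], rule tt_lambert) (use pm_bound pc_nz in auto)
  also have "\<dots> = (FF M 1)\<^sup>2 + (Fl l)\<^sup>2"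
  proof (cases "l < 2 * h + 1")
    case True
    have "(z ^ l) ^ (2 * h + 1) = z powi (int l * p)"
      unfolding p_def by (simp only: power_int_mult power_int_of_nat)
    then have "(z ^ l) ^ (2 * h + 1) = 1" using z_powi_eq_1 by simp
    from lam_half_sum_cyclic[OF s this]
    have "(\<Sum>k=1..int h. lam M ((z ^ l) powi (4 * k)) (4 * s * k)) = (FF s (z ^ l))\<^sup>2 + (FF M 1)\<^sup>2"
      by (simp only: M_def p_def)
    moreover have "(z ^ l) powi (4 * k) = pc l k" for k
    proof -
      have "(z ^ l) powi (4 * k) = z powi (int l * (4 * k))" by (simp only: power_int_mult power_int_of_nat)
      then show ?thesis using True by (simp add: pc_def mult.assoc mult.left_commute)
    qed
    ultimately show ?thesis using True by (simp add: pm_def Fl_def add.commute)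
  next
    case False
    then show ?thesis using lam_half_sum_mu[OF M_pos z] by (simp add: pc_def pm_def Fl_def p_def)
  qed
  finally show ?thesis .
qed

text \<open>The lowest exponents s or p M differ from M. Through \<open>line_sum\<close> this makes
  the sum of t over each subgroup nonzero, so that it may serve as a denominator.\<close>

lemma Fl_neq: "Fl l \<noteq> FF M 1"
proof (cases "l < 2 * h + 1")
  case True
  have "s < M" using s p_pos by (simp add: M_def)
  then have "FF M 1 $$ s = (0 :: 'a)" by (rule FF_nonzero(2)[OF M_pos])
  moreover have "FF s (z ^ l) $$ s = z ^ l" by (rule FF_nonzero(1)[OF s]) (simp add: z_nz)
  ultimately have "FF s (z ^ l) $$ s \<noteq> FF M 1 $$ s" using z_nz by simp
  then show ?thesis using True by (auto simp: Fl_def)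
next
  case False
  have "M < p * M" using M_pos p_pos by simp
  then have "FF (p * M) 1 $$ M = (0 :: 'a)" by (rule FF_nonzero(2)[rotated]) (use M_pos p_pos in simp)
  moreover have "FF M 1 $$ M = (1 :: 'a)" by (rule FF_nonzero(1)[OF M_pos]) simp
  ultimately have "FF (p * M) 1 $$ M \<noteq> (FF M 1 $$ M :: 'a)" by simp
  then show ?thesis using False by (auto simp: Fl_def)
qed

lemma FF_M_nz: "FF M 1 \<noteq> (0 :: 'a fls)" using FF_neq_0[OF M_pos, of 1] by simp

lemma line_sum_nz: "(\<Sum>k=1..int h. tp l k) \<noteq> 0"
proof
  assume "(\<Sum>k=1..int h. tp l k) = 0"
  then have "(FF M 1)\<^sup>2 = (Fl l)\<^sup>2" using line_sum[of l] by (simp add: add_eq_0_iff_eq)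
  then show False using square_inj Fl_neq by metis
qed

lemma p_not_dvd: "1 \<le> k \<Longrightarrow> k \<le> int h \<Longrightarrow> \<not> p dvd k"
  unfolding p_def by (auto dest!: zdvd_imp_le)

lemma p_not_dvd_2: "\<not> p dvd 2" using p_pos by (auto dest!: zdvd_imp_le)

lemma tp_half_sum: "\<not> p dvd a \<Longrightarrow> (\<Sum>k=1..int h. g (tp l (a * k))) = (\<Sum>k=1..int h. g (tp l k))"
  using half_sum_mult[of "\<lambda>k. g (tp l k)" a] tp_minus tp_mod by simp

text \<open>\<open>line_sum\<close> determines only the square of \<open>Fl\<close>. Replacing k by
  2k permutes the subgroup, and the doubling formula shows that each F t(2P) is a square; extracting
  roots gives \<open>Fl\<close> as a rational function of t.\<close>

lemma Fl_eq: "Fl l = FF M 1 + (\<Sum>k=1..int h. tp l k / (1 + tp l k)\<^sup>2)"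
proof -
  have "(FF M 1 + (\<Sum>k=1..int h. tp l k / (1 + tp l k)\<^sup>2))\<^sup>2 = (FF M 1)\<^sup>2 + (\<Sum>k=1..int h. (tp l k)\<^sup>2 / (1 + tp l k)^4)"
  proof -
    have "(x\<^sup>2)\<^sup>2 = x^4" for x :: "'a fls" by (simp flip: power_mult)
    then show ?thesis by (simp only: square_add[of "FF M 1"] square_sum power_divide)
  qed
  also have "\<dots> = (FF M 1)\<^sup>2 + FF M 1 * (\<Sum>k=1..int h. tp l (2 * k))"
    by (simp only: tp_double[symmetric] sum_distrib_left)
  also have "\<dots> = (Fl l)\<^sup>2"
    by (simp only: tp_half_sum[OF p_not_dvd_2, of "\<lambda>x. x"] line_sum add_self_left)
  finally show ?thesis by (rule square_inj[symmetric])
qed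

lemma tp_root:
  fixes f :: "'b::comm_ring_1 \<Rightarrow> 'a fls"
  assumes f: "is_hom f" and r: "f r = 1 / FF M 1" and k: "\<not> p dvd k"
  shows "pev f (tp l k) (dn r h) = 0"
proof -
  have nz: "theta False M (pc l k) (pm l k) \<noteq> 0" by (rule theta_regular_nonzero[OF M_pos pc_nz pm_regular(1)])
  have t0: "tp l k \<noteq> 0" using tp_eq_0_iff k by simp
  then have nz': "theta True M (pc l k) (pm l k) \<noteq> 0" by (auto simp: tp_def tt_def)
  have "tp l (int (2 * h + 1) * k) = 0" unfolding tp_eq_0_iff p_def by (rule dvd_triv_left)
  then have "theta True M (pc l k ^ (2 * h + 1)) (int (2 * h + 1) * pm l k) = 0"
    unfolding tp_def pc_mult pm_mult tt_def
    using theta_regular_nonzero[OF M_pos _ pm_regular(1), of "pc l k ^ (2 * h + 1)" l "int (2 * h + 1) * k"] pc_nz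
    unfolding pm_mult by simp
  then have "pev f (tp l k) (da r (2 * h + 1)) = 0"
    using division_poly_theta(2)[OF M_pos pc_nz f r nz nz', of "2 * h + 1"] nz t0 by (simp add: tp_def)
  then show ?thesis unfolding da_odd using is_hom_power[OF is_hom_pev[OF f]] by simp
qed

lemma tp_mult:
  fixes f :: "'b::comm_ring_1 \<Rightarrow> 'a fls"
  assumes f: "is_hom f" and r: "f r = 1 / FF M 1" and k: "\<not> p dvd k"
  shows "tp l (int n * k) = tp l k * pev f (tp l k) (da r n) / pev f (tp l k) (db r n)"
    and "pev f (tp l k) (db r n) \<noteq> 0"
proof -
  have nz: "theta False M (pc l k) (pm l k) \<noteq> 0" by (rule theta_regular_nonzero[OF M_pos pc_nz pm_regular(1)])
  have t0: "tp l k \<noteq> 0" using tp_eq_0_iff k by simp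
  then have nz': "theta True M (pc l k) (pm l k) \<noteq> 0" by (auto simp: tp_def tt_def)
  have nzn: "theta False M (pc l k ^ n) (int n * pm l k) \<noteq> 0"
    unfolding pc_mult[symmetric] pm_mult[symmetric] by (rule theta_regular_nonzero[OF M_pos pc_nz pm_regular(1)])
  note d = division_poly_theta[OF M_pos pc_nz f r nz nz', of n, folded tp_def]
  show "pev f (tp l k) (db r n) \<noteq> 0" using d(1) nzn by auto
  show "tp l (int n * k) = tp l k * pev f (tp l k) (da r n) / pev f (tp l k) (db r n)"
    unfolding tp_def[of l "int n * k"] pc_mult pm_mult tt_def d[symmetric] using nz by simp
qed

text \<open>Multiply the equation of t by F^m, m being its degree. The coefficient of t^j has at
  most m - j factors 1/F, so what results is a monic equation for F t over R.\<close>

lemma tp_integral: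
  fixes f :: "'b::field \<Rightarrow> 'a fls"
  assumes f: "is_hom f" and R: "is_subring R" "F0 \<in> R" and F0: "f F0 = FF M 1" and k: "\<not> p dvd k"
  shows "integral_over f R (FF M 1 * tp l k)"
proof -
  let ?m = "2 * h\<^sup>2 + 2 * h" and ?F = "FF M 1 :: 'a fls" and ?t = "tp l k"
  have F00: "F0 \<noteq> 0" using F0 FF_M_nz is_homD(1)[OF f] by auto
  define r where "r = inverse F0"
  have r: "f r = 1 / ?F" by (simp add: r_def is_hom_inverse[OF f] F0 divide_inverse)
  have rF: "r * F0 = 1" using F00 by (simp add: r_def)
  note dn = dn_monic[OF R rF h]
  have deg: "degree (dn r h) \<le> ?m" by (rule degree_le) (use dn(1) in \<open>auto simp: td_def\<close>)
  have "(\<Sum>j\<le>?m. f (coeff (dn r h) j) * ?t ^ j) = 0"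
    using tp_root[OF f r k] pev_eq_sum[OF f deg] by simp
  then have "(\<Sum>j\<le>?m. ?F ^ ?m * (f (coeff (dn r h) j) * ?t ^ j)) = 0" by (simp flip: sum_distrib_left)
  moreover have "?F ^ ?m * (f (coeff (dn r h) j) * ?t ^ j) = f (coeff (dn r h) j * F0 ^ (?m - j)) * (?F * ?t) ^ j"
    if "j \<le> ?m" for j
  proof -
    have "?F ^ ?m = ?F ^ (?m - j) * ?F ^ j" using that by (simp flip: power_add)
    then show ?thesis by (simp add: is_homD[OF f] is_hom_power[OF f] F0 power_mult_distrib mult_ac)
  qed
  ultimately have "(\<Sum>j\<le>?m. f (coeff (dn r h) j * F0 ^ (?m - j)) * (?F * ?t) ^ j) = 0" by simp
  then have "(\<Sum>j<?m. f (coeff (dn r h) j * F0 ^ (?m - j)) * (?F * ?t) ^ j) + (?F * ?t) ^ ?m = 0"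
    using dn(2) by (simp add: is_homD[OF f] flip: lessThan_Suc_atMost)
  then have "(?F * ?t) ^ ?m = (\<Sum>j<?m. f (coeff (dn r h) j * F0 ^ (?m - j)) * (?F * ?t) ^ j)"
    by (simp add: add_eq_0_iff_eq)
  then show ?thesis
    unfolding integral_over_def
    by (intro exI[of _ ?m] exI[of _ "\<lambda>j. coeff (dn r h) j * F0 ^ (?m - j)"]) (use dn(1) in \<open>auto simp: td_def\<close>)
qed

end

section \<open>Two specializations at level 5 and the sum over subgroups\<close>

definition bc :: "bit \<Rightarrow> 'a::zero_neq_one" where "bc b = (if b = 0 then 0 else 1)"

lemma bc_simps [simp]: "bc 0 = 0" "bc 1 = 1" by (simp_all add: bc_def)

lemma is_hom_bc: "is_hom (bc :: bit \<Rightarrow> 'a::char2)"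
proof -
  have "bc (x + y) = (bc x + bc y :: 'a)" for x y by (cases x; cases y) (simp_all add: add_self two_eq_0)
  moreover have "bc (x * y) = (bc x * bc y :: 'a)" for x y by (cases x; cases y) simp_all
  ultimately show ?thesis unfolding is_hom_def by simp
qed

text \<open>The sum of the two series is h (1 + h), and the second is h^4 times this sum, so h^4 is
  determined.\<close>

lemma level5_unique:
  fixes h k :: "'a::{field,char2}"
  assumes "h * (1 + h)^5 = k * (1 + k)^5" "h^5 * (1 + h) = k^5 * (1 + k)" "h \<noteq> 0" "1 + h \<noteq> 0"
  shows "h = k"
proof -
  have s: "x * (1 + x)^5 + x^5 * (1 + x) = x * (1 + x)" for x :: 'a
  proof -
    have "x * (1 + x)^5 + x^5 * (1 + x) = x * (1 + x) * ((1 + x)^4 + x^4)"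
      by (simp add: algebra_simps eval_nat_numeral)
    then show ?thesis by (simp add: power4_add add.assoc add_self)
  qed
  have f: "x^5 * (1 + x) = x^4 * (x * (1 + x))" for x :: 'a by (simp add: eval_nat_numeral mult_ac)
  have e: "h * (1 + h) = k * (1 + k)" using s[of h] s[of k] assms(1,2) by simp
  have "h^4 * (h * (1 + h)) = k^4 * (h * (1 + h))" using assms(2) unfolding f e .
  then have "(h\<^sup>2)\<^sup>2 = (k\<^sup>2)\<^sup>2" using assms(3,4) by (simp flip: power_mult)
  then show ?thesis by (metis square_inj)
qed

text \<open>The curves for \<open>x\<^sup>p\<close> and \<open>x\<^bsup>5p\<^esup>\<close>, with \<open>x\<close> in the role of \<open>h(x\<^sup>p)\<close>; \<open>\<phi>1\<close> and \<open>\<phi>2\<close> specialize the variable of \<open>\<int>/2(H)\<close> to \<open>h\<close> and \<open>1 + h\<close>.\<close>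
locale hecke = E1: torsion z h 1 + E2: torsion "z ^ 5" h 5
  for z :: "'a::{field,char2}" and h :: nat +
  fixes w :: 'a and \<phi>1 \<phi>2 :: "bit poly fract \<Rightarrow> 'a fls" and x :: "'a fls"
  assumes w: "prim_root w 5" and p5: "\<not> E1.p dvd 5"
    and hom1: "is_hom \<phi>1" and hom2: "is_hom \<phi>2"
    and \<phi>1: "\<And>P. \<phi>1 (fpoly P) = pev bc x P" and \<phi>2: "\<And>P. \<phi>2 (fpoly P) = pev bc (1 + x) P"
    and x: "x \<noteq> 0" "1 + x \<noteq> 0"
    and F: "FF E1.M 1 = x * (1 + x)^5" and G: "FF (5 * E1.M) 1 = x^5 * (1 + x)"
begin

text \<open>The choice of \<open>z ^ 5\<close> and s = 5 makes the points of the second curve the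
  fifth powers of those of the first, that is, their images under division by the fifth roots of
  unity.\<close>

lemma M2: "E2.M = 5 * E1.M" and pc2: "E2.pc l k = E1.pc l k ^ 5" and pm2: "E2.pm l k = 5 * E1.pm l k"
proof -
  have "(z ^ 5) powi i = (z powi i) ^ 5" for i
    by (metis mult.commute power_int_mult power_int_of_nat of_nat_numeral power_int_power)
  then show "E2.M = 5 * E1.M" "E2.pc l k = E1.pc l k ^ 5" "E2.pm l k = 5 * E1.pm l k"
    by (simp_all add: E1.M_def E2.M_def E1.pc_def E2.pc_def E1.pm_def E2.pm_def)
qed

abbreviation "FE \<equiv> FF E1.M (1::'a)"
abbreviation "GE \<equiv> FF E2.M (1::'a)"

lemma GE: "GE = x^5 * (1 + x)" using G by (simp add: M2)

lemma five_torsion: "tt E1.M w 0 * tt E1.M (w\<^sup>2) 0 = pi5 x" "tt E1.M w 0 + tt E1.M (w\<^sup>2) 0 = sig5 x"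
proof -
  obtain y where y: "y \<noteq> 0" "1 + y \<noteq> 0" "FE = y * (1 + y)^5" "FF (5 * E1.M) 1 = y^5 * (1 + y)"
    "tt E1.M w 0 * tt E1.M (w\<^sup>2) 0 = pi5 y" "tt E1.M w 0 + tt E1.M (w\<^sup>2) 0 = sig5 y"
    using level5_mu[OF E1.M_pos w] by blast
  have "y = x" by (rule level5_unique) (use y F G in simp_all)
  then show "tt E1.M w 0 * tt E1.M (w\<^sup>2) 0 = pi5 x" "tt E1.M w 0 + tt E1.M (w\<^sup>2) 0 = sig5 x" using y by simp_all
qed

text \<open>Both sides depend on k only modulo p and up to sign, which moves k into the range where
  the Lambert expansion behind \<open>level5_isogeny\<close> is valid.\<close>

lemma isogeny: "GE * E2.tp l k = FE * E1.tp l k + iso5 x (E1.tp l k)" and den_nz: "den5 x (E1.tp l k) \<noteq> 0"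
proof -
  obtain k' i where k': "0 \<le> k'" "k' \<le> int h" "k = k' + E1.p * i \<or> k = - k' + E1.p * i" by (rule E1.fold_residue)
  have e: "E1.tp l k = E1.tp l k'" "E2.tp l k = E2.tp l k'"
    using k'(3) E1.tp_mod[of l _ i] E2.tp_mod[of l _ i] E1.tp_minus[of l k'] E2.tp_minus[of l k']
    by (elim disjE; simp only:)+
  have "GE * E2.tp l k' = FE * E1.tp l k' + iso5 x (E1.tp l k') \<and> den5 x (E1.tp l k') \<noteq> 0"
  proof (cases "k' = 0")
    case True
    then have "E1.tp l k' = 0" "E2.tp l k' = 0" by (simp_all add: E1.tp_eq_0_iff E2.tp_eq_0_iff)
    then show ?thesis by (simp add: iso5_def den5_def)
  next
    case False
    then have b: "\<bar>E1.pm l k'\<bar> < 2 * E1.M" using k' by (intro E1.pm_bound) auto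
    note iso = level5_isogeny[OF w b E1.pc_nz[of l k'] five_torsion]
    show ?thesis using iso unfolding E1.tp_def E2.tp_def M2 pc2 pm2 by blast
  qed
  then show "GE * E2.tp l k = FE * E1.tp l k + iso5 x (E1.tp l k)" "den5 x (E1.tp l k) \<noteq> 0" unfolding e by auto
qed

text \<open>The dual isogeny keeps v and replaces q^5 by q. The v of a point on the second curve is
  already the fifth power of that on the first, whence the index 5k.\<close>

lemma dual_isogeny: "FE * E1.tp l (5 * k) = GE * E2.tp l k + iso5 (1 + x) (E2.tp l k)"
proof -
  have "tt (5 * E1.M) (1::'a) (4 * E1.M) * tt (5 * E1.M) 1 (8 * E1.M) = pi5 (1 + x)"
    "tt (5 * E1.M) (1::'a) (4 * E1.M) + tt (5 * E1.M) 1 (8 * E1.M) = sig5 (1 + x)"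
    using level5_cyclic[OF E1.M_pos x F G] by auto
  note d = level5_dual_isogeny[OF _ E1.p_pos(2,1) E2.pc_nz[of l k] E1.M_def _ this]
  have "\<exists>j. E2.pm l k = 4 * 1 * j" by (auto simp: E2.pm_def)
  then obtain j where "E2.pm l k = 4 * 1 * j" by blast
  from d(1)[OF _ this]
  have "FE * tt E1.M (E2.pc l k) (E2.pm l k) = GE * E2.tp l k + iso5 (1 + x) (E2.tp l k)"
    by (simp add: E2.tp_def M2)
  moreover have "tt E1.M (E2.pc l k) (E2.pm l k) = E1.tp l (5 * k)"
    using E1.pc_mult[of l 5 k] E1.pm_mult[of l 5 k] by (simp add: E1.tp_def pc2 pm2)
  ultimately show ?thesis by simp
qed

definition H0 :: "bit poly fract" where "H0 = fpoly [:0, 1:]"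
definition F0 :: "bit poly fract" where "F0 = H0 * (1 + H0)^5"
definition G0 :: "bit poly fract" where "G0 = H0^5 * (1 + H0)"

lemma \<phi>H0: "\<phi>1 H0 = x" "\<phi>2 H0 = 1 + x"
proof -
  have "pev bc y [:0, 1:] = y" for y :: "'a fls"
    by (simp add: pev_pCons is_hom_bc is_homD(1)[OF is_hom_pev[OF is_hom_bc]])
  then show "\<phi>1 H0 = x" "\<phi>2 H0 = 1 + x" by (simp_all only: H0_def \<phi>1 \<phi>2)
qed

lemma \<phi>FG: "\<phi>1 F0 = FE" "\<phi>2 F0 = GE" "\<phi>1 G0 = GE" "\<phi>2 G0 = FE"
  unfolding F0_def G0_def F GE
  by (simp_all only: is_homD[OF hom1] is_homD[OF hom2] is_hom_power[OF hom1] is_hom_power[OF hom2] \<phi>H0 add_self_left mult.commute)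

lemma FG0_range: "F0 \<in> range fpoly" "G0 \<in> range fpoly"
proof -
  note R = is_subring_range_fpoly[where 'a = bit]
  have H: "H0 \<in> range fpoly" by (simp add: H0_def)
  then have "1 + H0 \<in> range fpoly" by (intro is_subringD[OF R])
  then show "F0 \<in> range fpoly" "G0 \<in> range fpoly"
    unfolding F0_def G0_def using H is_subringD(4)[OF R] is_subring_power[OF R] by blast+
qed

definition I :: "(nat \<times> int) set" where "I = {..2 * h + 1} \<times> {1..int h}"
definition \<psi> :: "bit poly fract poly" where "\<psi> = dn (inverse F0) h"

lemma F0_nz: "F0 \<noteq> 0" using \<phi>FG(1) E1.FF_M_nz is_homD(1)[OF hom1] by auto
lemma \<phi>_inverse: "\<phi>1 (inverse F0) = 1 / FE" "\<phi>2 (inverse F0) = 1 / GE" "\<phi>1 (inverse G0) = 1 / GE"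
  by (simp_all add: is_hom_inverse[OF hom1] is_hom_inverse[OF hom2] \<phi>FG divide_inverse)

text \<open>The number of index pairs, (2h + 2) h, is exactly the degree of \<open>\<psi>\<close>;
  with injectivity of t on both curves it splits into distinct linear factors in either
  specialization.\<close>

sublocale two_fibres \<phi>1 \<phi>2 I "\<lambda>(l, k). E1.tp l k" "\<lambda>(l, k). E2.tp l k" \<psi>
proof
  have R: "is_subring (UNIV :: bit poly fract set)" by (simp add: is_subring_def)
  have rF: "inverse F0 * F0 = 1" using F0_nz by simp
  note dn = dn_monic[OF R UNIV_I rF E1.h]
  have card: "card I = 2 * h\<^sup>2 + 2 * h" by (simp add: I_def card_cartesian_product power2_eq_square algebra_simps)
  have "degree \<psi> \<le> 2 * h\<^sup>2 + 2 * h" unfolding \<psi>_def by (rule degree_le) (use dn(1) in \<open>auto simp: td_def\<close>)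
  moreover have "2 * h\<^sup>2 + 2 * h \<le> degree \<psi>" unfolding \<psi>_def by (rule le_degree) (simp add: dn(2))
  ultimately have d: "degree \<psi> = 2 * h\<^sup>2 + 2 * h" by simp
  then show "degree \<psi> = card I" using card by simp
  show "lead_coeff \<psi> = 1" unfolding d using dn(2) by (simp add: \<psi>_def)
  show "finite I" by (simp add: I_def)
  show "inj_on (\<lambda>(l, k). E1.tp l k) I"
  proof (rule inj_onI)
    fix a b assume "a \<in> I" "b \<in> I" "(case a of (l, k) \<Rightarrow> E1.tp l k) = (case b of (l, k) \<Rightarrow> E1.tp l k)"
    then show "a = b" using E1.tp_inj[of "snd a" "snd b" "fst a" "fst b"] by (auto simp: I_def prod_eq_iff split_def)
  qed
  show "inj_on (\<lambda>(l, k). E2.tp l k) I"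
  proof (rule inj_onI)
    fix a b assume "a \<in> I" "b \<in> I" "(case a of (l, k) \<Rightarrow> E2.tp l k) = (case b of (l, k) \<Rightarrow> E2.tp l k)"
    then show "a = b" using E2.tp_inj[of "snd a" "snd b" "fst a" "fst b"] by (auto simp: I_def prod_eq_iff split_def)
  qed
  fix a assume "a \<in> I"
  then obtain l k where a: "a = (l, k)" "1 \<le> k" "k \<le> int h" by (auto simp: I_def)
  show "pev \<phi>1 (case a of (l, k) \<Rightarrow> E1.tp l k) \<psi> = 0"
    unfolding a(1) split \<psi>_def by (rule E1.tp_root[OF hom1 \<phi>_inverse(1) E1.p_not_dvd[OF a(2,3)]])
  show "pev \<phi>2 (case a of (l, k) \<Rightarrow> E2.tp l k) \<psi> = 0"
    unfolding a(1) split \<psi>_def by (rule E2.tp_root[OF hom2 \<phi>_inverse(2) E2.p_not_dvd[OF a(2,3)]])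
qed (rule hom1 hom2)+

lemma IE: "a \<in> I \<Longrightarrow> 1 \<le> snd a \<and> snd a \<le> int h \<and> \<not> E1.p dvd snd a"
  using E1.p_not_dvd by (auto simp: I_def)

lemma rep_mult_point: "rep (\<lambda>a. E1.tp (fst a) (int n * snd a)) (\<lambda>a. E2.tp (fst a) (int n * snd a))"
proof -
  have r: "rep (\<lambda>a. E1.tp (fst a) (snd a)) (\<lambda>a. E2.tp (fst a) (snd a))"
    using rep_root by (simp add: split_def)
  have p: "rep (\<lambda>a. pev \<phi>1 (E1.tp (fst a) (snd a)) g) (\<lambda>a. pev \<phi>2 (E2.tp (fst a) (snd a)) g)" for g
    using rep_pev[of g] by (simp add: split_def)
  show ?thesis
    by (rule rep_cong[OF rep_divide[OF rep_mult[OF r p[of "da (inverse F0) n"]] p[of "db (inverse F0) n"]]])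
      (use IE E1.tp_mult[OF hom1 \<phi>_inverse(1)] E2.tp_mult[OF hom2 \<phi>_inverse(2)] in auto)
qed

lemma rep_const': "rep (\<lambda>_. x) (\<lambda>_. 1 + x)" "rep (\<lambda>_. FE) (\<lambda>_. GE)" "rep (\<lambda>_. GE) (\<lambda>_. FE)"
  using rep_const[of H0] rep_const[of F0] rep_const[of G0] unfolding \<phi>H0 \<phi>FG by auto

text \<open>The isogeny formula on the first fibre specializes to the dual one on the second. Their
  composite is multiplication by 5, so the partner of a point k of the second curve is the point 5k
  of the first.\<close>

lemma rep_isogeny: "rep (\<lambda>a. E2.tp (fst a) (int n * snd a)) (\<lambda>a. E1.tp (fst a) (5 * (int n * snd a)))"
proof -
  note t = rep_mult_point[of n]
  note x1 = rep_add[OF rep_one rep_const'(1)]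
  have sig: "rep (\<lambda>_. sig5 x) (\<lambda>_. sig5 (1 + x))"
    unfolding sig5_def by (intro rep_divide rep_power rep_const'(1) x1) (use x in simp)
  have pi: "rep (\<lambda>_. pi5 x) (\<lambda>_. pi5 (1 + x))"
    unfolding pi5_def by (intro rep_divide rep_power rep_const'(1) x1) (use x in simp)
  have den: "rep (\<lambda>a. den5 x (E1.tp (fst a) (int n * snd a))) (\<lambda>a. den5 (1 + x) (E2.tp (fst a) (int n * snd a)))"
    unfolding den5_def by (intro rep_add rep_mult rep_power rep_one sig pi t)
  have iso: "rep (\<lambda>a. iso5 x (E1.tp (fst a) (int n * snd a))) (\<lambda>a. iso5 (1 + x) (E2.tp (fst a) (int n * snd a)))"
    unfolding iso5_def by (intro rep_divide rep_add rep_mult rep_power rep_one sig pi t den) (simp add: den_nz)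
  have "rep (\<lambda>a. (FE * E1.tp (fst a) (int n * snd a) + iso5 x (E1.tp (fst a) (int n * snd a))) / GE)
     (\<lambda>a. (GE * E2.tp (fst a) (int n * snd a) + iso5 (1 + x) (E2.tp (fst a) (int n * snd a))) / FE)"
    by (intro rep_divide rep_add rep_mult rep_const' t iso) (rule E2.FF_M_nz)
  then show ?thesis
    by (rule rep_cong) (simp_all only: isogeny[symmetric] dual_isogeny[symmetric] nonzero_mult_div_cancel_left[OF E1.FF_M_nz]
        nonzero_mult_div_cancel_left[OF E2.FF_M_nz])
qed

lemma half_reindex: "(\<Sum>k=1..int h. g k) = (\<Sum>n=1..h. g (int n))"
  by (rule sum.reindex_cong[of int]) (auto simp: image_int_atLeastAtMost)

lemma rep_Fl1: "rep (\<lambda>a. E1.Fl (fst a)) (\<lambda>a. E2.Fl (fst a))"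
proof -
  have "rep (\<lambda>a. FE + (\<Sum>n=1..h. E1.tp (fst a) (int n * snd a) / (1 + E1.tp (fst a) (int n * snd a))\<^sup>2))
     (\<lambda>a. GE + (\<Sum>n=1..h. E2.tp (fst a) (int n * snd a) / (1 + E2.tp (fst a) (int n * snd a))\<^sup>2))"
    by (intro rep_add rep_sum rep_divide rep_power rep_one rep_const' rep_mult_point) (simp add: E1.tp_one_plus)
  then show ?thesis
  proof (rule rep_cong)
    fix a assume a: "a \<in> I"
    show "E1.Fl (fst a) = FE + (\<Sum>n=1..h. E1.tp (fst a) (int n * snd a) / (1 + E1.tp (fst a) (int n * snd a))\<^sup>2)"
      using E1.tp_half_sum[of "snd a" "\<lambda>t. t / (1 + t)\<^sup>2" "fst a"] IE[OF a]
      by (simp add: E1.Fl_eq half_reindex mult.commute)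
    show "E2.Fl (fst a) = GE + (\<Sum>n=1..h. E2.tp (fst a) (int n * snd a) / (1 + E2.tp (fst a) (int n * snd a))\<^sup>2)"
      using E2.tp_half_sum[of "snd a" "\<lambda>t. t / (1 + t)\<^sup>2" "fst a"] IE[OF a]
      by (simp add: E2.Fl_eq half_reindex mult.commute)
  qed
qed

text \<open>The factor 5 brought in by the dual isogeny only permutes each subgroup, because p does
  not divide 5, so the same series \<open>Fl\<close> results.\<close>

lemma rep_Fl2: "rep (\<lambda>a. E2.Fl (fst a)) (\<lambda>a. E1.Fl (fst a))"
proof -
  have "rep (\<lambda>a. GE + (\<Sum>n=1..h. E2.tp (fst a) (int n * snd a) / (1 + E2.tp (fst a) (int n * snd a))\<^sup>2))
     (\<lambda>a. FE + (\<Sum>n=1..h. E1.tp (fst a) (5 * (int n * snd a)) / (1 + E1.tp (fst a) (5 * (int n * snd a)))\<^sup>2))"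
    by (intro rep_add rep_sum rep_divide rep_power rep_one rep_const' rep_isogeny) (simp add: E2.tp_one_plus)
  then show ?thesis
  proof (rule rep_cong)
    fix a assume a: "a \<in> I"
    show "E2.Fl (fst a) = GE + (\<Sum>n=1..h. E2.tp (fst a) (int n * snd a) / (1 + E2.tp (fst a) (int n * snd a))\<^sup>2)"
      using E2.tp_half_sum[of "snd a" "\<lambda>t. t / (1 + t)\<^sup>2" "fst a"] IE[OF a]
      by (simp add: E2.Fl_eq half_reindex mult.commute)
    have "\<not> E1.p dvd 5 * snd a" using p5 IE[OF a] prime_dvd_mult_iff[OF E1.prime_int_p] by blast
    then show "E1.Fl (fst a) = FE + (\<Sum>n=1..h. E1.tp (fst a) (5 * (int n * snd a)) / (1 + E1.tp (fst a) (5 * (int n * snd a)))\<^sup>2)"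
      using E1.tp_half_sum[of "5 * snd a" "\<lambda>t. t / (1 + t)\<^sup>2" "fst a"]
      by (simp add: E1.Fl_eq half_reindex mult.commute mult.left_commute)
  qed
qed

text \<open>A trace over \<open>I\<close> would count each subgroup h times, and h may be 0 in the
  field. The weights t(P) divided by the sum of t over the subgroup of P are representable and add
  up to 1 on every subgroup, so the weighted trace counts each subgroup once.\<close>

lemma hecke_sum_fract:
  "\<exists>y. \<phi>1 y = (\<Sum>l\<le>2 * h + 1. E1.Fl l ^ i * E2.Fl l ^ j) \<and> \<phi>2 y = (\<Sum>l\<le>2 * h + 1. E2.Fl l ^ i * E1.Fl l ^ j)"
proof -
  define S1 where "S1 l = (\<Sum>k=1..int h. E1.tp l k)" for l
  define S2 where "S2 l = (\<Sum>k=1..int h. E2.tp l k)" for l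
  have S: "rep (\<lambda>a. S1 (fst a)) (\<lambda>a. S2 (fst a))"
  proof (rule rep_cong[OF rep_sum[of "{1..h}", OF rep_mult_point]])
    fix a assume a: "a \<in> I"
    show "S1 (fst a) = (\<Sum>n=1..h. E1.tp (fst a) (int n * snd a))"
      using E1.tp_half_sum[of "snd a" "\<lambda>t. t" "fst a"] IE[OF a] by (simp add: S1_def half_reindex mult.commute)
    show "S2 (fst a) = (\<Sum>n=1..h. E2.tp (fst a) (int n * snd a))"
      using E2.tp_half_sum[of "snd a" "\<lambda>t. t" "fst a"] IE[OF a] by (simp add: S2_def half_reindex mult.commute)
  qed
  have "rep (\<lambda>a. E1.tp (fst a) (snd a) * (E1.Fl (fst a) ^ i * E2.Fl (fst a) ^ j) / S1 (fst a))
     (\<lambda>a. E2.tp (fst a) (snd a) * (E2.Fl (fst a) ^ i * E1.Fl (fst a) ^ j) / S2 (fst a))"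
    using rep_mult_point[of 1]
    by (intro rep_divide rep_mult rep_power rep_Fl1 rep_Fl2 S) (auto simp: S1_def E1.line_sum_nz)
  then obtain y where y: "\<phi>1 y = (\<Sum>a\<in>I. E1.tp (fst a) (snd a) * (E1.Fl (fst a) ^ i * E2.Fl (fst a) ^ j) / S1 (fst a))"
    "\<phi>2 y = (\<Sum>a\<in>I. E2.tp (fst a) (snd a) * (E2.Fl (fst a) ^ i * E1.Fl (fst a) ^ j) / S2 (fst a))"
    by (rule rep_trace) (use E1.h in \<open>auto simp: I_def\<close>)
  have sum: "(\<Sum>a\<in>I. t (fst a) (snd a) * c (fst a) / s (fst a)) = (\<Sum>l\<le>2 * h + 1. c l)"
    if "\<And>l. s l = (\<Sum>k=1..int h. t l k)" "\<And>l. s l \<noteq> 0" for t :: "nat \<Rightarrow> int \<Rightarrow> 'a fls" and c s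
  proof -
    have "(\<Sum>a\<in>I. t (fst a) (snd a) * c (fst a) / s (fst a)) = (\<Sum>l\<le>2 * h + 1. \<Sum>k=1..int h. t l k * c l / s l)"
      unfolding I_def by (simp add: sum.cartesian_product split_def)
    also have "\<dots> = (\<Sum>l\<le>2 * h + 1. c l)"
    proof (rule sum.cong[OF refl])
      fix l
      have "(\<Sum>k=1..int h. t l k * c l / s l) = s l * (c l / s l)"
        by (simp add: that(1)[of l, symmetric] flip: sum_distrib_right sum_divide_distrib)
      then show "(\<Sum>k=1..int h. t l k * c l / s l) = c l" using that(2)[of l] by simp
    qed
    finally show ?thesis .
  qed
  show ?thesis
    by (intro exI[of _ y] conjI; unfold y; rule sum) (simp_all add: S1_def S2_def E1.line_sum_nz E2.line_sum_nz)
qed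

text \<open>By \<open>line_sum\<close> the squares of \<open>Fl\<close>, unlike \<open>Fl\<close>
  itself, are polynomials in the integral quantities F t and F. So the square of the weighted trace
  y is a polynomial in H; then y satisfies Y^2 = y^2, is itself integral, and is a polynomial as
  well.\<close>

theorem hecke_sum:
  "\<exists>P. pev bc x P = (\<Sum>l\<le>2 * h + 1. E1.Fl l ^ i * E2.Fl l ^ j) \<and>
    pev bc (1 + x) P = (\<Sum>l\<le>2 * h + 1. E2.Fl l ^ i * E1.Fl l ^ j)"
proof -
  obtain y where y: "\<phi>1 y = (\<Sum>l\<le>2 * h + 1. E1.Fl l ^ i * E2.Fl l ^ j)"
    "\<phi>2 y = (\<Sum>l\<le>2 * h + 1. E2.Fl l ^ i * E1.Fl l ^ j)" using hecke_sum_fract by blast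
  let ?R = "range (fpoly :: bit poly \<Rightarrow> _)"
  note R = is_subring_range_fpoly[where 'a = bit]
  define Z where "Z = (\<lambda>(l, k). FE * E1.tp l k) ` I \<union> (\<lambda>(l, k). GE * E2.tp l k) ` I"
  have Z1: "FE * E1.tp l k \<in> Z" "GE * E2.tp l k \<in> Z" if "l \<le> 2 * h + 1" "k \<in> {1..int h}" for l k
    unfolding Z_def I_def using that by (auto intro!: image_eqI[of _ _ "(l, k)"])
  have "finite Z" by (simp add: Z_def I_def)
  moreover have "integral_over \<phi>1 ?R u" if "u \<in> Z" for u
    using that E1.tp_integral[OF hom1 R FG0_range(1) \<phi>FG(1)] E2.tp_integral[OF hom1 R FG0_range(2) \<phi>FG(3)]
      E1.p_not_dvd by (auto simp: Z_def I_def)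
  ultimately obtain A B where A: "is_subring A" "\<phi>1 ` ?R \<subseteq> A" "Z \<subseteq> A" "finite B" "A \<subseteq> rspan \<phi>1 ?R B"
    using integral_ring_exists[OF hom1 R] by metis
  have FA: "FE \<in> A" "GE \<in> A" using A(2) FG0_range \<phi>FG by (metis image_subset_iff)+
  have Fl1: "(E1.Fl l)\<^sup>2 \<in> A" if "l \<le> 2 * h + 1" for l
  proof -
    have "FE\<^sup>2 + FE * (\<Sum>k=1..int h. E1.tp l k) = (E1.Fl l)\<^sup>2"
      by (simp only: E1.line_sum add_self_left)
    moreover have "FE * (\<Sum>k=1..int h. E1.tp l k) \<in> A"
      unfolding sum_distrib_left using Z1(1)[OF that] A(3) by (intro is_subring_sum[OF A(1)]) auto
    ultimately show ?thesis using is_subringD(3)[OF A(1) is_subring_power[OF A(1) FA(1)]] by metis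
  qed
  have Fl2: "(E2.Fl l)\<^sup>2 \<in> A" if "l \<le> 2 * h + 1" for l
  proof -
    have "GE\<^sup>2 + GE * (\<Sum>k=1..int h. E2.tp l k) = (E2.Fl l)\<^sup>2"
      by (simp only: E2.line_sum add_self_left)
    moreover have "GE * (\<Sum>k=1..int h. E2.tp l k) \<in> A"
      unfolding sum_distrib_left using Z1(2)[OF that] A(3) by (intro is_subring_sum[OF A(1)]) auto
    ultimately show ?thesis using is_subringD(3)[OF A(1) is_subring_power[OF A(1) FA(2)]] by metis
  qed
  have "\<phi>1 (y\<^sup>2) = (\<Sum>l\<le>2 * h + 1. ((E1.Fl l)\<^sup>2) ^ i * ((E2.Fl l)\<^sup>2) ^ j)"
    unfolding is_hom_power[OF hom1] y(1) square_sum
    by (simp add: power_mult_distrib mult.commute flip: power_mult)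
  also have "\<dots> \<in> A"
    by (intro is_subring_sum[OF A(1)] is_subringD(4)[OF A(1)] is_subring_power[OF A(1)] Fl1 Fl2) auto
  finally have "y\<^sup>2 \<in> ?R" by (rule integral_fract_is_poly[OF hom1 A(1,2,4,5)])
  then have "integral_over \<phi>1 ?R (\<phi>1 y)"
    unfolding integral_over_def
    by (intro exI[of _ 2] exI[of _ "\<lambda>k. if k = 0 then y\<^sup>2 else 0"])
      (simp add: is_subringD(1)[OF R] is_homD[OF hom1] lessThan_nat_numeral is_hom_power[OF hom1])
  then obtain A B where "is_subring A" "\<phi>1 ` ?R \<subseteq> A" "{\<phi>1 y} \<subseteq> A" "finite B" "A \<subseteq> rspan \<phi>1 ?R B"
    using integral_ring_exists[OF hom1 R, of "{\<phi>1 y}"] by auto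
  then have "y \<in> ?R" using integral_fract_is_poly[OF hom1, of A B y] by simp
  then obtain P where "y = fpoly P" by blast
  then show ?thesis using y \<phi>1 \<phi>2 by metis
qed

end

section \<open>Hecke operators and the Hauptmodul\<close>

text \<open>\<open>emb M c f\<close> is the series \<open>f(c x\<^sup>M)\<close> over the larger field.\<close>
definition emb :: "nat \<Rightarrow> 'a::{field,char2} \<Rightarrow> bit fps \<Rightarrow> 'a fls" where
  "emb M c f = fps_to_fls (Abs_fps (\<lambda>n. bc (f $ n) * c ^ n) oo fps_X ^ M)"

lemma emb_nth:
  assumes "0 < M"
  shows "emb M c f $$ n = (if 0 \<le> n \<and> int M dvd n then bc (f $ (nat n div M)) * c ^ (nat n div M) else 0)"
proof (cases "0 \<le> n")
  case True
  then obtain m where n: "n = int m" by (metis nonneg_int_cases)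
  show ?thesis using assms by (simp add: emb_def n fps_nth_compose_X_power)
qed (simp add: emb_def)

lemma is_hom_emb:
  assumes M: "0 < M"
  shows "is_hom (emb M c)"
proof -
  let ?g = "\<lambda>f. Abs_fps (\<lambda>n. bc (f $ n) * c ^ n)"
  note b = is_homD[OF is_hom_bc[where 'a = 'a]]
  have add: "?g (f + f') = ?g f + ?g f'" for f f' by (rule fps_ext) (simp only: fps_nth_Abs_fps fps_add_nth b distrib_right)
  have mult: "?g (f * f') = ?g f * ?g f'" for f f'
  proof (rule fps_ext)
    fix n
    have "c ^ n = c ^ i * c ^ (n - i)" if "i \<in> {0..n}" for i using that by (simp flip: power_add)
    then have "(\<Sum>i=0..n. bc (f $ i) * bc (f' $ (n - i)) * c ^ n) = (\<Sum>i=0..n. bc (f $ i) * c ^ i * (bc (f' $ (n - i)) * c ^ (n - i)))"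
      by (intro sum.cong refl) (simp add: mult_ac)
    then show "?g (f * f') $ n = (?g f * ?g f') $ n"
      by (simp only: fps_nth_Abs_fps fps_mult_nth is_hom_sum[OF is_hom_bc] b sum_distrib_right)
  qed
  have z: "?g 0 = 0" and o: "?g 1 = 1" by (rule fps_ext, simp)+
  have X: "(fps_X ^ M :: 'a fps) $ 0 = 0" using M by simp
  show ?thesis
    unfolding is_hom_def emb_def
    by (simp only: z o add mult fps_compose_add_distrib fps_compose_mult_distrib[OF X] fps_compose_0 fps_compose_1
        fps_zero_to_fls fps_one_to_fls fps_to_fls_plus fls_times_fps_to_fls simp_thms all_simps)
qed

lemma emb_inject:
  assumes M: "0 < M" and c: "c \<noteq> (0 :: 'a::{field,char2})" and e: "emb M c f = emb M c g"
  shows "f = g"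
proof (rule fps_ext)
  fix n
  have "emb M c f $$ (int M * int n) = emb M c g $$ (int M * int n)" using e by simp
  moreover have "nat (int M * int n) div M = n" using M by (simp flip: of_nat_mult)
  ultimately have "(bc (f $ n) :: 'a) = bc (g $ n)" using c by (simp add: emb_nth[OF M])
  then show "f $ n = g $ n" by (simp add: bc_def split: if_splits)
qed

lemma F_nth: "F $ m = (if \<exists>n::nat. odd n \<and> m = n\<^sup>2 then 1 else 0)"
proof -
  have "(\<exists>n::nat. odd n \<and> n > 0 \<and> m = n\<^sup>2) \<longleftrightarrow> (\<exists>n::nat. odd n \<and> m = n\<^sup>2)"
    by (metis gr0I even_zero)
  then show ?thesis by (simp add: F_def)
qed

lemma emb_F:
  assumes M: "0 < M"
  shows "emb M c F = FF (int M) c"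
proof (rule fls_eqI)
  fix N :: int
  have l: "locfin posodd (\<lambda>n. int M * n\<^sup>2)" using M by (intro locfin_square) simp
  have "emb M c F $$ N = (\<Sum>n | n \<in> posodd \<and> int M * n\<^sup>2 = N. c powi (n\<^sup>2))"
  proof (cases "\<exists>m::nat. odd m \<and> N = int M * (int m)\<^sup>2")
    case True
    then obtain m :: nat where m: "odd m" "N = int M * (int m)\<^sup>2" by blast
    have "0 < m" using m by (cases m) auto
    then have "{n. n \<in> posodd \<and> int M * n\<^sup>2 = N} = {int m}" using m M by (auto simp: power2_eq_iff_nonneg)
    moreover have "nat N div M = m\<^sup>2" using m M by (simp add: nat_mult_distrib nat_power_eq)
    moreover have "F $ (m\<^sup>2) = 1" using m by (auto simp: F_nth)
    moreover have "c powi ((int m)\<^sup>2) = c ^ (m\<^sup>2)" by (metis of_nat_power power_int_of_nat)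
    ultimately show ?thesis using m by (simp add: emb_nth[OF M])
  next
    case False
    have "{n. n \<in> posodd \<and> int M * n\<^sup>2 = N} = {}"
    proof -
      have "n \<notin> posodd" if "int M * n\<^sup>2 = N" for n
        using False[simplified, rule_format, of "nat n"] that by (auto simp: even_nat_iff)
      then show ?thesis by blast
    qed
    moreover have "F $ (nat N div M) = 0" if "0 \<le> N" "int M dvd N"
    proof -
      have "nat N div M \<noteq> m\<^sup>2" if "odd m" for m :: nat
      proof
        assume "nat N div M = m\<^sup>2"
        moreover have "N = int M * int (nat N div M)"
          using \<open>0 \<le> N\<close> \<open>int M dvd N\<close> by (metis dvd_mult_div_cancel int_nat_eq of_nat_mult nat_int of_nat_dvd_iff)
        ultimately show False using False that by auto
      qed
      then show ?thesis by (auto simp: F_nth)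
    qed
    ultimately show ?thesis by (simp only: emb_nth[OF M] sum.empty) simp
  qed
  then show "emb M c F $$ N = FF (int M) c $$ N" unfolding FF_def by (simp only: lsum_nth[OF l])
qed

lemma emb_compose:
  assumes "0 < M" "0 < d"
  shows "emb M c (f oo fps_X ^ d) = emb (M * d) (c ^ d) f"
proof (rule fls_eqI)
  fix n :: int
  have Md: "0 < M * d" using assms by simp
  show "emb M c (f oo fps_X ^ d) $$ n = emb (M * d) (c ^ d) f $$ n"
  proof (cases "0 \<le> n \<and> int M dvd n")
    case True
    then obtain m where n: "n = int M * int m" by (metis dvdE nonneg_int_cases of_nat_0_less_iff assms(1) zero_le_mult_iff not_less order.asym)
    have e: "nat n div M = m" "nat n div (M * d) = m div d"
      using assms by (simp_all add: n nat_mult_distrib div_mult2_eq)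
    have "int (M * d) dvd n \<longleftrightarrow> d dvd m" using assms by (simp add: n)
    then show ?thesis
      using True assms by (auto simp: emb_nth[OF assms(1)] emb_nth[OF Md] e fps_nth_compose_X_power simp flip: power_mult)
  next
    case False
    moreover have "int (M * d) dvd n \<Longrightarrow> int M dvd n" by (metis dvd_mult_left of_nat_mult)
    ultimately show ?thesis unfolding emb_nth[OF assms(1)] emb_nth[OF Md] by auto
  qed
qed

lemma emb_G: "0 < M \<Longrightarrow> emb M c G = FF (5 * int M) (c ^ 5)"
  unfolding G_def by (subst emb_compose) (simp_all add: emb_F mult.commute)

lemma fps_square_nth_char2:
  fixes f :: "'a::{comm_ring_1,char2} fps"
  shows "(f\<^sup>2) $ n = (if even n then (f $ (n div 2))\<^sup>2 else 0)"
proof -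
  let ?S = "{i \<in> {0..n}. 2 * i \<noteq> n}"
  have "(\<Sum>i\<in>?S. f $ i * f $ (n - i)) = 0"
    by (rule sum_involution_char2[where g = "\<lambda>i. n - i"]) (auto simp: mult.commute)
  moreover have "(\<Sum>i\<in>{0..n}. f $ i * f $ (n - i)) = (\<Sum>i\<in>?S. f $ i * f $ (n - i)) + (\<Sum>i\<in>{i \<in> {0..n}. 2 * i = n}. f $ i * f $ (n - i))"
    by (subst sum.union_disjoint[symmetric]) (auto intro!: sum.cong)
  ultimately have e: "(f\<^sup>2) $ n = (\<Sum>i\<in>{i \<in> {0..n}. 2 * i = n}. f $ i * f $ (n - i))"
    by (simp add: power2_eq_square fps_mult_nth)
  show ?thesis
  proof (cases "even n")
    case True
    then have "{i \<in> {0..n}. 2 * i = n} = {n div 2}" "n - n div 2 = n div 2" by auto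
    then show ?thesis unfolding e using True by (simp add: power2_eq_square)
  next
    case False
    then have "{i \<in> {0..n}. 2 * i = n} = {}" by auto
    then show ?thesis unfolding e using False by (simp only: sum.empty if_False)
  qed
qed

text \<open>Squaring a series over \<open>Z/2\<close> moves the coefficient at n to 2n, so h + h^2 =
  F + G is a recursion from n to n/2.\<close>

fun hcoeff :: "nat \<Rightarrow> bit" where
  "hcoeff n = (if n = 0 then 0 else (F + G) $ n + (if even n then hcoeff (n div 2) else 0))"

declare hcoeff.simps [simp del]

text \<open>The Hauptmodul modulo 2, as the solution without constant term of \<open>h + h\<^sup>2 = F + G\<close>.\<close>
definition hb :: "bit fps" where "hb = Abs_fps hcoeff"

lemma G_nth: "G $ n = (if 5 dvd n then F $ (n div 5) else 0)"
  by (simp add: G_def fps_nth_compose_X_power)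

lemma F_nth_0: "F $ 0 = 0" by (auto simp: F_nth intro: gr0I)

lemma F_nth_1: "F $ 1 = 1"
  unfolding F_nth by (auto intro: exI[of _ 1])

lemma hb_0: "hb $ 0 = 0" by (simp add: hb_def hcoeff.simps)

lemma hb_eq: "hb + hb\<^sup>2 = F + G"
proof (rule fps_ext)
  fix n
  have sq: "(y::bit)\<^sup>2 = y" for y by (cases y) simp_all
  show "(hb + hb\<^sup>2) $ n = (F + G) $ n"
  proof (cases "n = 0")
    case True
    then show ?thesis by (simp add: hb_0 F_nth_0 G_nth fps_square_nth_char2)
  next
    case False
    then have "hb $ n = (F + G) $ n + (if even n then hb $ (n div 2) else 0)"
      using hcoeff.simps[of n] by (simp add: hb_def)
    moreover have "(hb\<^sup>2) $ n = (if even n then hb $ (n div 2) else 0)" by (simp add: fps_square_nth_char2 sq)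
    ultimately show ?thesis by (simp only: fps_add_nth[of hb] add.assoc add_self add_0_right)
  qed
qed

text \<open>A root of 1 + X + ... + X^(n-1) in the algebraic closure; it differs from 1 because n is
  odd, and its order is n because n is prime.\<close>

lemma prim_root_exists:
  assumes n: "prime n" "odd n"
  shows "\<exists>z :: bit alg_closure. prim_root z n"
proof -
  have n1: "1 < n" by (rule prime_gt_1_nat[OF n(1)])
  let ?p = "\<Sum>i<n. monom (1 :: bit alg_closure) i"
  have co: "coeff ?p i = (if i < n then 1 else 0)" for i
    by (simp add: coeff_sum)
  have "n - 1 \<le> degree ?p" by (rule le_degree) (use n1 co in simp)
  then have "0 < degree ?p" using n1 by simp
  then obtain z where "poly ?p z = 0" using alg_closed_imp_poly_has_root by blast
  then have z: "(\<Sum>i<n. z ^ i) = 0" by (simp add: poly_sum poly_monom)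
  obtain j where j: "n = 2 * j + 1" using n(2) by (rule oddE)
  have z1: "z \<noteq> 1"
  proof
    assume "z = 1"
    then have "of_nat n = (0 :: bit alg_closure)" using z by simp
    then show False by (simp add: j two_eq_0)
  qed
  have zn: "z ^ n = 1" using geometric_sum[OF z1, of n] z z1 by simp
  have z0: "z \<noteq> 0" using zn n1 by (auto simp: power_0_left)
  have znb: "z powi (int n * b) = 1" for b using zn by (simp add: power_int_mult)
  have "int n dvd b" if b: "z powi b = 1" for b
  proof (rule ccontr)
    assume "\<not> int n dvd b"
    then have "coprime (int n) b" using n(1) by (intro prime_imp_coprime) simp_all
    then obtain u v where "u * int n + v * b = 1" by (metis bezout_int coprime_imp_gcd_eq_1)
    then have "z powi 1 = z powi (int n * u) * (z powi b) powi v"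
      using z0 by (metis mult.commute power_int_add power_int_mult)
    then show False using z1 znb b by simp
  qed
  moreover have "z powi b = 1" if "int n dvd b" for b using that znb by (auto simp: dvd_def)
  ultimately show ?thesis unfolding prim_root_def by blast
qed

section \<open>Polynomials in the Hauptmodul\<close>

definition pv :: "bit fps \<Rightarrow> bit poly \<Rightarrow> bit fps" where "pv t P = pev fps_const t P"

lemma is_hom_fps_const: "is_hom (fps_const :: bit \<Rightarrow> bit fps)"
  by (simp add: is_hom_def)

lemma is_hom_pv: "is_hom (pv t)"
  unfolding pv_def by (rule is_hom_pev[OF is_hom_fps_const])

lemma pv_pCons: "pv t (pCons a P) = fps_const a + t * pv t P"
  unfolding pv_def by (rule pev_pCons[OF is_hom_fps_const])

text \<open>A nonzero series without constant term is transcendental: split off powers of t until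
  the constant coefficient of P is nonzero.\<close>

lemma pv_nonzero: "t $ 0 = 0 \<Longrightarrow> t \<noteq> 0 \<Longrightarrow> P \<noteq> 0 \<Longrightarrow> pv t P \<noteq> 0"
proof (induct P)
  case (pCons a P)
  show ?case
  proof (cases "a = 0")
    case True
    then show ?thesis using pCons by (simp add: pv_pCons)
  next
    case False
    have "pv t (pCons a P) $ 0 = a" using pCons(3) by (simp add: pv_pCons)
    then show ?thesis using False by auto
  qed
qed simp

lemma pv_pcompose: "pv t (pcompose P Q) = pv (pv t Q) P"
  by (induct P) (simp_all add: pcompose_pCons is_homD[OF is_hom_pv] pv_pCons is_homD(1)[OF is_hom_pv])

lemma pv_X: "pv t [:a, 1:] = fps_const a + t"
  by (simp add: pv_pCons is_homD(1)[OF is_hom_pv])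

lemma pv_nonzero_shift:
  assumes "t $ 0 = 0" "t \<noteq> 0" "P \<noteq> 0"
  shows "pv (1 + t) P \<noteq> 0"
proof -
  have "pcompose P [:1, 1:] \<noteq> 0" using assms(3) by (auto dest!: pcompose_eq_0)
  from pv_nonzero[OF assms(1,2) this] show ?thesis by (simp add: pv_pcompose pv_X)
qed

lemma hb_nonzero: "hb \<noteq> 0" "1 + hb \<noteq> 0"
proof -
  show "hb \<noteq> 0"
  proof
    assume "hb = 0"
    then have "F $ 1 + G $ 1 = 0" using hb_eq by (metis fps_add_nth fps_zero_nth power_zero_numeral add_0)
    then show False using F_nth_1 by (simp add: G_nth)
  qed
  have "(1 + hb) $ 0 = 1" by (simp add: hb_0)
  then show "1 + hb \<noteq> 0" by (metis fps_zero_nth zero_neq_one)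
qed

lemma pev_emb:
  assumes "0 < M"
  shows "pev bc (emb M c t) P = emb M c (pv t P)"
proof -
  note h = is_homD[OF is_hom_emb[OF assms, of c]]
  have c: "emb M c (fps_const a) = bc a" for a by (cases a) (simp_all add: h)
  show ?thesis
  proof (induct P)
    case 0
    then show ?case by (simp add: h is_homD(1)[OF is_hom_pev[OF is_hom_bc]] is_homD(1)[OF is_hom_pv])
  next
    case (pCons a P)
    then show ?case by (simp add: pev_pCons[OF is_hom_bc] pv_pCons h c)
  qed
qed

text \<open>The parametrization over the algebraic closure gives some y with y + y^2 = F + G, hence
  y is \<open>hb\<close> or \<open>1 + hb\<close>. The second would give F = \<open>hb\<close>^5 (1
  + \<open>hb\<close>), which has no term in x.\<close>

lemma FG_hb: "F = hb * (1 + hb)^5" "G = hb^5 * (1 + hb)"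
proof -
  obtain w :: "bit alg_closure" where w: "prim_root w 5" using prim_root_exists[of 5] by auto
  obtain y :: "bit alg_closure fls" where y: "y \<noteq> 0" "1 + y \<noteq> 0" "FF 1 1 = y * (1 + y)^5" "FF (5 * 1) 1 = y^5 * (1 + y)"
    using level5_mu[OF zero_less_one w] by metis
  let ?e = "emb 1 (1 :: bit alg_closure)"
  have M: "0 < (1::nat)" by simp
  note h = is_homD[OF is_hom_emb[OF M]] is_hom_power[OF is_hom_emb[OF M]]
  have FG: "?e F = FF 1 1" "?e G = FF (5 * 1) 1" using emb_F[OF M, of 1] emb_G[OF M, of 1] by simp_all
  have "y * (1 + y)^5 + y^5 * (1 + y) = y + y\<^sup>2"
  proof -
    have "y * (1 + y)^5 + y^5 * (1 + y) = y * (1 + y) * ((1 + y)^4 + y^4)"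
      by (simp add: algebra_simps eval_nat_numeral)
    then show ?thesis by (simp add: power4_add add.assoc add_self distrib_left power2_eq_square)
  qed
  then have "y + y\<^sup>2 = ?e (F + G)" using y FG by (simp only: h)
  then have "y + y\<^sup>2 = ?e hb + (?e hb)\<^sup>2" by (simp only: hb_eq[symmetric] h)
  moreover have "(y + ?e hb) * (1 + (y + ?e hb)) = (y + y\<^sup>2) + (?e hb + (?e hb)\<^sup>2)"
    by (simp only: distrib_left mult_1_right power2_eq_square[symmetric] square_add add_ac)
  ultimately have "(y + ?e hb) * (1 + (y + ?e hb)) = 0" by (simp only: add_self)
  then have "y + ?e hb = 0 \<or> y + (1 + ?e hb) = 0" unfolding mult_eq_0_iff by (simp only: add_ac)
  then have "y = ?e hb \<or> y = 1 + ?e hb" by (simp only: add_eq_0_iff_eq)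
  moreover have "y \<noteq> 1 + ?e hb"
  proof
    assume e: "y = 1 + ?e hb"
    have "?e F = ?e (hb^5 * (1 + hb))"
      unfolding FG y(3) e by (simp only: h add_self_left mult.commute)
    then have "F = hb^5 * (1 + hb)" by (rule emb_inject[OF M, rotated]) simp
    also have "\<dots> = hb * (hb^4 * (1 + hb))" by (simp add: eval_nat_numeral mult_ac)
    finally have "F $ 1 = (hb * (hb^4 * (1 + hb))) $ 1" by (rule arg_cong)
    moreover have "(hb * f) $ 1 = hb $ 1 * f $ 0" for f by (simp add: fps_mult_nth hb_0)
    moreover have "(hb^4 * (1 + hb)) $ 0 = 0" by (simp add: hb_0)
    ultimately show False using F_nth_1 by (metis mult_zero_right zero_neq_one)
  qed
  ultimately have e: "y = ?e hb" by blast
  have "?e F = ?e (hb * (1 + hb)^5)" unfolding FG y(3) e by (simp only: h)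
  then show "F = hb * (1 + hb)^5" by (rule emb_inject[OF M, rotated]) simp
  have "?e G = ?e (hb^5 * (1 + hb))" unfolding FG y(4) e by (simp only: h)
  then show "G = hb^5 * (1 + hb)" by (rule emb_inject[OF M, rotated]) simp
qed

text \<open>After the substitution of x^p the Hecke operator is a sum over p + 1 substitutions.
  Summing f(z^l x) over l selects the exponents divisible by p with multiplicity p, and p is 1 in
  characteristic 2.\<close>

lemma emb_T:
  fixes z :: "'a::{field,char2}"
  assumes p: "0 < p" and z: "prim_root z p" and odd: "odd p"
  shows "emb p 1 (T p f) = emb (p * p) 1 f + (\<Sum>l<p. emb 1 (z ^ l) f)"
proof (rule fls_eqI)
  fix n :: int
  have pp: "0 < p * p" using p by simp
  have s: "(\<Sum>l<p. (z ^ l) ^ m) = (if p dvd m then 1 else 0)" for m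
  proof -
    have e: "(z ^ l) ^ m = (z ^ m) ^ l" for l by (metis mult.commute power_mult)
    have r: "z ^ m = 1 \<longleftrightarrow> p dvd m"
      using z unfolding prim_root_def by (metis int_dvd_int_iff power_int_of_nat)
    show ?thesis
    proof (cases "p dvd m")
      case True
      obtain j where "p = 2 * j + 1" using odd by (rule oddE)
      then show ?thesis using True r by (simp add: e two_eq_0)
    next
      case False
      have "(z ^ m) ^ p = (z ^ p) ^ m" by (metis mult.commute power_mult)
      also have "z ^ p = 1" using z unfolding prim_root_def by (metis dvd_refl power_int_of_nat)
      finally show ?thesis using False r by (simp add: e root_sum)
    qed
  qed
  show "emb p 1 (T p f) $$ n = (emb (p * p) 1 f + (\<Sum>l<p. emb 1 (z ^ l) f)) $$ n"
  proof (cases "0 \<le> n")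
    case True
    then obtain m where n: "n = int m" by (metis nonneg_int_cases)
    have e2: "emb (p * p) (1::'a) f $$ n = (if p * p dvd m then bc (f $ (m div (p * p))) else 0)"
      by (subst emb_nth[OF pp]) (simp only: n int_dvd_int_iff of_nat_0_le_iff simp_thms nat_int power_one mult_1_right)
    have "(emb (p * p) (1::'a) f + (\<Sum>l<p. emb 1 (z ^ l) f)) $$ n =
        (if p * p dvd m then bc (f $ (m div (p * p))) else 0) + (if p dvd m then bc (f $ m) else 0)"
      unfolding fls_plus_nth e2 by (simp add: n fls_nth_sum emb_nth s flip: sum_distrib_left)
    also have "\<dots> = emb p 1 (T p f) $$ n"
    proof (cases "p dvd m")
      case True
      then obtain k where k: "m = p * k" by (auto simp: dvd_def)
      have q: "nat n div p = k" "int p dvd n" "0 \<le> n" using p by (simp_all add: n k nat_mult_distrib)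
      have T: "T p f $ k = f $ (p * k) + (if p dvd k then f $ (k div p) else 0)"
        by (simp only: T_def fps_nth_Abs_fps)
      have "emb p (1::'a) (T p f) $$ n = bc (T p f $ k)"
        by (simp only: emb_nth[OF p] q simp_thms if_True power_one mult_1_right)
      also have "\<dots> = bc (f $ (p * k)) + (if p dvd k then bc (f $ (k div p)) else 0)"
        by (simp only: T is_homD[OF is_hom_bc] if_distrib[of bc] bc_simps)
      also have "\<dots> = (if p * p dvd m then bc (f $ (m div (p * p))) else 0) + (if p dvd m then bc (f $ m) else 0)"
        using p by (simp add: k div_mult2_eq add.commute)
      finally show ?thesis by simp
    next
      case False
      then have "\<not> p * p dvd m" by (auto dest: dvd_mult_left)
      then show ?thesis using False by (simp add: n emb_nth[OF p])
    qed
    finally show ?thesis by simp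
  qed (simp add: fls_nth_sum emb_nth p pp del: of_nat_mult)
qed

text \<open>Everything is read after x -> x^p, so that q = x^p has the p-th roots z^l x and s = 1.
  The terms of \<open>emb_T\<close> are then the values of \<open>Fl\<close>, with f(x^(p^2))
  belonging to the roots of unity, and injectivity of \<open>emb\<close> returns to series over
  \<open>Z/2\<close>.\<close>

theorem hecke_modular:
  assumes "prime p" "p \<noteq> 2" "p \<noteq> 5"
  shows "\<exists>P. T p (F ^ i * G ^ j) = pv hb P \<and> T p (F ^ j * G ^ i) = pv (1 + hb) P"
proof -
  have p2: "2 < p" using assms prime_ge_2_nat[of p] by linarith
  have odd: "odd p" using assms p2 by (metis prime_odd_nat)
  then obtain h where h: "p = 2 * h + 1" by (rule oddE)
  have h0: "0 < h" using p2 h by simp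
  obtain z :: "bit alg_closure" where z: "prim_root z p" using prim_root_exists assms odd by blast
  obtain w :: "bit alg_closure" where w: "prim_root w 5" using prim_root_exists[of 5] by auto
  have np5: "\<not> p dvd 5" using assms(1,3) primes_dvd_imp_eq[of p 5] by auto
  have z5: "prim_root (z ^ 5) p"
  proof -
    have "(z ^ 5) powi b = z powi (5 * b)" for b by (metis of_nat_numeral power_int_mult power_int_of_nat)
    moreover have "int p dvd 5 * b \<longleftrightarrow> int p dvd b" for b
    proof -
      have "coprime (int p) 5" using np5 assms(1) by (metis int_dvd_int_iff of_nat_numeral prime_imp_coprime prime_nat_int_transfer)
      then show ?thesis by (rule coprime_dvd_mult_right_iff)
    qed
    ultimately show ?thesis using z unfolding prim_root_def by simp
  qed
  have pp: "0 < p" using p2 by simp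
  let ?e = "emb p (1 :: bit alg_closure)"
  define x where "x = ?e hb"
  note e = is_homD[OF is_hom_emb[OF pp]] is_hom_power[OF is_hom_emb[OF pp]]
  have e0: "?e f = 0 \<longleftrightarrow> f = 0" for f using emb_inject[OF pp, of "1 :: bit alg_closure" f 0] e(1) by auto
  have px: "pev bc x P = ?e (pv hb P)" "pev bc (1 + x) P = ?e (pv (1 + hb) P)" for P
    using pev_emb[OF pp, of 1 hb P] pev_emb[OF pp, of 1 "1 + hb" P] by (simp_all add: x_def e)
  obtain \<phi>1 :: "bit poly fract \<Rightarrow> bit alg_closure fls" where f1: "is_hom \<phi>1" "\<And>P. \<phi>1 (fpoly P) = pev bc x P"
    by (rule fract_hom_exists[OF is_hom_pev[OF is_hom_bc], of x])
      (auto simp: px e0 pv_nonzero[OF hb_0 hb_nonzero(1)])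
  obtain \<phi>2 :: "bit poly fract \<Rightarrow> bit alg_closure fls" where f2: "is_hom \<phi>2" "\<And>P. \<phi>2 (fpoly P) = pev bc (1 + x) P"
    by (rule fract_hom_exists[OF is_hom_pev[OF is_hom_bc], of "1 + x"])
      (auto simp: px e0 pv_nonzero_shift[OF hb_0 hb_nonzero(1)])
  interpret E1: torsion z h 1
    by unfold_locales (use h0 z assms(1) h in simp_all)
  interpret E2: torsion "z ^ 5" h 5
    by unfold_locales (use h0 z5 assms(1) h in simp_all)
  have M1: "E1.M = int p" and M2: "E2.M = 5 * int p" and P: "E1.p = int p" "E2.p = int p"
    using h by (simp_all add: E1.M_def E2.M_def E1.p_def E2.p_def)
  interpret hecke z h w \<phi>1 \<phi>2 x
  proof unfold_locales
    show "\<not> E1.p dvd 5" using np5 unfolding P by (metis int_dvd_int_iff of_nat_numeral)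
    show "x \<noteq> 0" using hb_nonzero e0 by (simp add: x_def)
    have "1 + x = ?e (1 + hb)" by (simp add: x_def e)
    then show "1 + x \<noteq> 0" using hb_nonzero e0 by simp
    have "?e F = x * (1 + x)^5" by (subst FG_hb(1)) (simp add: x_def e)
    then show "FF E1.M 1 = x * (1 + x)^5" using emb_F[OF pp, of "1 :: bit alg_closure"] by (simp add: M1)
    have "?e G = x^5 * (1 + x)" by (subst FG_hb(2)) (simp add: x_def e)
    then show "FF (5 * E1.M) 1 = x^5 * (1 + x)" using emb_G[OF pp, of "1 :: bit alg_closure"] by (simp add: M1)
  qed (rule w f1 f2)+
  have one: "0 < (1::nat)" and p2': "0 < p * p" using pp by auto
  have Fl1: "E1.Fl l = (if l < p then emb 1 (z ^ l) F else emb (p * p) 1 F)" for l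
    unfolding E1.Fl_def h[symmetric] M1 P
    using emb_F[OF one, of "z ^ l"] emb_F[OF p2', of "1 :: bit alg_closure"] by (simp del: One_nat_def)
  \<comment> \<open>The parameters z^5 and 5 of the second curve turn its series for l < p into
    F(z^(5l) x^5), which is G(z^l x).\<close>
  have Fl2: "E2.Fl l = (if l < p then emb 1 (z ^ l) G else emb (p * p) 1 G)" for l
    unfolding E2.Fl_def h[symmetric] M2 M1 P
    using emb_G[OF one, of "z ^ l"] emb_G[OF p2', of "1 :: bit alg_closure"]
    by (simp add: mult.commute mult.left_commute del: One_nat_def flip: power_mult)
  have sum: "(\<Sum>l\<le>2 * h + 1. E1.Fl l ^ a * E2.Fl l ^ b) = ?e (T p (F ^ a * G ^ b))" for a b
  proof -
    have "{..2 * h + 1} = insert p {..<p}" using h by auto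
    then have "(\<Sum>l\<le>2 * h + 1. E1.Fl l ^ a * E2.Fl l ^ b) = emb (p * p) 1 (F ^ a * G ^ b) + (\<Sum>l<p. emb 1 (z ^ l) (F ^ a * G ^ b))"
      by (simp add: Fl1 Fl2 is_homD[OF is_hom_emb[OF one]] is_hom_power[OF is_hom_emb[OF one]]
          is_homD[OF is_hom_emb[OF p2']] is_hom_power[OF is_hom_emb[OF p2']] del: One_nat_def)
    then show ?thesis by (simp only: emb_T[OF pp z odd])
  qed
  obtain P where P: "pev bc x P = (\<Sum>l\<le>2 * h + 1. E1.Fl l ^ i * E2.Fl l ^ j)"
    "pev bc (1 + x) P = (\<Sum>l\<le>2 * h + 1. E2.Fl l ^ i * E1.Fl l ^ j)" using hecke_sum by blast
  have "?e (pv hb P) = ?e (T p (F ^ i * G ^ j))" using P(1) unfolding px sum .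
  then have 1: "pv hb P = T p (F ^ i * G ^ j)" by (rule emb_inject[OF pp, rotated]) simp
  have "?e (pv (1 + hb) P) = ?e (T p (F ^ j * G ^ i))"
    using P(2) unfolding px by (simp only: mult.commute[of "E2.Fl _ ^ i"] sum)
  then have 2: "pv (1 + hb) P = T p (F ^ j * G ^ i)" by (rule emb_inject[OF pp, rotated]) simp
  show ?thesis using 1 2 by metis
qed

section \<open>The modules N2 and W\<close>

lemma FG_sum: "F + G = hb * (1 + hb)"
  using hb_eq by (simp add: distrib_left power2_eq_square)

lemma level5_relation: "(F + G)^6 = F * G"
  unfolding FG_sum unfolding FG_hb power_mult_distrib by (simp add: eval_nat_numeral mult_ac)

definition odd_series :: "bit fps \<Rightarrow> bool" where "odd_series f \<longleftrightarrow> (\<forall>n. even n \<longrightarrow> f $ n = 0)"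
definition even_series :: "bit fps \<Rightarrow> bool" where "even_series f \<longleftrightarrow> (\<forall>n. odd n \<longrightarrow> f $ n = 0)"

lemma series_mult:
  "even_series f \<Longrightarrow> even_series g \<Longrightarrow> even_series (f * g)"
  "even_series f \<Longrightarrow> odd_series g \<Longrightarrow> odd_series (f * g)"
  "odd_series f \<Longrightarrow> even_series g \<Longrightarrow> odd_series (f * g)"
proof -
  have *: "(f * g) $ n = 0" if "\<And>i. i \<le> n \<Longrightarrow> f $ i = 0 \<or> g $ (n - i) = 0" for f g :: "bit fps" and n
    unfolding fps_mult_nth by (rule sum.neutral) (use that in auto)
  have sub: "even (n - i) \<longleftrightarrow> (even n \<longleftrightarrow> even i)" if "i \<le> n" for n i :: nat
    using that by (auto simp: even_diff_nat)
  show "even_series f \<Longrightarrow> even_series g \<Longrightarrow> even_series (f * g)"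
    unfolding even_series_def by (intro allI impI *) (use sub in blast)
  show "even_series f \<Longrightarrow> odd_series g \<Longrightarrow> odd_series (f * g)"
    unfolding even_series_def odd_series_def by (intro allI impI *) (use sub in blast)
  show "odd_series f \<Longrightarrow> even_series g \<Longrightarrow> odd_series (f * g)"
    unfolding even_series_def odd_series_def by (intro allI impI *) (use sub in blast)
qed

lemma even_series_square: "even_series (f\<^sup>2)"
  unfolding even_series_def by (intro allI impI) (simp only: fps_square_nth_char2 if_False)

lemma odd_series_FG: "odd_series F" "odd_series G" "odd_series (F + G)"
proof -
  show f: "odd_series F" by (auto simp: odd_series_def F_nth)
  show g: "odd_series G" unfolding odd_series_def
  proof (intro allI impI)
    fix n :: nat assume "even n"
    then have "even (n div 5)" if "5 dvd n" using that by presburger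
    then show "G $ n = 0" using f by (simp add: odd_series_def G_nth)
  qed
  show "odd_series (F + G)" using f g by (simp add: odd_series_def)
qed

lemma odd_series_monomial:
  assumes "odd (i + j)"
  shows "odd_series (F ^ i * G ^ j)"
proof -
  have e: "even_series (f ^ (2 * n))" for f and n by (simp only: power_mult power_commutes even_series_square mult.commute[of 2] power_mult[of f n 2])
  have o: "odd_series (f ^ (2 * n + 1))" if "odd_series f" for f n
    using series_mult(3)[OF that e[of f n]] by simp
  show ?thesis
  proof (cases "even i")
    case True
    then obtain a where a: "i = 2 * a" by (rule evenE)
    have "odd j" using assms True by simp
    then obtain b where b: "j = 2 * b + 1" by (rule oddE)
    show ?thesis unfolding a b by (intro series_mult(2) e o odd_series_FG)
  next
    case False
    then obtain a where a: "i = 2 * a + 1" by (rule oddE)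
    have "even j" using assms False by simp
    then obtain b where b: "j = 2 * b" by (rule evenE)
    show ?thesis unfolding a b by (intro series_mult(3) e o odd_series_FG)
  qed
qed

lemma pv_square: "pv (t\<^sup>2) P = (pv t P)\<^sup>2"
proof (induct P)
  case (pCons a P)
  have "(fps_const a)\<^sup>2 = fps_const a" by (cases a) simp_all
  then show ?case using pCons by (simp only: pv_pCons square_add power_mult_distrib)
qed (simp add: is_homD(1)[OF is_hom_pv])

text \<open>Every \<open>P\<close> is \<open>A(X\<^sup>2) + (X + X\<^sup>2) B(X\<^sup>2)\<close>, and \<open>X + X\<^sup>2\<close> is invariant under \<open>X \<mapsto> X + 1\<close>.\<close>
lemma poly_parity_split: "\<exists>A B. \<forall>t. pv t P = (pv t A)\<^sup>2 + (t + t\<^sup>2) * (pv t B)\<^sup>2"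
proof (induct P)
  case 0
  show ?case by (intro exI[of _ 0]) (simp add: is_homD(1)[OF is_hom_pv])
next
  case (pCons a P)
  then obtain A B where AB: "\<And>t. pv t P = (pv t A)\<^sup>2 + (t + t\<^sup>2) * (pv t B)\<^sup>2" by blast
  note h = is_homD[OF is_hom_pv]
  have c: "(fps_const a)\<^sup>2 = fps_const a" by (cases a) simp_all
  have X: "pv t [:0, 1:] = t" for t using pv_X[of t 0] by simp
  let ?A = "[:a:] + [:0, 1:] * A + ([:0, 1:] + [:0, 1:] * [:0, 1:]) * B"
  let ?B = "A + [:0, 1:] * B"
  have "pv t (pCons a P) = (pv t ?A)\<^sup>2 + (t + t\<^sup>2) * (pv t ?B)\<^sup>2" for t
  proof -
    have k: "pv t [:a:] = fps_const a" by (simp add: pv_pCons h(1))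
    have id: "t * (x\<^sup>2 + (t + t\<^sup>2) * y\<^sup>2) = (t * x + (t + t * t) * y)\<^sup>2 + (t + t\<^sup>2) * (x + t * y)\<^sup>2" for x y
      by (simp add: algebra_simps power2_eq_square char2_numeral add_self add_self_left)
    have "pv t (pCons a P) = (fps_const a)\<^sup>2 + t * ((pv t A)\<^sup>2 + (t + t\<^sup>2) * (pv t B)\<^sup>2)"
      by (simp only: pv_pCons AB c)
    also have "\<dots> = (fps_const a + (t * pv t A + (t + t * t) * pv t B))\<^sup>2 + (t + t\<^sup>2) * (pv t A + t * pv t B)\<^sup>2"
      unfolding id by (simp only: square_add[of "fps_const a"] add.assoc)
    finally show ?thesis by (simp only: h(3,4) X k add.assoc)
  qed
  then show ?case by blast
qed

text \<open>In the splitting of P the first term is an even series at \<open>hb\<close> and the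
  second an odd one. Oddness kills the first, and transcendence of \<open>hb\<close> makes this an
  identity of polynomials, which alone permits the evaluation at \<open>1 + hb\<close>.\<close>

lemma odd_modular:
  assumes "odd_series (pv hb P)"
  obtains B where "pv hb P = (F + G) * pv (hb\<^sup>2) B" "pv (1 + hb) P = (F + G) * pv ((1 + hb)\<^sup>2) B"
proof -
  obtain A B where AB: "\<And>t. pv t P = (pv t A)\<^sup>2 + (t + t\<^sup>2) * (pv t B)\<^sup>2" using poly_parity_split by blast
  have u: "(1 + hb) + (1 + hb)\<^sup>2 = F + G"
    unfolding hb_eq[symmetric] square_add by (simp add: add.assoc add.left_commute[of hb] add_self_left)
  have o: "odd_series ((F + G) * (pv hb B)\<^sup>2)" by (intro series_mult(3) odd_series_FG even_series_square)
  have "(pv hb A)\<^sup>2 = 0"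
  proof (rule fps_ext)
    fix n
    have "(pv hb P) $ n = ((pv hb A)\<^sup>2) $ n + ((F + G) * (pv hb B)\<^sup>2) $ n"
      by (simp only: AB hb_eq fps_add_nth)
    then show "((pv hb A)\<^sup>2) $ n = 0 $ n"
      using o assms even_series_square[of "pv hb A"] unfolding odd_series_def even_series_def
      by (cases "even n") (simp_all del: plus_bit_def)
  qed
  then have "pv hb A = 0" by simp
  then have "A = 0" using pv_nonzero[OF hb_0 hb_nonzero(1)] by blast
  then have "pv t P = (t + t\<^sup>2) * pv (t\<^sup>2) B" for t
    unfolding pv_square by (simp add: AB is_homD(1)[OF is_hom_pv])
  from this[of hb] this[of "1 + hb"] show ?thesis
    unfolding hb_eq u by (rule that)
qed

section \<open>Operators at the prime 5\<close>

definition U5 :: "bit fps \<Rightarrow> bit fps" where "U5 f = Abs_fps (\<lambda>n. f $ (5 * n))"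
definition pr :: "bit fps \<Rightarrow> bit fps" where "pr f = Abs_fps (\<lambda>n. if 5 dvd n then 0 else f $ n)"
definition V5 :: "bit fps \<Rightarrow> bit fps" where "V5 f = f oo fps_X ^ 5"

lemma V5_nth: "V5 f $ n = (if 5 dvd n then f $ (n div 5) else 0)"
  by (simp add: V5_def fps_nth_compose_X_power)

lemma V5_hom: "V5 (f + g) = V5 f + V5 g" "V5 (f * g) = V5 f * V5 g" "V5 (f ^ n) = V5 f ^ n" "V5 F = G"
  by (simp_all add: V5_def G_def fps_compose_add_distrib fps_compose_mult_distrib fps_compose_power)

lemma V5_mult_nth: "(V5 f * g) $ n = (\<Sum>i\<le>n div 5. f $ i * g $ (n - 5 * i))"
proof -
  have "(V5 f * g) $ n = (\<Sum>i\<in>{0..n}. V5 f $ i * g $ (n - i))" by (simp add: fps_mult_nth)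
  also have "\<dots> = (\<Sum>i\<in>(\<lambda>i. 5 * i) ` {..n div 5}. V5 f $ i * g $ (n - i))"
    by (rule sum.mono_neutral_right) (auto simp: V5_nth image_iff elim!: dvdE)
  also have "\<dots> = (\<Sum>i\<le>n div 5. f $ i * g $ (n - 5 * i))"
    by (subst sum.reindex) (auto simp: inj_on_def V5_nth)
  finally show ?thesis .
qed

lemma U5_V5_mult: "U5 (V5 f * g) = f * U5 g"
proof (rule fps_ext)
  fix n
  have "g $ (5 * n - 5 * i) = U5 g $ (n - i)" for i by (simp add: U5_def right_diff_distrib')
  then show "U5 (V5 f * g) $ n = (f * U5 g) $ n"
    unfolding fps_mult_nth[of f] by (simp only: U5_def fps_nth_Abs_fps V5_mult_nth atLeast0AtMost nonzero_mult_div_cancel_left[OF zero_neq_numeral[symmetric]] right_diff_distrib'[symmetric])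
qed

lemma pr_V5_mult: "pr (V5 f * g) = V5 f * pr g"
proof (rule fps_ext)
  fix n
  show "pr (V5 f * g) $ n = (V5 f * pr g) $ n"
    unfolding V5_mult_nth pr_def fps_nth_Abs_fps
  proof (cases "5 dvd n")
    case True
    then have "5 dvd n - 5 * i" for i by simp
    then show "(if 5 dvd n then 0 else \<Sum>i\<le>n div 5. f $ i * g $ (n - 5 * i)) =
      (\<Sum>i\<le>n div 5. f $ i * (if 5 dvd n - 5 * i then 0 else g $ (n - 5 * i)))" using True by simp
  next
    case False
    have "\<not> 5 dvd n - 5 * i" if "i \<le> n div 5" for i
    proof
      assume "5 dvd n - 5 * i"
      then have "5 dvd (n - 5 * i) + 5 * i" by (rule dvd_add) simp
      moreover have "(n - 5 * i) + 5 * i = n" using that by linarith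
      ultimately show False using False by simp
    qed
    then show "(if 5 dvd n then 0 else \<Sum>i\<le>n div 5. f $ i * g $ (n - 5 * i)) =
      (\<Sum>i\<le>n div 5. f $ i * (if 5 dvd n - 5 * i then 0 else g $ (n - 5 * i)))" using False by simp
  qed
qed

lemma U5_V5: "U5 (V5 f) = f" and U5_add: "U5 (f + g) = U5 f + U5 g"
  by (rule fps_ext, simp add: U5_def V5_nth)+

lemma pr_V5: "pr (V5 f) = 0" and pr_add: "pr (f + g) = pr f + pr g"
  by (rule fps_ext, simp add: pr_def V5_nth)+

lemma U5_square: "U5 (f\<^sup>2) = (U5 f)\<^sup>2"
proof (rule fps_ext)
  fix n :: nat
  have "5 * n div 2 = 5 * (n div 2)" "even (5 * n) \<longleftrightarrow> even n" if "even n" using that by (auto elim!: evenE)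
  moreover have "even (5 * n) \<longleftrightarrow> even n" by simp
  ultimately show "U5 (f\<^sup>2) $ n = (U5 f)\<^sup>2 $ n"
    by (cases "even n") (simp_all only: U5_def fps_nth_Abs_fps fps_square_nth_char2 if_True if_False)
qed

lemma pr_square: "pr (f\<^sup>2) = (pr f)\<^sup>2"
proof (rule fps_ext)
  fix n :: nat
  have "5 dvd n \<longleftrightarrow> 5 dvd n div 2" if "even n" using that by presburger
  then show "pr (f\<^sup>2) $ n = (pr f)\<^sup>2 $ n" by (simp add: pr_def fps_square_nth_char2)
qed

lemma pr_U5: "pr f = f \<longleftrightarrow> U5 f = 0"
  by (auto simp: fps_eq_iff pr_def U5_def elim!: dvdE)

lemma D_nth: "D $ m = (if \<exists>n::nat. coprime n 10 \<and> m = n\<^sup>2 then 1 else 0)"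
proof -
  have "coprime 0 (10::nat) \<longleftrightarrow> False" by simp
  then have "(\<exists>n::nat. n > 0 \<and> coprime n 10 \<and> m = n\<^sup>2) \<longleftrightarrow> (\<exists>n::nat. coprime n 10 \<and> m = n\<^sup>2)"
    by (metis gr0I)
  then show ?thesis by (simp add: D_def)
qed

lemma coprime_10_iff: "coprime n (10::nat) \<longleftrightarrow> odd n \<and> \<not> 5 dvd n"
proof -
  have "coprime n (10::nat) \<longleftrightarrow> coprime n 2 \<and> coprime n 5"
    using coprime_mult_right_iff[of n 2 5] by simp
  moreover have "coprime n (5::nat) \<longleftrightarrow> \<not> 5 dvd n"
  proof
    assume "coprime n 5"
    then show "\<not> 5 dvd n" by (auto dest: coprime_common_divisor_nat)
  next
    have p5: "prime (5::nat)" by simp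
    assume "\<not> 5 dvd n"
    then have "coprime 5 n" by (rule prime_imp_coprime[OF p5])
    then show "coprime n 5" by (simp only: coprime_commute)
  qed
  ultimately show ?thesis by (simp add: coprime_right_2_iff_odd)
qed

lemma F_split: "F = D + V5 G"
proof (rule fps_ext)
  fix m
  show "F $ m = (D + V5 G) $ m"
  proof (cases "\<exists>n. odd n \<and> m = n\<^sup>2")
    case True
    then obtain n where n: "odd n" "m = n\<^sup>2" by blast
    have p5: "prime (5::nat)" by simp
    have d5: "5 dvd m \<longleftrightarrow> 5 dvd n" unfolding n(2) using prime_dvd_power_iff[OF p5, of 2 n] by simp
    have uniq: "n = n'" if "m = n'\<^sup>2" for n' :: nat using that n(2) by simp
    show ?thesis
    proof (cases "5 dvd n")
      case True
      then obtain k where k: "n = 5 * k" by (auto simp: dvd_def)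
      have "\<not> (\<exists>n'. coprime n' 10 \<and> m = n'\<^sup>2)" using uniq True by (auto simp: coprime_10_iff)
      moreover have "m = 25 * k\<^sup>2" unfolding n(2) k by (simp add: power2_eq_square)
      then have "V5 G $ m = F $ (k\<^sup>2)" by (simp add: V5_nth G_nth)
      moreover have "F $ (k\<^sup>2) = 1" using n(1) k by (auto simp: F_nth)
      ultimately show ?thesis using n by (auto simp: F_nth D_nth)
    next
      case False
      then have "D $ m = 1" using n by (auto simp: D_nth coprime_10_iff)
      moreover have "V5 G $ m = 0" using d5 False by (simp add: V5_nth)
      ultimately show ?thesis using n by (auto simp: F_nth)
    qed
  next
    case False
    then have "F $ m = 0" by (simp add: F_nth)
    moreover have "D $ m = 0" using False by (auto simp: D_nth coprime_10_iff)
    moreover have "V5 G $ m = 0"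
    proof -
      have "F $ k = 0" if "m = 25 * k" for k
      proof -
        have "k \<noteq> n\<^sup>2" if "odd n" for n using False \<open>m = 25 * k\<close> that by (auto dest!: spec[of _ "5 * n"] simp: power_mult_distrib)
        then show ?thesis by (auto simp: F_nth)
      qed
      then show ?thesis by (auto simp: V5_nth G_nth elim!: dvdE)
    qed
    ultimately show ?thesis by simp
  qed
qed

lemma pr_D: "pr D = D" and U5_D: "U5 D = 0"
proof -
  show "pr D = D"
  proof (rule fps_ext)
    fix n
    have p5: "prime (5::nat)" by simp
    have "D $ n = 0" if "5 dvd n"
      using that prime_dvd_power[OF p5, of _ 2] by (auto simp: D_nth coprime_10_iff)
    then show "pr D $ n = D $ n" by (simp add: pr_def)
  qed
  then show "U5 D = 0" by (simp add: pr_U5)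
qed

lemma square_mod_5: "\<not> 5 dvd (n::nat) \<Longrightarrow> n\<^sup>2 mod 5 = 1 \<or> n\<^sup>2 mod 5 = 4"
proof -
  assume "\<not> 5 dvd n"
  then have "n mod 5 = 1 \<or> n mod 5 = 2 \<or> n mod 5 = 3 \<or> n mod 5 = 4" by presburger
  then show ?thesis by (auto simp: power2_eq_square mod_mult_eq[of n 5 n, symmetric])
qed

text \<open>The exponents of \<open>D\<^sup>3\<close> are of the form \<open>2a\<^sup>2 + b\<^sup>2\<close> with \<open>a\<close>, \<open>b\<close> prime to 5.\<close>
lemma U5_D3: "U5 (D^3) = 0"
proof (rule fps_ext)
  fix n
  have "(D\<^sup>2 * D) $ (5 * n) = 0"
    unfolding fps_mult_nth
  proof (rule sum.neutral, rule ballI)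
    fix i assume i: "i \<in> {0..5 * n}"
    show "(D\<^sup>2) $ i * D $ (5 * n - i) = 0"
    proof (rule ccontr)
      assume "(D\<^sup>2) $ i * D $ (5 * n - i) \<noteq> 0"
      then have nz: "(D\<^sup>2) $ i \<noteq> 0" "D $ (5 * n - i) \<noteq> 0" by (metis mult_zero_left, metis mult_zero_right)
      then have "even i" "D $ (i div 2) \<noteq> 0" by (auto simp: fps_square_nth_char2 split: if_splits)
      then obtain a b where ab: "\<not> 5 dvd a" "i div 2 = a\<^sup>2" "\<not> 5 dvd b" "5 * n - i = b\<^sup>2"
        using nz(2) by (auto simp: D_nth coprime_10_iff split: if_splits)
      then have "5 * n = 2 * a\<^sup>2 + b\<^sup>2" using i \<open>even i\<close> by auto
      then have "(2 * a\<^sup>2 + b\<^sup>2) mod 5 = 0" by (simp flip: \<open>5 * n = _\<close>)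
      moreover have "(2 * x + y) mod 5 \<noteq> 0" if "x mod 5 = 1 \<or> x mod 5 = 4" "y mod 5 = 1 \<or> y mod 5 = 4" for x y :: nat
      proof -
        have "(2 * x + y) mod 5 = (2 * (x mod 5) mod 5 + y mod 5) mod 5" by (simp only: mod_mult_right_eq mod_add_eq)
        then show ?thesis using that by auto
      qed
      ultimately show False using square_mod_5[OF ab(1)] square_mod_5[OF ab(3)] by metis
    qed
  qed
  then show "U5 (D^3) $ n = 0 $ n" by (simp only: U5_def fps_nth_Abs_fps power3_eq_cube power2_eq_square fps_zero_nth)
qed

section \<open>Odd polynomials in the Hauptmodul as combinations of six generators\<close>

definition comb :: "(nat \<Rightarrow> bit poly) \<Rightarrow> bit fps \<Rightarrow> bit fps \<Rightarrow> bit fps" where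
  "comb c f g = (\<Sum>i<5. pv (g\<^sup>2) (c i) * (f ^ i * g ^ (if even i then 1 else 0)))"

lemma comb_expand:
  "comb c f g = pv (g\<^sup>2) (c 0) * g + pv (g\<^sup>2) (c 1) * f + pv (g\<^sup>2) (c 2) * (f\<^sup>2 * g) + pv (g\<^sup>2) (c 3) * f^3
    + pv (g\<^sup>2) (c 4) * (f^4 * g)"
proof -
  have "{..<5} = {0, 1, 2, 3, 4::nat}" by auto
  then show ?thesis by (simp add: comb_def add.assoc)
qed

lemma comb_add: "comb (\<lambda>i. c i + d i) f g = comb c f g + comb d f g"
  by (simp only: comb_def is_homD[OF is_hom_pv] distrib_right sum.distrib)

lemma comb_mult: "comb (\<lambda>i. q * c i) f g = pv (g\<^sup>2) q * comb c f g"
  by (simp only: comb_def is_homD[OF is_hom_pv] sum_distrib_left mult.assoc)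

text \<open>Expressions in \<open>t\<close> that are \<open>\<int>/2[g\<^sup>2]\<close>-combinations of the five generators and \<open>f\<^sup>5\<close>, where
  \<open>f = t(1 + t)\<^sup>5\<close> and \<open>g = t\<^sup>5(1 + t)\<close>. Specializing \<open>t\<close> to \<open>hb\<close> gives \<open>(f, g) = (F, G)\<close>,
  and to \<open>1 + hb\<close> gives \<open>(G, F)\<close>.\<close>
definition six_gen :: "(bit fps \<Rightarrow> bit fps) \<Rightarrow> bool" where
  "six_gen \<phi> \<longleftrightarrow> (\<exists>c C. \<forall>t f g. f = t * (1 + t)^5 \<longrightarrow> g = t^5 * (1 + t) \<longrightarrow>
     \<phi> t = comb c f g + pv (g\<^sup>2) C * f^5)"

lemma six_gen_add:
  assumes "six_gen \<phi>" "six_gen \<psi>"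
  shows "six_gen (\<lambda>t. \<phi> t + \<psi> t)"
proof -
  obtain c C where c: "\<forall>t f g. f = t * (1 + t)^5 \<longrightarrow> g = t^5 * (1 + t) \<longrightarrow> \<phi> t = comb c f g + pv (g\<^sup>2) C * f^5"
    using assms(1) unfolding six_gen_def by blast
  obtain d D where d: "\<forall>t f g. f = t * (1 + t)^5 \<longrightarrow> g = t^5 * (1 + t) \<longrightarrow> \<psi> t = comb d f g + pv (g\<^sup>2) D * f^5"
    using assms(2) unfolding six_gen_def by blast
  have "\<phi> t + \<psi> t = comb (\<lambda>i. c i + d i) f g + pv (g\<^sup>2) (C + D) * f^5"
    if "f = t * (1 + t)^5" "g = t^5 * (1 + t)" for t f g
    using c[rule_format, OF that] d[rule_format, OF that]
    by (simp only: comb_add is_homD[OF is_hom_pv] distrib_right add_ac)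
  then show ?thesis unfolding six_gen_def by blast
qed

lemma six_gen_mult:
  assumes "six_gen \<phi>"
  shows "six_gen (\<lambda>t. pv ((t^5 * (1 + t))\<^sup>2) q * \<phi> t)"
proof -
  obtain c C where c: "\<forall>t f g. f = t * (1 + t)^5 \<longrightarrow> g = t^5 * (1 + t) \<longrightarrow> \<phi> t = comb c f g + pv (g\<^sup>2) C * f^5"
    using assms(1) unfolding six_gen_def by blast
  have "pv ((t^5 * (1 + t))\<^sup>2) q * \<phi> t = comb (\<lambda>i. q * c i) f g + pv (g\<^sup>2) (q * C) * f^5"
    if "f = t * (1 + t)^5" "g = t^5 * (1 + t)" for t f g
    using c[rule_format, OF that] that(2)
    by (simp only: comb_mult is_homD[OF is_hom_pv] distrib_left mult.assoc)
  then show ?thesis unfolding six_gen_def by blast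
qed

lemma pow_char2:
  fixes K :: "bit fps"
  shows "(1 + K)^2 = 1 + K^2" "(1 + K)^4 = 1 + K^4" "(1 + K)^5 = (1 + K^4) * (1 + K)"
    "(1 + K)^7 = (1 + K^4) * (1 + K^2) * (1 + K)" "(1 + K)^10 = (1 + K^8) * (1 + K^2)"
    "(1 + K)^12 = (1 + K^8) * (1 + K^4)"
proof -
  show 2: "(1 + K)^2 = 1 + K^2" by (simp add: square_add)
  show 4: "(1 + K)^4 = 1 + K^4" using power4_add[of 1 K] by simp
  have "(1 + K)^8 = ((1 + K)^4)^2" by (simp flip: power_mult)
  then have 8: "(1 + K)^8 = 1 + K^8" by (simp add: 4 square_add flip: power_mult)
  show "(1 + K)^5 = (1 + K^4) * (1 + K)" by (simp only: 4[symmetric] power_Suc2[symmetric]) simp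
  have "(1 + K)^7 = (1 + K)^4 * (1 + K)^2 * (1 + K)" by (simp only: power_Suc2[symmetric] power_add[symmetric]) simp
  then show "(1 + K)^7 = (1 + K^4) * (1 + K^2) * (1 + K)" by (simp only: 2 4)
  have "(1 + K)^10 = (1 + K)^8 * (1 + K)^2" by (simp only: power_add[symmetric]) simp
  then show "(1 + K)^10 = (1 + K^8) * (1 + K^2)" by (simp only: 2 8)
  have "(1 + K)^12 = (1 + K)^8 * (1 + K)^4" by (simp only: power_add[symmetric]) simp
  then show "(1 + K)^12 = (1 + K^8) * (1 + K^4)" by (simp only: 4 8)
qed

text \<open>Here K stands for the square of the Hauptmodul t, and g for the square of t^5 (1 + t).
  Multiplied by t + t^2, the elements e0, ..., e5 become the five generators and the fifth power of
  f = t (1 + t)^5. The identities express 1, K, K^3, K^4, K^5 through them over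
  \<open>Z/2[g]\<close>; K^2 is e0 itself.\<close>

lemma hauptmodul_square_identities:
  fixes K :: "bit fps"
  defines "g \<equiv> K^5 * (1 + K)" and "e0 \<equiv> K^2" and "e1 \<equiv> (1 + K)^2" and "e2 \<equiv> K^3 * (1 + K)^5"
    and "e3 \<equiv> K * (1 + K)^7" and "e4 \<equiv> K^4 * (1 + K)^10" and "e5 \<equiv> K^2 * (1 + K)^12"
  shows "1 = e0 + e1"
    "K = e0 + g * e0 + g * e1 + e2 + e3"
    "K^3 = e0 + g * e0 + g^2 * e0 + g^2 * e1 + e2 + e4 + e5"
    "K^4 = e0 + g^2 * e0 + g^2 * e1 + e4 + e5"
    "K^5 = e0 + g * e0 + g * e1 + g^2 * e1 + e5"
  unfolding g_def e0_def e1_def e2_def e3_def e4_def e5_def pow_char2 power_mult_distrib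
  by (simp_all add: distrib_left distrib_right power_Suc[symmetric] power_Suc2[symmetric] power_add[symmetric] power_mult[symmetric]
     power2_eq_square[symmetric]     add_ac add_self add_self_left del: power_Suc)

lemma six_gen_combination:
  assumes "\<And>K g. g = K^5 * (1 + K) \<Longrightarrow> \<phi> K = pv g q0 * K^2 + pv g q1 * (1 + K)^2 + pv g q2 * (K^3 * (1 + K)^5)
    + pv g q3 * (K * (1 + K)^7) + pv g q4 * (K^4 * (1 + K)^10) + pv g q5 * (K^2 * (1 + K)^12)"
  shows "six_gen (\<lambda>t. (t + t\<^sup>2) * \<phi> (t\<^sup>2))"
  unfolding six_gen_def
proof (rule exI[of _ "\<lambda>i. [q0, q1, q2, q3, q4] ! i"], rule exI[of _ q5], intro allI impI)
  fix t f g :: "bit fps"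
  assume f: "f = t * (1 + t)^5" and g: "g = t^5 * (1 + t)"
  define s where "s = 1 + t"
  have K: "1 + t\<^sup>2 = s\<^sup>2" by (simp add: s_def square_add)
  have u: "t + t\<^sup>2 = t * s" by (simp add: s_def distrib_left power2_eq_square)
  have g2: "g\<^sup>2 = (t\<^sup>2)^5 * (1 + t\<^sup>2)" unfolding K g s_def[symmetric] by (simp add: power_mult_distrib flip: power_mult)
  have e: "t * s * (t\<^sup>2)^2 = g" "t * s * (s\<^sup>2)^2 = f" "t * s * ((t\<^sup>2)^3 * (s\<^sup>2)^5) = f\<^sup>2 * g"
    "t * s * (t\<^sup>2 * (s\<^sup>2)^7) = f^3" "t * s * ((t\<^sup>2)^4 * (s\<^sup>2)^10) = f^4 * g" "t * s * ((t\<^sup>2)^2 * (s\<^sup>2)^12) = f^5"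
    unfolding f g s_def[symmetric]
    by (simp_all add: eval_nat_numeral mult_ac)
  have sw: "t * s * (pv a q * x) = pv a q * (t * s * x)" for a q x by (simp only: mult_ac)
  have "(t + t\<^sup>2) * \<phi> (t\<^sup>2) = pv (g\<^sup>2) q0 * g + pv (g\<^sup>2) q1 * f + pv (g\<^sup>2) q2 * (f\<^sup>2 * g) + pv (g\<^sup>2) q3 * f^3
    + pv (g\<^sup>2) q4 * (f^4 * g) + pv (g\<^sup>2) q5 * f^5"
    unfolding assms[OF g2] K u by (simp only: distrib_left sw e)
  then show "(t + t\<^sup>2) * \<phi> (t\<^sup>2) = comb (\<lambda>i. [q0, q1, q2, q3, q4] ! i) f g + pv (g\<^sup>2) q5 * f^5"
    unfolding comb_expand by simp
qed

lemma six_gen_monomial: "six_gen (\<lambda>t. (t + t\<^sup>2) * (t\<^sup>2)^m)"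
proof (induct m rule: less_induct)
  case (less m)
  have p1: "pv g 0 = 0" "pv g [:1:] = 1" "pv g [:0, 1:] = g" "pv g [:1, 1:] = 1 + g" "pv g [:1, 0, 1:] = 1 + g^2"
    "pv g [:0, 0, 1:] = g^2" "pv g [:1, 1, 1:] = 1 + g + g^2" "pv g [:0, 1, 1:] = g + g^2" for g
    by (simp_all add: pv_pCons is_homD(1)[OF is_hom_pv] power2_eq_square distrib_left add.assoc)
  note id = hauptmodul_square_identities
  show ?case
  proof (cases "m < 6")
    case True
    then consider "m = 0" | "m = 1" | "m = 2" | "m = 3" | "m = 4" | "m = 5" by linarith
    then show ?thesis
    proof cases
      case 1
      show ?thesis unfolding 1
        by (rule six_gen_combination[where ?q0.0 = "[:1:]" and ?q1.0 = "[:1:]" and ?q2.0 = 0 and ?q3.0 = 0 and ?q4.0 = 0 and ?q5.0 = 0])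
          (simp only: p1 mult_zero_left mult_1_left add_0_right power_0, rule id(1))
    next
      case 2
      show ?thesis unfolding 2
        by (rule six_gen_combination[where ?q0.0 = "[:1, 1:]" and ?q1.0 = "[:0, 1:]" and ?q2.0 = "[:1:]" and ?q3.0 = "[:1:]" and ?q4.0 = "0" and ?q5.0 = "0"])
          (simp only: p1 mult_zero_left mult_1_left add_0_right power_0 power_one_right, rule trans[OF id(2)], simp only: distrib_right mult_1_left add_ac)
    next
      case 3
      show ?thesis unfolding 3
        by (rule six_gen_combination[where ?q0.0 = "[:1:]" and ?q1.0 = "0" and ?q2.0 = "0" and ?q3.0 = "0" and ?q4.0 = "0" and ?q5.0 = "0"])
          (simp only: p1 mult_zero_left mult_1_left add_0_right)
    next
      case 4
      show ?thesis unfolding 4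
        by (rule six_gen_combination[where ?q0.0 = "[:1, 1, 1:]" and ?q1.0 = "[:0, 0, 1:]" and ?q2.0 = "[:1:]" and ?q3.0 = "0" and ?q4.0 = "[:1:]" and ?q5.0 = "[:1:]"])
          (simp only: p1 mult_zero_left mult_1_left add_0_right power_0 power_one_right, rule trans[OF id(3)], simp only: distrib_right mult_1_left add_ac)
    next
      case 5
      show ?thesis unfolding 5
        by (rule six_gen_combination[where ?q0.0 = "[:1, 0, 1:]" and ?q1.0 = "[:0, 0, 1:]" and ?q2.0 = "0" and ?q3.0 = "0" and ?q4.0 = "[:1:]" and ?q5.0 = "[:1:]"])
          (simp only: p1 mult_zero_left mult_1_left add_0_right power_0 power_one_right, rule trans[OF id(4)], simp only: distrib_right mult_1_left add_ac)
    next
      case 6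
      show ?thesis unfolding 6
        by (rule six_gen_combination[where ?q0.0 = "[:1, 1:]" and ?q1.0 = "[:0, 1, 1:]" and ?q2.0 = "0" and ?q3.0 = "0" and ?q4.0 = "0" and ?q5.0 = "[:1:]"])
          (simp only: p1 mult_zero_left mult_1_left add_0_right power_0 power_one_right, rule trans[OF id(5)], simp only: distrib_right mult_1_left add_ac)
    qed
  next
    case False
    then obtain k where k: "m = k + 6" by (metis le_add_diff_inverse2 not_less)
    \<comment> \<open>Recursion from K^6 = K^5 + K^5 (1 + K) with K = t^2, where K^5 (1 + K) is the
      square of t^5 (1 + t) and thus a scalar.\<close>
    have "six_gen (\<lambda>t. (t + t\<^sup>2) * (t\<^sup>2)^(k + 5) + pv ((t^5 * (1 + t))\<^sup>2) [:0, 1:] * ((t + t\<^sup>2) * (t\<^sup>2)^k))"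
      by (intro six_gen_add six_gen_mult less) (simp_all add: k)
    moreover have "(t + t\<^sup>2) * (t\<^sup>2)^(k + 5) + pv ((t^5 * (1 + t))\<^sup>2) [:0, 1:] * ((t + t\<^sup>2) * (t\<^sup>2)^k) = (t + t\<^sup>2) * (t\<^sup>2)^m" for t
    proof -
      define K where "K = t\<^sup>2"
      have "(t^5 * (1 + t))\<^sup>2 = K^5 * (1 + K)"
        by (simp add: K_def power_mult_distrib square_add flip: power_mult)
      then have "(t + t\<^sup>2) * K^(k + 5) + pv ((t^5 * (1 + t))\<^sup>2) [:0, 1:] * ((t + t\<^sup>2) * K^k) =
         (t + t\<^sup>2) * (K^k * (K^5 + K^5 * (1 + K)))"
        by (simp only: p1 power_add distrib_left mult_ac)
      also have "K^5 + K^5 * (1 + K) = K^6" by (simp add: distrib_left add_self_left eval_nat_numeral)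
      finally show ?thesis by (simp only: K_def k power_add)
    qed
    ultimately show ?thesis by (simp only:)
  qed
qed

lemma six_gen_poly: "six_gen (\<lambda>t. (t + t\<^sup>2) * (t\<^sup>2)^m * pv (t\<^sup>2) B)"
proof (induct B arbitrary: m)
  case 0
  have "six_gen (\<lambda>t. 0)" unfolding six_gen_def
    by (rule exI[of _ "\<lambda>_. 0"], rule exI[of _ 0]) (simp add: comb_def is_homD(1)[OF is_hom_pv])
  then show ?case by (simp add: is_homD(1)[OF is_hom_pv])
next
  case (pCons a B)
  have c: "pv x [:a:] = fps_const a" for x by (simp add: pv_pCons is_homD(1)[OF is_hom_pv])
  have "six_gen (\<lambda>t. pv ((t^5 * (1 + t))\<^sup>2) [:a:] * ((t + t\<^sup>2) * (t\<^sup>2)^m) + (t + t\<^sup>2) * (t\<^sup>2)^(Suc m) * pv (t\<^sup>2) B)"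
    by (intro six_gen_add six_gen_mult six_gen_monomial pCons)
  then show ?case unfolding c by (simp add: pv_pCons distrib_left mult_ac)
qed

lemma odd_modular_comb:
  assumes "odd_series (pv hb P)"
  obtains c C where "pv hb P = comb c F G + pv (G\<^sup>2) C * F^5" "pv (1 + hb) P = comb c G F + pv (F\<^sup>2) C * G^5"
proof -
  obtain B where B: "pv hb P = (F + G) * pv (hb\<^sup>2) B" "pv (1 + hb) P = (F + G) * pv ((1 + hb)\<^sup>2) B"
    using odd_modular[OF assms] by blast
  obtain c C where c: "\<And>t f g. f = t * (1 + t)^5 \<Longrightarrow> g = t^5 * (1 + t) \<Longrightarrow>
      (t + t\<^sup>2) * (t\<^sup>2)^0 * pv (t\<^sup>2) B = comb c f g + pv (g\<^sup>2) C * f^5"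
    using six_gen_poly[of 0 B] unfolding six_gen_def by blast
  have u: "(1 + hb) + (1 + hb)\<^sup>2 = F + G"
    unfolding hb_eq[symmetric] square_add by (simp add: add.assoc add.left_commute[of hb] add_self_left)
  have s: "1 + (1 + hb) = hb" by (simp add: add_self_left)
  show ?thesis
  proof
    show "pv hb P = comb c F G + pv (G\<^sup>2) C * F^5" using c[OF FG_hb] unfolding B(1) hb_eq by simp
    have "G = (1 + hb) * (1 + (1 + hb))^5" "F = (1 + hb)^5 * (1 + (1 + hb))" unfolding s
      by (subst FG_hb, simp only: mult.commute)+
    from c[OF this] show "pv (1 + hb) P = comb c G F + pv (F\<^sup>2) C * G^5" unfolding B(2) u by simp
  qed
qed

lemma pv_sum_coeff:
  assumes "degree P < n"
  shows "pv t P = (\<Sum>j<n. fps_const (coeff P j) * t ^ j)"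
  using assms
proof (induct P arbitrary: n)
  case (pCons a P)
  show ?case
  proof (cases n)
    case (Suc m)
    have "pv t P = (\<Sum>j<m. fps_const (coeff P j) * t ^ j)"
    proof (cases "P = 0")
      case False
      then show ?thesis using pCons Suc by simp
    qed (simp add: is_homD(1)[OF is_hom_pv])
    then show ?thesis unfolding Suc sum.lessThan_Suc_shift
      by (simp add: pv_pCons sum_distrib_left mult_ac)
  qed (use pCons in simp)
qed (simp add: is_homD(1)[OF is_hom_pv])

lemma pv_Poly: "pv t (\<Sum>j<n. monom (a j) j) = (\<Sum>j<n. fps_const (a j) * t ^ j)"
proof -
  have "pv t (monom b j) = fps_const b * t ^ j" for b j
    by (induct j) (simp_all add: monom_0 monom_Suc pv_pCons is_homD(1)[OF is_hom_pv] mult_ac)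
  then show ?thesis by (simp add: is_hom_sum[OF is_hom_pv])
qed

lemma N2gens_nth: "i < 5 \<Longrightarrow> N2gens ! i = F ^ i * G ^ (if even i then 1 else 0)"
proof -
  assume "i < 5"
  then consider "i = 0" | "i = 1" | "i = 2" | "i = 3" | "i = 4" by linarith
  then show ?thesis by cases (simp_all add: N2gens_def)
qed

lemma N2_eq: "N2 = range (\<lambda>c. comb c F G)"
proof (intro equalityI subsetI)
  fix f assume "f \<in> N2"
  then obtain n c where f: "f = (\<Sum>i<5. (\<Sum>j<n. fps_const (c i j) * G ^ (2 * j)) * N2gens ! i)"
    unfolding N2_def by blast
  have "f = comb (\<lambda>i. \<Sum>j<n. monom (c i j) j) F G"
    unfolding f comb_def pv_Poly by (rule sum.cong) (simp_all add: N2gens_nth power_mult)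
  then show "f \<in> range (\<lambda>c. comb c F G)" by blast
next
  fix f assume "f \<in> range (\<lambda>c. comb c F G)"
  then obtain c where f: "f = comb c F G" by blast
  define n where "n = Suc (\<Sum>i<5. degree (c i))"
  have "degree (c i) < n" if "i < 5" for i
    unfolding n_def less_Suc_eq_le by (rule member_le_sum) (use that in auto)
  then have "f = (\<Sum>i<5. (\<Sum>j<n. fps_const (coeff (c i) j) * G ^ (2 * j)) * N2gens ! i)"
    unfolding f comb_def by (intro sum.cong refl) (simp add: pv_sum_coeff[where n = n] N2gens_nth power_mult)
  then show "f \<in> N2" unfolding N2_def mem_Collect_eq
    by (intro exI[of _ n] exI[of _ "\<lambda>i j. coeff (c i) j"]) simp
qed

lemma N2_add: "f \<in> N2 \<Longrightarrow> g \<in> N2 \<Longrightarrow> f + g \<in> N2"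
  unfolding N2_eq by (auto simp flip: comb_add)

lemma N2_0: "0 \<in> N2"
proof -
  have "comb (\<lambda>_. 0) F G = 0" by (simp add: comb_def is_homD(1)[OF is_hom_pv])
  then show ?thesis unfolding N2_eq by (metis rangeI)
qed

lemma N2_sum: "(\<And>i. i \<in> A \<Longrightarrow> f i \<in> N2) \<Longrightarrow> sum f A \<in> N2"
  by (induct A rule: infinite_finite_induct) (auto simp: N2_add N2_0)

lemma N2_mult: "f \<in> N2 \<Longrightarrow> pv (G\<^sup>2) q * f \<in> N2"
  unfolding N2_eq by (auto simp flip: comb_mult)

lemma N2_gen:
  assumes "i < 5"
  shows "F ^ i * G ^ (if even i then 1 else 0) \<in> N2"
proof -
  have "comb (\<lambda>k. if k = i then 1 else 0) F G = (\<Sum>k<5. if k = i then F ^ i * G ^ (if even i then 1 else 0) else 0)"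
    unfolding comb_def by (rule sum.cong) (simp_all add: is_homD(1,2)[OF is_hom_pv])
  then have "comb (\<lambda>k. if k = i then 1 else 0) F G = F ^ i * G ^ (if even i then 1 else 0)"
    using assms by (simp only: sum.delta finite_lessThan lessThan_iff if_True)
  then show ?thesis unfolding N2_eq by (metis rangeI)
qed

section \<open>Stability of the module N2\<close>

lemma T_add: "T p (f + g) = T p f + T p g"
proof (rule fps_ext)
  fix n
  show "T p (f + g) $ n = (T p f + T p g) $ n"
    by (cases "p dvd n") (simp_all only: T_def fps_nth_Abs_fps fps_add_nth add_ac if_True if_False add_0_right add_0_left)
qed

lemma T_0: "T p 0 = 0"
  by (rule fps_ext) (simp add: T_def)

lemma T_sum: "T p (sum f A) = (\<Sum>i\<in>A. T p (f i))"
  by (induct A rule: infinite_finite_induct) (simp_all add: T_add T_0)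

lemma T_const_mult: "T p (fps_const a * f) = fps_const a * T p f"
  by (cases a) (simp_all add: T_0)

lemma T_odd_series:
  assumes "odd p" "odd_series f"
  shows "odd_series (T p f)"
  unfolding odd_series_def
proof (intro allI impI)
  fix n :: nat assume n: "even n"
  have "even (n div p)" if "p dvd n"
    using that n assms(1) even_mult_iff[of p "n div p"] by simp
  then show "T p f $ n = 0" using assms(2) n by (simp add: T_def odd_series_def)
qed

lemma T_U5_pr:
  assumes "prime p" "p \<noteq> 5"
  shows "U5 (T p f) = T p (U5 f)" "pr (T p f) = T p (pr f)"
proof -
  have p5: "prime (5::nat)" by simp
  have np: "\<not> p dvd 5" "\<not> 5 dvd p" using assms primes_dvd_imp_eq p5 by (metis, metis)
  have d1: "p dvd 5 * n \<longleftrightarrow> p dvd n" for n using np(1) assms(1) by (simp add: prime_dvd_mult_iff)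
  have d2: "5 dvd p * n \<longleftrightarrow> 5 dvd n" for n using np(2) p5 prime_dvd_mult_iff by blast
  have d3: "5 * n div p = 5 * (n div p)" if "p dvd n" for n using that by (simp add: div_mult_swap)
  have d4: "5 dvd n \<longleftrightarrow> 5 dvd n div p" if "p dvd n" for n
    using that d2 by (metis dvd_mult_div_cancel)
  show "U5 (T p f) = T p (U5 f)"
    by (rule fps_ext) (simp add: U5_def T_def d1 d3 mult.left_commute[of p])
  show "pr (T p f) = T p (pr f)"
    by (rule fps_ext) (simp add: pr_def T_def d2 d4)
qed

lemma V5_pv: "V5 (pv t P) = pv (V5 t) P"
proof (induct P)
  case (pCons a P)
  have "V5 (fps_const a) = fps_const a" by (simp add: V5_def)
  then show ?case using pCons by (simp add: pv_pCons V5_hom)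
qed (simp add: is_homD(1)[OF is_hom_pv] V5_def)

text \<open>Expanding powers of F = D + V5 G, the mixed terms disappear because \<open>U5\<close>
  kills D, D^2 and D^3; the powers 2 and 4 follow from Frobenius.\<close>

lemma U5_power_F: "i < 5 \<Longrightarrow> U5 (F ^ i) = G ^ i"
proof -
  have 0: "U5 1 = 1" by (rule fps_ext) (simp add: U5_def)
  have 1: "U5 F = G" by (subst F_split) (simp add: U5_add U5_D U5_V5)
  have 2: "U5 (F\<^sup>2) = G\<^sup>2" by (simp add: U5_square 1)
  have "U5 ((F\<^sup>2)\<^sup>2) = (G\<^sup>2)\<^sup>2" by (simp only: U5_square 1)
  then have 4: "U5 (F^4) = G^4" by (simp flip: power_mult)
  have "F^3 = D^3 + (V5 G * D\<^sup>2 + (V5 (G\<^sup>2) * D + V5 (G^3) * 1))"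
    by (subst F_split) (simp add: V5_hom eval_nat_numeral distrib_left distrib_right mult_ac add_ac add_self_left add_self)
  then have 3: "U5 (F^3) = G^3" by (simp only: U5_add U5_D3 U5_V5_mult U5_square U5_D 0) simp
  assume "i < 5"
  then consider "i = 0" | "i = 1" | "i = 2" | "i = 3" | "i = 4" by linarith
  then show ?thesis by cases (simp_all add: 0 1 2 3 4)
qed

text \<open>F^5 begins with x^5, so its image under \<open>U5\<close> has the term x, which G^5
  lacks.\<close>

lemma U5_power_F_5: "U5 (F^5) \<noteq> G^5"
proof
  assume e: "U5 (F^5) = G^5"
  have "U5 (F^5) $ 1 = (F $ 1)^5" using startsby_zero_power_nth_same[OF F_nth_0, of 5] by (simp add: U5_def)
  moreover have "G $ 0 = 0" by (simp add: G_nth F_nth_0)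
  then have "G^5 $ 1 = 0" by (intro startsby_zero_power_prefix[rule_format]) simp_all
  ultimately show False using e F_nth_1 by simp
qed

text \<open>The coefficients are series in G^2 = V5 (F^2) and can be pulled out of \<open>U5\<close>
  with F^2 in place of G^2; on the powers of F below the fifth, \<open>U5\<close> replaces F by G.
  So \<open>U5\<close> exchanges the two series.\<close>

lemma U5_comb: "U5 (comb c F G) = comb c G F"
proof -
  have sum: "U5 (sum f A) = (\<Sum>i\<in>A. U5 (f i))" for f and A :: "nat set"
    by (induct A rule: infinite_finite_induct) (simp_all add: U5_add, simp_all add: U5_def fps_eq_iff)
  show ?thesis unfolding comb_def sum
  proof (rule sum.cong)
    fix i :: nat assume "i \<in> {..<5}"
    then have i: "U5 (F ^ i) = G ^ i" using U5_power_F by simp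
    let ?e = "if even i then 1 else 0 :: nat"
    have e: "pv (G\<^sup>2) (c i) * (F ^ i * G ^ ?e) = V5 (pv (F\<^sup>2) (c i) * F ^ ?e) * F ^ i"
      by (simp only: V5_hom V5_pv mult_ac)
    show "U5 (pv (G\<^sup>2) (c i) * (F ^ i * G ^ ?e)) = pv (F\<^sup>2) (c i) * (G ^ i * F ^ ?e)"
      unfolding e U5_V5_mult i by (simp only: mult_ac)
  qed simp
qed

text \<open>\<open>U5\<close> acts on \<open>F\<^sup>i G\<^sup>j\<close>, hence on its image under \<open>T\<^sub>p\<close>, as the substitution of \<open>1 + hb\<close> for \<open>hb\<close>;
  this fails for \<open>F\<^sup>5\<close>, which excludes the sixth generator.\<close>
lemma T_N2_gen:
  assumes p: "prime p" "p \<noteq> 2" "p \<noteq> 5" and i: "i < 5" "odd (i + j)"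
  shows "T p (F ^ i * G ^ j) \<in> N2"
proof -
  have podd: "odd p" using p prime_ge_2_nat[of p] by (metis le_neq_implies_less prime_odd_nat)
  obtain P where P: "T p (F ^ i * G ^ j) = pv hb P" "T p (F ^ j * G ^ i) = pv (1 + hb) P"
    using hecke_modular[OF p] by blast
  have "odd_series (pv hb P)" unfolding P(1)[symmetric]
    by (intro T_odd_series podd odd_series_monomial i)
  then obtain c C where c: "pv hb P = comb c F G + pv (G\<^sup>2) C * F^5" "pv (1 + hb) P = comb c G F + pv (F\<^sup>2) C * G^5"
    by (rule odd_modular_comb)
  have "F ^ i * G ^ j = V5 (F ^ j) * F ^ i" by (simp only: V5_hom mult.commute)
  then have "U5 (F ^ i * G ^ j) = F ^ j * G ^ i" by (simp only: U5_V5_mult U5_power_F[OF i(1)])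
  then have "U5 (pv hb P) = pv (1 + hb) P"
    unfolding P[symmetric] by (simp only: T_U5_pr(1)[OF p(1,3)])
  moreover have "U5 (pv hb P) = comb c G F + pv (F\<^sup>2) C * U5 (F^5)"
  proof -
    have "pv (G\<^sup>2) C = V5 (pv (F\<^sup>2) C)" by (simp only: V5_pv V5_hom)
    then show ?thesis unfolding c(1) by (simp only: U5_add U5_comb U5_V5_mult)
  qed
  ultimately have "pv (F\<^sup>2) C * U5 (F^5) = pv (F\<^sup>2) C * G^5" unfolding c(2) by simp
  then have "pv (F\<^sup>2) C = 0" using U5_power_F_5 by simp
  moreover have "F\<^sup>2 $ 0 = 0" "F\<^sup>2 \<noteq> 0" using F_nth_0 F_nth_1 by (auto simp: power2_eq_square)
  ultimately have "C = 0" using pv_nonzero by blast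
  then show ?thesis unfolding P(1) c(1) N2_eq by (simp add: is_homD(1)[OF is_hom_pv])
qed

theorem T_N2:
  assumes p: "prime p" "p \<noteq> 2" "p \<noteq> 5" and f: "f \<in> N2"
  shows "T p f \<in> N2"
proof -
  obtain n c where f: "f = (\<Sum>i<5. (\<Sum>j<n. fps_const (c i j) * G ^ (2 * j)) * N2gens ! i)"
    using f unfolding N2_def by blast
  have "T p f = (\<Sum>i<5. \<Sum>j<n. fps_const (c i j) * T p (G ^ (2 * j) * N2gens ! i))"
    unfolding f by (simp only: sum_distrib_right T_sum T_const_mult mult.assoc)
  also have "\<dots> \<in> N2"
  proof (intro N2_sum)
    fix i j :: nat assume "i \<in> {..<5}"
    then have i: "i < 5" by simp
    let ?e = "if even i then 1 else 0 :: nat"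
    have "T p (F ^ i * G ^ (2 * j + ?e)) \<in> N2" by (rule T_N2_gen[OF p i]) simp
    also have "F ^ i * G ^ (2 * j + ?e) = G ^ (2 * j) * N2gens ! i"
      by (simp only: N2gens_nth[OF i] power_add mult_ac)
    finally show "fps_const (c i j) * T p (G ^ (2 * j) * N2gens ! i) \<in> N2"
      by (cases "c i j") (simp_all add: N2_0)
  qed
  finally show ?thesis .
qed

section \<open>The space W as an image of N2\<close>

lemma FG_nonzero: "F \<noteq> 0" "G \<noteq> 0"
proof -
  show "F \<noteq> 0" using F_nth_1 by auto
  show "G \<noteq> 0" unfolding FG_hb(2) using hb_nonzero by (metis mult_eq_0_iff power_not_zero)
qed

lemma D_nonzero: "D \<noteq> 0"
proof -
  have "D $ 1 = 1" unfolding D_nth by (auto intro: exI[of _ 1])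
  then show ?thesis by auto
qed

text \<open>With \<open>a = F + G\<close>, \<open>b = V5 F + V5 G\<close>: \<open>a + b = D\<close>, and the level 5 relation and its image under
  \<open>x \<mapsto> x\<^sup>5\<close> give \<open>a\<^sup>6 = F G\<close> and \<open>b\<^sup>6 = G (V5 G)\<close>.\<close>
lemma level25_relation: "G * (D^3 + D\<^sup>2 * V5 G + D * (V5 G)\<^sup>2 + G\<^sup>2 * D) = D^8"
proof -
  define H where "H = V5 G"
  define a where "a = F + G"
  define b where "b = G + H"
  define s where "s = a * b"
  have F: "F = D + H" unfolding H_def by (rule F_split)
  have ab: "a + b = D" by (simp add: a_def b_def F add_ac add_self add_self_left)
  have a6: "a^6 = F * G" using level5_relation by (simp add: a_def)
  have "V5 ((F + G)^6) = V5 (F * G)" by (simp only: level5_relation)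
  then have b6: "b^6 = G * H" by (simp only: V5_hom b_def H_def)
  have S: "a\<^sup>2 + b\<^sup>2 = D\<^sup>2" by (simp add: ab flip: square_add)
  \<comment> \<open>This is a^2 + a b + b^2, so that D e = a^3 + b^3, whose square is known from the
    two sixth powers.\<close>
  define e where "e = D\<^sup>2 + s"
  have r1: "D * (D * e\<^sup>2) = D * G"
  proof -
    have "D * (D * e\<^sup>2) = (D * e)\<^sup>2" by (simp add: power2_eq_square mult_ac)
    also have "D * e = a^3 + b^3"
      by (simp add: e_def s_def ab[symmetric] eval_nat_numeral algebra_simps char2_numeral add_self add_self_left)
    also have "(a^3 + b^3)\<^sup>2 = a^6 + b^6" by (simp add: square_add flip: power_mult)
    also have "\<dots> = G * (F + H)" by (simp only: a6 b6 distrib_left mult.commute)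
    finally show ?thesis by (simp add: F add.assoc add_self mult.commute)
  qed
  then have r1: "D * e\<^sup>2 = G" using D_nonzero by simp
  have r2: "D * (s * (D^4 + D\<^sup>2 * s + s\<^sup>2)) = D * G\<^sup>2"
  proof -
    have "b * a^6 + a * b^6 = G * (b * F + a * H)" by (simp only: a6 b6 distrib_left mult_ac)
    also have "b * F + a * H = D * G"
      by (simp add: a_def b_def F algebra_simps add_self add_self_left)
    finally have "b * a^6 + a * b^6 = D * G\<^sup>2" by (simp add: power2_eq_square mult_ac)
    moreover have "b * a^6 + a * b^6 = D * (s * (D^4 + D\<^sup>2 * s + s\<^sup>2))"
    proof -
      have D4: "D^4 = a^4 + b^4" by (simp only: ab[symmetric] power4_add)
      have D2: "D\<^sup>2 = a\<^sup>2 + b\<^sup>2" by (simp only: S)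
      show ?thesis unfolding D4 D2 s_def unfolding ab[symmetric]
        by (simp add: eval_nat_numeral algebra_simps char2_numeral add_self add_self_left)
    qed
    ultimately show ?thesis by simp
  qed
  then have r2: "s * (D^4 + D\<^sup>2 * s + s\<^sup>2) = G\<^sup>2" using D_nonzero by simp
  have s: "s = e + D\<^sup>2" by (simp add: e_def add_ac add_self_left)
  have "e^3 + D^6 = G\<^sup>2"
    using r2 unfolding s
    by (simp add: eval_nat_numeral algebra_simps char2_numeral add_self add_self_left)
  then have "D * e^3 + D * D^6 = D * G\<^sup>2" by (metis distrib_left)
  moreover have "D * e^3 = G * e" using r1 by (simp add: eval_nat_numeral mult_ac)
  ultimately have "G * e + D * D^6 = D * G\<^sup>2" by simp
  then have "D * D^6 = G * e + D * G\<^sup>2" by (metis add_self_left)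
  then have "D^8 = D * (G * (e + D * G))" by (simp add: eval_nat_numeral distrib_left mult_ac)
  also have "e + D * G = D\<^sup>2 + D * H + H\<^sup>2 + G\<^sup>2"
    by (simp add: e_def s_def a_def b_def F power2_eq_square algebra_simps add_self add_self_left)
  finally show ?thesis by (simp add: H_def eval_nat_numeral distrib_left mult_ac)
qed

lemma pr_mult_G: "pr (f * G) = pr f * G"
  using pr_V5_mult[of F f] by (simp add: V5_hom mult.commute)

lemma pr_F: "pr F = D" "pr (F\<^sup>2) = D\<^sup>2" "pr (F^4) = D^4"
proof -
  show 1: "pr F = D" by (subst F_split) (simp add: pr_add pr_D pr_V5)
  show "pr (F\<^sup>2) = D\<^sup>2" by (simp only: pr_square 1)
  have "pr ((F\<^sup>2)\<^sup>2) = (D\<^sup>2)\<^sup>2" by (simp only: pr_square 1)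
  then show "pr (F^4) = D^4" by (simp flip: power_mult)
qed

text \<open>This is the origin of D_3 = D^8/G: expanding F = D + V5 G leaves D^3 + D^2 V5 G + D (V5
  G)^2, which \<open>level25_relation\<close> evaluates up to the term G^2 D, that is, D_11.\<close>

lemma pr_F3: "pr (F^3) = D^8 / G + G\<^sup>2 * D"
proof -
  define R where "R = D^3 + D\<^sup>2 * V5 G + D * (V5 G)\<^sup>2"
  have "F^3 = D^3 + (V5 G * D\<^sup>2 + (V5 (G\<^sup>2) * D + V5 (G^3)))"
    by (subst F_split) (simp add: V5_hom eval_nat_numeral distrib_left distrib_right mult_ac add_ac add_self_left add_self)
  moreover have "pr (D^3) = D^3" by (simp add: pr_U5 U5_D3)
  ultimately have "pr (F^3) = D^3 + (V5 G * D\<^sup>2 + (V5 (G\<^sup>2) * D + 0))"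
    by (simp only: pr_add pr_V5_mult pr_V5 pr_square pr_D)
  then have R: "pr (F^3) = R" by (simp add: R_def V5_hom mult.commute add.assoc)
  have "D^8 = (R + G\<^sup>2 * D) * G" using level25_relation by (simp only: R_def mult.commute[of G])
  then have "D^8 / G = R + G\<^sup>2 * D" using FG_nonzero by simp
  then show ?thesis unfolding R by (simp add: add.assoc add_self)
qed

lemma Dk_mem_W: "0 < k \<Longrightarrow> coprime k 10 \<Longrightarrow> Dk k \<in> W"
  unfolding W_def mem_Collect_eq by (intro exI[of _ "{k}"] exI[of _ "\<lambda>_. 1"]) simp

lemma W_add:
  assumes "f \<in> W" "g \<in> W"
  shows "f + g \<in> W"
proof -
  obtain S c where f: "f = (\<Sum>k\<in>S. fps_const (c k) * Dk k)" "finite S" "S \<subseteq> {k. k > 0 \<and> coprime k 10}"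
    using assms(1) unfolding W_def by blast
  obtain S' c' where g: "g = (\<Sum>k\<in>S'. fps_const (c' k) * Dk k)" "finite S'" "S' \<subseteq> {k. k > 0 \<and> coprime k 10}"
    using assms(2) unfolding W_def by blast
  let ?c = "\<lambda>k. if k \<in> S then c k else 0" and ?c' = "\<lambda>k. if k \<in> S' then c' k else 0"
  have "f = (\<Sum>k\<in>S \<union> S'. fps_const (?c k) * Dk k)" "g = (\<Sum>k\<in>S \<union> S'. fps_const (?c' k) * Dk k)"
    unfolding f(1) g(1) by (rule sum.mono_neutral_cong_left; use f(2) g(2) in auto)+
  then have "f + g = (\<Sum>k\<in>S \<union> S'. fps_const (?c k + ?c' k) * Dk k)"
    by (simp only: sum.distrib[symmetric] distrib_right[symmetric] fps_const_add[symmetric])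
  moreover have "finite (S \<union> S')" "S \<union> S' \<subseteq> {k. k > 0 \<and> coprime k 10}" using f g by auto
  ultimately show ?thesis unfolding W_def mem_Collect_eq
    by (intro exI[of _ "S \<union> S'"] exI[of _ "\<lambda>k. ?c k + ?c' k"]) (simp only: simp_thms)
qed

lemma W_0: "0 \<in> W"
  unfolding W_def mem_Collect_eq by (intro exI[of _ "{}"]) simp

lemma W_sum: "(\<And>i. i \<in> A \<Longrightarrow> f i \<in> W) \<Longrightarrow> sum f A \<in> W"
  by (induct A rule: infinite_finite_induct) (auto simp: W_add W_0)

lemma W_mult:
  assumes "f \<in> W"
  shows "fps_const a * G ^ (2 * j) * f \<in> W"
proof -
  obtain S c where f: "f = (\<Sum>k\<in>S. fps_const (c k) * Dk k)" "S \<subseteq> {k. k > 0 \<and> coprime k 10}"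
    using assms unfolding W_def by blast
  have D: "G ^ (2 * j) * Dk k = Dk (k + 10 * j)" for k
    by (simp add: Dk_def distrib_left mult_ac flip: power_add)
  have "fps_const a * G ^ (2 * j) * f = (\<Sum>k\<in>S. fps_const (a * c k) * Dk (k + 10 * j))"
    unfolding f sum_distrib_left D[symmetric] fps_const_mult[symmetric] by (simp only: mult_ac)
  also have "\<dots> \<in> W"
  proof (rule W_sum)
    fix k assume "k \<in> S"
    then have "0 < k" "coprime k 10" using f by auto
    moreover have "5 dvd k + 10 * j \<longleftrightarrow> 5 dvd k" by presburger
    ultimately have "Dk (k + 10 * j) \<in> W" by (intro Dk_mem_W) (simp_all add: coprime_10_iff)
    then show "fps_const (a * c k) * Dk (k + 10 * j) \<in> W"
      by (cases "a * c k") (simp_all add: W_0)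
  qed
  finally show ?thesis .
qed

lemma pr_gen_mem_W:
  assumes "i < 5"
  shows "pr (F ^ i * G ^ (if even i then 1 else 0)) \<in> W"
proof -
  have D: "Dk 1 = D" "Dk 7 = D\<^sup>2 * G" "Dk 9 = D^4 * G" "Dk 3 = D^8 / G" "Dk 11 = G\<^sup>2 * D"
    by (simp_all add: Dk_def Dbase_def)
  have "Dk k \<in> W" if "k \<in> {1, 3, 7, 9, 11}" for k
    by (rule Dk_mem_W) (use that in \<open>auto simp: coprime_10_iff\<close>)
  from this[of 1] this[of 7] this[of 9] this[of 3] this[of 11]
  have W: "D \<in> W" "D\<^sup>2 * G \<in> W" "D^4 * G \<in> W" "D^8 / G \<in> W" "G\<^sup>2 * D \<in> W"
    unfolding D by simp_all
  have "pr (1 * G) = pr (V5 1) * G" by (simp only: pr_mult_G V5_def fps_compose_1)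
  then have 0: "pr G = 0" by (simp add: pr_V5)
  consider "i = 0" | "i = 1" | "i = 2" | "i = 3" | "i = 4" using assms by linarith
  then show ?thesis
    by cases (simp_all add: 0 pr_mult_G pr_F pr_F3 W W_0 W_add)
qed

lemma pr_sum: "pr (sum f A) = (\<Sum>i\<in>A. pr (f i))"
  by (induct A rule: infinite_finite_induct) (simp_all add: pr_add, simp_all add: pr_def fps_eq_iff)

text \<open>\<open>pr\<close> is linear over the series in G^2 and kills G. The other four
  generators of \<open>N2\<close> go to D_1, D_7, D_9 and D_3 + G^2 D_1, so the images span the same
  module as the four basic series of \<open>W\<close>.\<close>

lemma W_eq: "W = pr ` N2"
proof (intro equalityI subsetI)
  fix f assume "f \<in> pr ` N2"
  then obtain n' where "n' \<in> N2" "f = pr n'" by blast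
  then obtain n c where f: "f = pr (\<Sum>i<5. (\<Sum>j<n. fps_const (c i j) * G ^ (2 * j)) * N2gens ! i)"
    unfolding N2_def by blast
  have V: "fps_const a * G ^ (2 * j) = V5 (fps_const a * F ^ (2 * j))" for a j
    by (simp only: V5_hom) (simp add: V5_def)
  have "f = (\<Sum>i<5. \<Sum>j<n. fps_const (c i j) * G ^ (2 * j) * pr (N2gens ! i))"
    unfolding f sum_distrib_right pr_sum V pr_V5_mult ..
  also have "\<dots> \<in> W" by (intro W_sum W_mult) (simp add: N2gens_nth pr_gen_mem_W)
  finally show "f \<in> W" .
next
  have p: "f + g \<in> pr ` N2" if "f \<in> pr ` N2" "g \<in> pr ` N2" for f g
    using that by (auto simp: N2_add simp flip: pr_add)
  have z: "0 \<in> pr ` N2" using N2_0 by (intro image_eqI[of _ _ 0]) (simp add: pr_def fps_eq_iff)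
  have GV: "pv (G\<^sup>2) q = V5 (pv (F\<^sup>2) q)" for q by (simp only: V5_pv V5_hom)
  have m: "pv (G\<^sup>2) q * f \<in> pr ` N2" if "f \<in> pr ` N2" for q f
  proof -
    from that obtain g where g: "g \<in> N2" "f = pr g" by blast
    have "pv (G\<^sup>2) q * f = pr (pv (G\<^sup>2) q * g)" unfolding GV pr_V5_mult g(2) ..
    then show ?thesis using N2_mult[OF g(1)] by blast
  qed
  have g: "pr (F ^ i * G ^ (if even i then 1 else 0)) \<in> pr ` N2" if "i < 5" for i
    using N2_gen[OF that] by blast
  have D1: "D \<in> pr ` N2" using g[of 1] by (simp add: pr_F)
  have D7: "D\<^sup>2 * G \<in> pr ` N2" using g[of 2] by (simp add: pr_mult_G pr_F)
  have D9: "D^4 * G \<in> pr ` N2" using g[of 4] by (simp add: pr_mult_G pr_F)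
  have "D^8 / G = pr (F^3) + pv (G\<^sup>2) [:0, 1:] * D"
    unfolding pr_F3 pv_X by (simp add: add.assoc add_self)
  then have D3: "D^8 / G \<in> pr ` N2" using g[of 3] by (simp add: p m D1)
  have B: "Dbase r \<in> pr ` N2" for r unfolding Dbase_def by (simp add: D1 D3 D7 D9 z)
  have "Dk k \<in> pr ` N2" for k
  proof -
    have "pv t (monom 1 n) = t ^ n" for t n
      by (induct n) (simp_all add: monom_0 monom_Suc pv_pCons is_homD(1)[OF is_hom_pv])
    then have "Dk k = pv (G\<^sup>2) (monom 1 (k div 10)) * Dbase (k mod 10)" by (simp add: Dk_def power_mult)
    then show ?thesis using m[OF B] by simp
  qed
  then have k: "fps_const a * Dk k \<in> pr ` N2" for a k by (cases a) (simp_all add: z)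
  have s: "sum f A \<in> pr ` N2" if "\<And>i. f i \<in> pr ` N2" for f and A :: "nat set"
    using that by (induct A rule: infinite_finite_induct) (simp_all add: p z)
  fix f assume "f \<in> W"
  then show "f \<in> pr ` N2" unfolding W_def by (auto intro: s k)
qed

theorem theorem2p19:
  fixes p :: nat
  assumes "prime p" and "p \<noteq> 2" and "p \<noteq> 5"
  shows "T p ` N2 \<subseteq> N2 \<and> T p ` W \<subseteq> W"
proof
  show N: "T p ` N2 \<subseteq> N2" using T_N2[OF assms] by blast
  show "T p ` W \<subseteq> W"
    unfolding W_eq using N by (auto simp flip: T_U5_pr(2)[OF assms(1,3)])
qed

end
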